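(* Let $\{x\mapsto G(\lambda,x)\}_{\lambda\in I}$ be a majorant family, with extremal majorants $M(\lambda,z)$, and let $\nu$ be a non-negative Borel measure on $I$ satisfying $$\int_I\int_{-\infty}^{\infty}\{M(\lambda,x)-G(\lambda,x)\}\,dx\,d\nu(\lambda)<\infty.$$ Let $g:\mathbb{R}\to\mathbb{R}$ be a function defining a tempered distribution that is continuous on $\mathbb{R}$, differentiable on $\mathbb{R}\setminus\{0\}$, and such that $$\widehat{g}(\varphi)=\int_{-\infty}^{\infty}\Bigl\{\int_I\widehat{G}(\lambda,t)\,d\nu(\lambda)\Bigr\}\varphi(t)\,dt$$ for all Schwartz functions $\varphi$ supported on $[-1,1]^c$. Then there exists a unique extremal majorant $m(z)$ of exponential type $2\pi$ for $g(x)$. The function $m(x)$ interpolates the values of $g(x)$ at $\mathbb{Z}$ and satisfies $$\int_{-\infty}^{\infty}\{m(x)-g(x)\}\,dx=\int_I\int_{-\infty}^{\infty}\{M(\lambda,x)-G(\lambda,x)\}\,dx\,d\nu(\lambda).$$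
   Context: An entire function $F$ is of exponential type (at most) $2\pi$ if for every $\epsilon>0$ there is $C>0$ with $|F(z)|\le Ce^{(2\pi+\epsilon)|z|}$ for all $z\in\mathbb{C}$. An extremal majorant of exponential type $2\pi$ for $f$ is an entire function $F$ of exponential type at most $2\pi$, real valued on $\mathbb{R}$, with $F(x)\ge f(x)$ for all real $x$, that minimizes $\int_{-\infty}^\infty|F(x)-f(x)|\,dx$ among all such functions. Fourier transform: $\widehat{\varphi}(y)=\int_{-\infty}^\infty\varphi(x)e^{-2\pi i xy}\,dx$. A function $g$ defines a tempered distribution by $g(\varphi)=\int g(x)\varphi(x)\,dx$ for Schwartz $\varphi$, and $\widehat{g}(\varphi)=g(\widehat\varphi)$. Write $[-1,1]^c=(-\infty,-1)\cup(1,\infty)$. Let $I\subset\mathbb{R}$ be an interval. A family of real valued even functions $x\mapsto G(\lambda,x)$, $\lambda\in I$, is a majorant family if for each $\lambda\in I$: (i) $x\mapsto G(\lambda,x)$ is continuous on $\mathbb{R}$ and differentiable on $\mathbb{R}\setminus\{0\}$; (ii) there are constants $C=C(\lambda)>0$, $\epsilon=\epsilon(\lambda)>0$ with $|G(\lambda,x)|\le C(1+|x|)^{-1-\epsilon}$ and $|\widehat{G}(\lambda,t)|\le C(1+|t|)^{-1-\epsilon}$ for all $x,t\in\mathbb{R}$, where $\widehat G(\lambda,\cdot)$ is the Fourier transform in $x$; (iii) $t\mapsto\widehat{G}(\lambda,t)$ is non-negative and radially non-increasing; (v) there is a unique extremal majorant $z\mapsto M(\lambda,z)$ of exponential type $2\pi$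 for $G(\lambda,\cdot)$ that interpolates the values of $G(\lambda,x)$ at $\mathbb{Z}$. *)

theory Defs
  imports "HOL-Complex_Analysis.Complex_Analysis"
begin

definition exp_type_at_most :: "real \<Rightarrow> (complex \<Rightarrow> complex) \<Rightarrow> bool" where
  "exp_type_at_most \<tau> F \<longleftrightarrow>
     F holomorphic_on UNIV \<and>
     (\<forall>\<epsilon>>0. \<exists>C>0. \<forall>z. norm (F z) \<le> C * exp ((\<tau> + \<epsilon>) * norm z))"

definition majorant :: "real \<Rightarrow> (real \<Rightarrow> real) \<Rightarrow> (complex \<Rightarrow> complex) \<Rightarrow> bool" where
  "majorant \<tau> f F \<longleftrightarrow>
     exp_type_at_most \<tau> F \<and>
     (\<forall>x::real. F (of_real x) \<in> \<real>) \<and>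
     (\<forall>x::real. f x \<le> Re (F (of_real x)))"

text \<open>The integrals lie in \<open>[0, \<infinity>]\<close>, so a majorant at infinite distance from \<open>f\<close>
  is a legitimate (but worst possible) competitor.\<close>

definition extremal_majorant :: "real \<Rightarrow> (real \<Rightarrow> real) \<Rightarrow> (complex \<Rightarrow> complex) \<Rightarrow> bool" where
  "extremal_majorant \<tau> f F \<longleftrightarrow>
     majorant \<tau> f F \<and>
     (\<forall>H. majorant \<tau> f H \<longrightarrow>
        (\<integral>\<^sup>+x. ennreal \<bar>Re (F (of_real x)) - f x\<bar> \<partial>lborel)
          \<le> (\<integral>\<^sup>+x. ennreal \<bar>Re (H (of_real x)) - f x\<bar> \<partial>lborel))"

definition interpolates_at_ints :: "(real \<Rightarrow> real) \<Rightarrow> (complex \<Rightarrow> complex) \<Rightarrow> bool" where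
  "interpolates_at_ints f F \<longleftrightarrow> (\<forall>n::int. F (of_int n) = of_real (f (of_int n)))"

definition fourier :: "(real \<Rightarrow> complex) \<Rightarrow> real \<Rightarrow> complex" where
  "fourier \<phi> y = (\<integral>x. \<phi> x * exp (- 2 * pi * \<i> * x * y) \<partial>lborel)"

definition nth_vderiv :: "nat \<Rightarrow> (real \<Rightarrow> complex) \<Rightarrow> real \<Rightarrow> complex" where
  "nth_vderiv n = ((\<lambda>f x. vector_derivative f (at x)) ^^ n)"

definition schwartz :: "(real \<Rightarrow> complex) \<Rightarrow> bool" where
  "schwartz \<phi> \<longleftrightarrow>
     (\<forall>n x. nth_vderiv n \<phi> differentiable (at x)) \<and>
     (\<forall>k n. bounded (range (\<lambda>x. x ^ k *\<^sub>R nth_vderiv n \<phi> x)))"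

definition schwartz_seminorm :: "nat \<Rightarrow> nat \<Rightarrow> (real \<Rightarrow> complex) \<Rightarrow> real" where
  "schwartz_seminorm k n \<phi> = (SUP x. norm (x ^ k *\<^sub>R nth_vderiv n \<phi> x))"

definition pairing :: "(real \<Rightarrow> real) \<Rightarrow> (real \<Rightarrow> complex) \<Rightarrow> complex" where
  "pairing g \<phi> = (\<integral>x. of_real (g x) * \<phi> x \<partial>lborel)"

text \<open>The second conjunct is continuity of \<open>pairing g\<close> for the Schwartz topology.\<close>

definition defines_tempered_distribution :: "(real \<Rightarrow> real) \<Rightarrow> bool" where
  "defines_tempered_distribution g \<longleftrightarrow>
     (\<forall>\<phi>. schwartz \<phi> \<longrightarrow> integrable lborel (\<lambda>x. of_real (g x) * \<phi> x)) \<and>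
     (\<exists>C N. \<forall>\<phi>. schwartz \<phi> \<longrightarrow>
        norm (pairing g \<phi>) \<le> C * (\<Sum>k\<le>N. \<Sum>n\<le>N. schwartz_seminorm k n \<phi>))"

definition distr_fourier :: "(real \<Rightarrow> real) \<Rightarrow> (real \<Rightarrow> complex) \<Rightarrow> complex" where
  "distr_fourier g \<phi> = pairing g (fourier \<phi>)"

text \<open>The transform of an even real function is real. Membership in the non-negative reals
  is the non-negativity condition; the monotonicity condition compares real parts.\<close>

definition majorant_family :: "real set \<Rightarrow> (real \<Rightarrow> real \<Rightarrow> real) \<Rightarrow> bool" where
  "majorant_family I G \<longleftrightarrow>
     (\<forall>lam\<in>I.
        (\<forall>x. G lam (- x) = G lam x) \<and>
        continuous_on UNIV (G lam) \<and>
        (\<forall>x. x \<noteq> 0 \<longrightarrow> G lam differentiable (at x)) \<and>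
        (\<exists>C>0. \<exists>\<epsilon>>0.
           (\<forall>x. \<bar>G lam x\<bar> \<le> C * (1 + \<bar>x\<bar>) powr (- 1 - \<epsilon>)) \<and>
           (\<forall>t. norm (fourier (\<lambda>x. of_real (G lam x)) t) \<le> C * (1 + \<bar>t\<bar>) powr (- 1 - \<epsilon>))) \<and>
        (\<forall>t. fourier (\<lambda>x. of_real (G lam x)) t \<in> \<real>\<^sub>\<ge>\<^sub>0) \<and>
        (\<forall>s t. \<bar>s\<bar> \<le> \<bar>t\<bar> \<longrightarrow>
           Re (fourier (\<lambda>x. of_real (G lam x)) t) \<le> Re (fourier (\<lambda>x. of_real (G lam x)) s)) \<and>
        (\<exists>!F. extremal_majorant (2 * pi) (G lam) F \<and> interpolates_at_ints (G lam) F))"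

end

theory Submission
  imports Defs "HOL-Probability.Characteristic_Functions"
begin

text \<open>
  Write \<open>D(l, x) = M(l, x) - G(l, x)\<close> for the gap between \<open>G(l, \<cdot>)\<close> and its majorant, \<open>K(l)\<close> for the
  integral of \<open>D(l, \<cdot>)\<close>, and \<open>d(x)\<close> for the integral of \<open>D(l, x)\<close> over \<open>l\<close>.  The
  extremal majorant of \<open>g\<close> is \<open>m = g + d\<close>.

  \<^item> \<^emph>\<open>Why \<open>m\<close> is entire.\<close>  An integrable function of exponential type \<open>2 \<pi>\<close> has a Fourier
  transform that vanishes off \<open>[-1, 1]\<close> (\<open>fourier_exp_type_zero\<close>).  Applied to \<open>M(l, \<cdot>)\<close> this says
  that there the transform of \<open>D(l, \<cdot>)\<close> is the negative of that of \<open>G(l, \<cdot>)\<close>, so that the transform of \<open>d\<close>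
  cancels the given transform of \<open>g\<close>.  A continuous tempered function whose spectrum lies in
  \<open>[-1, 1]\<close> is the restriction of an entire function of exponential type \<open>2 \<pi>\<close>
  (\<open>paley_wiener_tempered\<close>).

  \<^item> \<^emph>\<open>Why \<open>m\<close> interpolates.\<close>  Each \<open>D(l, \<cdot>)\<close> vanishes at the integers, hence so does \<open>d\<close>; but \<open>m\<close> agrees
  with \<open>g + d\<close> at every point, and not only almost everywhere, because \<open>d\<close> is continuous.
  This follows by dominated convergence from \<open>D(l, x) \<le> B K(l)\<close> with \<open>B\<close> independent of \<open>l\<close>
  (\<open>gap_le\<close>), and here the non-negativity of the transform of \<open>G(l, \<cdot>)\<close> enters: off \<open>[-1, 1]\<close> the transform of \<open>D(l, \<cdot>)\<close> has
  constant sign, so its mass there is bounded by its mass near \<open>[-1, 1]\<close>.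

  \<^item> \<^emph>\<open>Why \<open>m\<close> is extremal, and the only extremal majorant.\<close>  If \<open>H\<close> is another majorant at finite distance from \<open>g\<close>,
  then \<open>H - m\<close> is integrable of exponential type \<open>2 \<pi>\<close>, and Poisson summation (\<open>poisson_sum\<close>) gives
  \<open>\<integral>(H - m) = \<Sum>(H(n) - g(n)) \<ge> 0\<close>.  In case of equality \<open>H - m\<close> vanishes at all integers, to second order
  at the non-zero ones, where \<open>g\<close> is differentiable and touched by both majorants; such a function is zero
  (\<open>zero_if_samples_zero\<close>).

  Interchanging the integrals over \<open>l\<close> and \<open>x\<close> needs \<open>M(l, x)\<close> to be measurable in \<open>l\<close>.  The integers
  determine \<open>M(l, \<cdot>)\<close>: its spectrum is an explicit series in the values \<open>G(l, n)\<close> and the derivatives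
  of \<open>G(l, \<cdot>)\<close> at \<open>n \<noteq> 0\<close> (\<open>reconstruction\<close>), and these depend measurably on \<open>l\<close>.
\<close>

section \<open>The Fourier transform of integrable functions\<close>

lemma fourier_cis: "fourier f y = (LBINT x. f x * cis (- (2 * pi * x * y)))"
  unfolding fourier_def cis_conv_exp by (simp add: algebra_simps)

lemma borel_measurable_cis [measurable]:
  assumes "f \<in> borel_measurable M"
  shows "(\<lambda>x. cis (f x)) \<in> borel_measurable M"
proof -
  have "cis \<in> borel_measurable borel"
    by (intro borel_measurable_continuous_onI continuous_intros)
  from measurable_compose[OF assms this] show ?thesis .
qed

lemma integrable_mult_cis:
  assumes "integrable M f" "h \<in> borel_measurable M"
  shows "integrable M (\<lambda>x. f x * cis (h x))"
  using assms by (intro Bochner_Integration.integrable_bound[OF assms(1)]) (auto simp: norm_mult)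

lemma norm_fourier_le: "norm (fourier f y) \<le> (LBINT x. norm (f x))"
  unfolding fourier_cis
  by (rule order_trans[OF integral_norm_bound]) (simp add: norm_mult)

lemma continuous_fourier:
  assumes f: "integrable lborel f"
  shows "continuous_on A (fourier f)"
proof -
  have "(\<lambda>n. fourier f (X n)) \<longlonglongrightarrow> fourier f y" if X: "X \<longlonglongrightarrow> y" for X y
    unfolding fourier_cis
  proof (rule integral_dominated_convergence[where w="\<lambda>x. norm (f x)"])
    show "AE x in lborel. (\<lambda>i. f x * cis (- (2 * pi * x * X i))) \<longlonglongrightarrow> f x * cis (- (2 * pi * x * y))"
      by (intro always_eventually allI tendsto_intros X)
  qed (use f in \<open>auto simp: norm_mult\<close>)
  then show ?thesis
    by (intro continuous_at_imp_continuous_on) (auto simp: continuous_at_sequentially o_def)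
qed

lemma borel_measurable_fourier [measurable]:
  assumes "integrable lborel f"
  shows "fourier f \<in> borel_measurable borel"
  by (intro borel_measurable_continuous_onI continuous_fourier assms)

text \<open>The multiplication formula moves a transform from one factor of a pairing to the other.\<close>
lemma fourier_multiplication:
  assumes f: "integrable lborel f" and g: "integrable lborel g"
  shows "(LBINT x. f x * fourier g x) = (LBINT t. fourier f t * g t)"
proof -
  have [measurable]: "f \<in> borel_measurable borel" "g \<in> borel_measurable borel"
    using f g by (auto dest: borel_measurable_integrable)
  have int: "integrable (lborel \<Otimes>\<^sub>M lborel) (\<lambda>(x, t). f x * g t * cis (- (2 * pi * t * x)))"
  proof (rule lborel_pair.Fubini_integrable)
    show "integrable lborel (\<lambda>x. LINT t|lborel. norm (case (x, t) of (x, t) \<Rightarrow> f x * g t * cis (- (2 * pi * t * x))))"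
      using f g by (auto simp: norm_mult)
    show "AE x in lborel. integrable lborel (\<lambda>t. case (x, t) of (x, t) \<Rightarrow> f x * g t * cis (- (2 * pi * t * x)))"
      using g by (intro AE_I2) (auto intro!: integrable_mult_cis)
  qed (simp_all add: borel_prod)
  have "(LBINT x. f x * fourier g x) = (LBINT x. (LBINT t. f x * g t * cis (- (2 * pi * t * x))))"
    unfolding fourier_cis
    by (intro Bochner_Integration.integral_cong refl)
       (simp add: mult.assoc integrable_mult_cis g)
  also have "\<dots> = (LBINT t. (LBINT x. f x * g t * cis (- (2 * pi * t * x))))"
    using lborel_pair.Fubini_integral[OF int] by simp
  also have "\<dots> = (LBINT t. fourier f t * g t)"
    unfolding fourier_cis
    by (intro Bochner_Integration.integral_cong refl, subst integral_mult_left_zero[symmetric])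
       (simp add: mult_ac)
  finally show ?thesis .
qed

lemma has_vector_derivative_quotient:
  fixes f :: "real \<Rightarrow> complex"
  assumes "((\<lambda>h. (f (x + h) - f x) / of_real h) \<longlongrightarrow> D) (at 0)"
  shows "(f has_vector_derivative D) (at x)"
proof -
  have "((\<lambda>h. norm ((f (x + h) - f x) / of_real h - D)) \<longlongrightarrow> 0) (at 0)"
    using assms tendsto_norm_zero LIM_zero by blast
  moreover have "eventually (\<lambda>h. norm ((f (x + h) - f x) / of_real h - D) = norm (f (x + h) - f x - h *\<^sub>R D) / norm h) (at (0::real))"
  proof (intro eventually_at_ball'[THEN eventually_mono, of 1])
    fix h :: real assume h: "h \<in> ball 0 1 \<and> h \<noteq> 0 \<and> h \<in> UNIV"
    then have "(f (x + h) - f x) / of_real h - D = (f (x + h) - f x - h *\<^sub>R D) / of_real h"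
      by (auto simp: field_simps scaleR_conv_of_real)
    then show "norm ((f (x + h) - f x) / of_real h - D) = norm (f (x + h) - f x - h *\<^sub>R D) / norm h"
      by (simp add: norm_divide)
  qed auto
  ultimately have "((\<lambda>h. norm (f (x + h) - f x - h *\<^sub>R D) / norm h) \<longlongrightarrow> 0) (at 0)"
    using tendsto_cong by force
  then show ?thesis
    unfolding has_vector_derivative_def has_derivative_at by (auto intro: bounded_linear_scaleR_left)
qed

lemma norm_cis_diff_le: "norm (cis a - cis b) \<le> \<bar>a - b\<bar>"
proof -
  have "norm (cis (a - b) - 1) \<le> \<bar>a - b\<bar>"
    using iexp_approx1[of "a - b" 0] by (simp add: cis_conv_exp)
  moreover have "cis a - cis b = cis b * (cis (a - b) - 1)"
    by (simp add: algebra_simps cis_mult)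
  ultimately show ?thesis by (simp add: norm_mult)
qed

lemma cis_has_vector_derivative:
  "((\<lambda>h. cis (h * c)) has_vector_derivative \<i> * of_real c * cis (x * c)) (at x)"
proof -
  have "((\<lambda>h. exp (of_real h * (\<i> * of_real c))) has_vector_derivative (\<i> * of_real c) * exp (of_real x * (\<i> * of_real c))) (at x)"
    by (rule has_vector_derivative_real_field) (auto intro!: derivative_eq_intros)
  then show ?thesis by (simp add: cis_conv_exp mult_ac)
qed

lemma cis_quotient_tendsto:
  assumes "X \<longlonglongrightarrow> 0" "\<And>n. X n \<noteq> 0"
  shows "(\<lambda>n. (cis (X n * c) - 1) / of_real (X n)) \<longlonglongrightarrow> \<i> * of_real c"
proof -
  have *: "((\<lambda>h. exp (h * (\<i> * of_real c))) has_field_derivative (\<i> * of_real c)) (at 0)"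
    by (auto intro!: derivative_eq_intros)
  then have "((\<lambda>h. (exp (h * (\<i> * of_real c)) - 1) / h) \<longlongrightarrow> \<i> * of_real c) (at 0)"
    by (simp add: has_field_derivative_iff)
  then have "((\<lambda>h. (exp (h * (\<i> * of_real c)) - 1) / h) \<circ> (\<lambda>n. of_real (X n))) \<longlonglongrightarrow> \<i> * of_real c"
    unfolding tendsto_at_iff_sequentially using assms by (auto simp: tendsto_of_real_iff[where 'a=complex, symmetric] simp del: tendsto_of_real_iff)
  then show ?thesis by (simp add: o_def cis_conv_exp mult_ac)
qed

text \<open>The difference quotients of the kernel in \<open>x\<close> are bounded by \<open>2 \<pi> \<bar>t\<bar>\<close>, so dominated convergence
  applies as soon as \<open>t f(t)\<close> is integrable.\<close>
lemma fourier_has_vector_derivative: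
  assumes f: "integrable lborel f" and tf: "integrable lborel (\<lambda>t. of_real t * f t)"
  shows "(fourier f has_vector_derivative fourier (\<lambda>t. - 2 * pi * \<i> * of_real t * f t) x) (at x)"
proof (rule has_vector_derivative_quotient, unfold tendsto_at_iff_sequentially, safe)
  fix X :: "nat \<Rightarrow> real"
  assume X: "\<forall>i. X i \<in> UNIV - {0}" "X \<longlonglongrightarrow> 0"
  have [measurable]: "f \<in> borel_measurable borel"
    using f by (auto dest: borel_measurable_integrable)
  let ?q = "\<lambda>n t. f t * cis (- (2 * pi * t * x)) * ((cis (X n * (- (2 * pi * t))) - 1) / of_real (X n))"
  have "(\<lambda>n. (LBINT t. ?q n t)) \<longlonglongrightarrow>
      (LBINT t. f t * cis (- (2 * pi * t * x)) * (\<i> * of_real (- (2 * pi * t))))"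
  proof (rule integral_dominated_convergence[where w="\<lambda>t. 2 * pi * norm (of_real t * f t)"])
    show "AE t in lborel. (\<lambda>n. ?q n t) \<longlonglongrightarrow> f t * cis (- (2 * pi * t * x)) * (\<i> * of_real (- (2 * pi * t)))"
      using X by (intro always_eventually allI tendsto_intros cis_quotient_tendsto) auto
    show "integrable lborel (\<lambda>t. 2 * pi * norm (of_real t * f t))"
      using integrable_norm[OF tf] by simp
    show "AE t in lborel. norm (?q n t) \<le> 2 * pi * norm (of_real t * f t)" for n
    proof (intro AE_I2)
      fix t
      have "norm (cis (X n * (- (2 * pi * t))) - 1) \<le> \<bar>X n\<bar> * (2 * pi * \<bar>t\<bar>)"
        using norm_cis_diff_le[of "X n * (- (2 * pi * t))" 0] by (simp add: abs_mult)
      then have "norm ((cis (X n * (- (2 * pi * t))) - 1) / of_real (X n)) \<le> 2 * pi * \<bar>t\<bar>"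
        using X(1) by (simp add: norm_divide divide_simps mult_ac)
      then have "norm (f t * cis (- (2 * pi * t * x))) * norm ((cis (X n * (- (2 * pi * t))) - 1) / of_real (X n))
          \<le> norm (f t) * (2 * pi * \<bar>t\<bar>)"
        by (intro mult_mono) (auto simp: norm_mult)
      then show "norm (?q n t) \<le> 2 * pi * norm (of_real t * f t)"
        by (simp only: norm_mult norm_of_real mult_ac)
    qed
  qed auto
  moreover have "(LBINT t. ?q n t) = (fourier f (x + X n) - fourier f x) / of_real (X n)" for n
  proof -
    have "(fourier f (x + X n) - fourier f x) =
       (LBINT t. f t * cis (- (2 * pi * t * (x + X n))) - f t * cis (- (2 * pi * t * x)))"
      unfolding fourier_cis using f by (subst Bochner_Integration.integral_diff) (auto intro!: integrable_mult_cis)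
    also have "\<dots> = (LBINT t. ?q n t * of_real (X n))"
    proof (intro Bochner_Integration.integral_cong refl)
      fix t
      have "- (2 * pi * t * (x + X n)) = - (2 * pi * t * x) + X n * (- (2 * pi * t))"
        by (simp add: algebra_simps)
      then have "cis (- (2 * pi * t * (x + X n))) = cis (- (2 * pi * t * x)) * cis (X n * (- (2 * pi * t)))"
        by (simp only: cis_mult)
      then show "f t * cis (- (2 * pi * t * (x + X n))) - f t * cis (- (2 * pi * t * x)) = ?q n t * of_real (X n)"
        using X(1) by (simp add: right_diff_distrib mult.assoc)
    qed
    finally show ?thesis using X(1) by (simp add: mult.assoc)
  qed
  moreover have "(LBINT t. f t * cis (- (2 * pi * t * x)) * (\<i> * of_real (- (2 * pi * t)))) =
     fourier (\<lambda>t. - 2 * pi * \<i> * of_real t * f t) x"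
    unfolding fourier_cis by (intro Bochner_Integration.integral_cong refl) (simp add: algebra_simps)
  ultimately show "((\<lambda>h. (fourier f (x + h) - fourier f x) / complex_of_real h) \<circ> X) \<longlonglongrightarrow>
     fourier (\<lambda>t. - 2 * pi * \<i> * of_real t * f t) x"
    by (simp only: o_def)
qed

lemma gaussian_cis_integral:
  "(LBINT s. of_real (std_normal_density s) * cis (t * s)) = of_real (exp (- t\<^sup>2 / 2))"
proof -
  have "of_real (exp (- t\<^sup>2 / 2)) = char std_normal_distribution t"
    by (simp add: char_std_normal_distribution)
  also have "\<dots> = (LBINT s. std_normal_density s *\<^sub>R iexp (t * s))"
    unfolding char_def by (subst integral_density) (auto simp: normal_density_nonneg)
  finally show ?thesis by (simp add: scaleR_conv_of_real cis_conv_exp)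
qed

text \<open>The characteristic function of the standard normal distribution, rescaled and modulated.\<close>
lemma fourier_gaussian:
  assumes a: "0 < a"
  shows "fourier (\<lambda>t. cis (2 * pi * t * x) * of_real (exp (- (a * t)\<^sup>2 / 2))) y =
    of_real (sqrt (2 * pi) / a * exp (- (2 * pi * (y - x) / a)\<^sup>2 / 2))"
proof -
  have "of_real (exp (- (2 * pi * (y - x) / a)\<^sup>2 / 2)) = 
    (LBINT s. of_real (std_normal_density s) * cis (- (2 * pi * (y - x) / a) * s))"
    by (subst gaussian_cis_integral) simp
  also have "\<dots> = \<bar>a\<bar> *\<^sub>R (LBINT t. of_real (std_normal_density (0 + a * t)) * cis (- (2 * pi * (y - x) / a) * (0 + a * t)))"
    using a by (intro lborel_integral_real_affine) auto
  also have "(LBINT t. of_real (std_normal_density (0 + a * t)) * cis (- (2 * pi * (y - x) / a) * (0 + a * t)))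
    = (LBINT t. of_real (1 / sqrt (2 * pi)) * (cis (2 * pi * t * x) * of_real (exp (- (a * t)\<^sup>2 / 2)) * cis (- (2 * pi * t * y))))"
  proof (intro Bochner_Integration.integral_cong refl)
    fix t
    have "- (2 * pi * (y - x) / a) * (0 + a * t) = 2 * pi * t * x + - (2 * pi * t * y)"
      using a by (simp add: field_simps)
    then have "cis (- (2 * pi * (y - x) / a) * (0 + a * t)) = cis (2 * pi * t * x) * cis (- (2 * pi * t * y))"
      by (simp only: cis_mult)
    then show "of_real (std_normal_density (0 + a * t)) * cis (- (2 * pi * (y - x) / a) * (0 + a * t)) =
      of_real (1 / sqrt (2 * pi)) * (cis (2 * pi * t * x) * of_real (exp (- (a * t)\<^sup>2 / 2)) * cis (- (2 * pi * t * y)))"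
      by (simp add: std_normal_density_def mult_ac del: real_sqrt_mult)
  qed
  also have "\<dots> = of_real (1 / sqrt (2 * pi)) * fourier (\<lambda>t. cis (2 * pi * t * x) * of_real (exp (- (a * t)\<^sup>2 / 2))) y"
    unfolding fourier_cis by (rule integral_mult_right_zero)
  finally show ?thesis using a by (simp add: scaleR_conv_of_real field_simps del: real_sqrt_mult)
qed

lemma gaussian_integrable: 
  fixes a :: real
  assumes "0 < a"
  shows "integrable lborel (\<lambda>t. exp (- (a * t)\<^sup>2 / 2))"
proof -
  have "integrable lborel (\<lambda>t. sqrt (2 * pi) * std_normal_density (0 + a * t))"
    using assms by (intro integrable_mult_right lborel_integrable_real_affine) auto
  then show ?thesis by (simp add: std_normal_density_def del: real_sqrt_mult)
qed

text \<open>Inversion: insert a Gaussian of width \<open>1/a\<close> and let \<open>a\<close> tend to zero.  Near \<open>x\<close> the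
  resulting average of \<open>f\<close> is handled by continuity; far from \<open>x\<close> the Gaussian is uniformly small.\<close>

theorem fourier_inversion:
  assumes f: "integrable lborel f" and ff: "integrable lborel (fourier f)" and c: "isCont f x"
  shows "f x = (LBINT t. fourier f t * cis (2 * pi * t * x))"
proof -
  have [measurable]: "f \<in> borel_measurable borel" "fourier f \<in> borel_measurable borel"
    using f ff by (auto dest: borel_measurable_integrable)
  define a where "a n = 1 / real (Suc n)" for n
  have a: "0 < a n" "a n \<le> 1" for n by (auto simp: a_def)
  have a0: "a \<longlonglongrightarrow> 0" unfolding a_def using LIMSEQ_inverse_real_of_nat by (simp add: inverse_eq_divide)
  define k where "k n w = sqrt (2 * pi) / a n * exp (- (2 * pi * w / a n)\<^sup>2 / 2)" for n w
  have [measurable]: "k n \<in> borel_measurable borel" for n unfolding k_def by measurable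
  obtain d where d: "d > 0" "\<And>y. \<bar>y - x\<bar> < d \<Longrightarrow> norm (f y - f x) < 1"
    using c unfolding continuous_at_eps_delta dist_norm by (metis real_norm_def zero_less_one)
  define f1 where "f1 y = (if \<bar>y - x\<bar> < d then f y else 0)" for y
  define f2 where "f2 y = (if \<bar>y - x\<bar> < d then 0 else f y)" for y
  have [measurable]: "f1 \<in> borel_measurable borel" "f2 \<in> borel_measurable borel"
    unfolding f1_def f2_def by measurable
  have bound1: "norm (f1 y) \<le> norm (f x) + 1" for y
    using d(2)[of y] norm_triangle_ineq2[of "f y" "f x"] by (auto simp: f1_def)
  have f1x: "f1 x = f x" using d by (simp add: f1_def)
  have c1: "isCont f1 x"
  proof (rule continuous_transform_within[of x UNIV f d, simplified])
    show "isCont f x" by (rule c)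
  qed (use d in \<open>auto simp: f1_def dist_real_def abs_minus_commute\<close>)
  have i1: "integrable lborel f1" and i2: "integrable lborel f2"
    using f by (auto intro!: Bochner_Integration.integrable_bound[OF f] simp: f1_def f2_def)
  have "exp (- u\<^sup>2 / 2) \<le> 2 / u\<^sup>2" if "u \<noteq> 0" for u :: real
  proof -
    have "u\<^sup>2 / 2 \<le> exp (u\<^sup>2 / 2)" using exp_ge_add_one_self[of "u\<^sup>2 / 2"] by linarith
    then show ?thesis using that by (simp add: exp_minus field_simps)
  qed
  then have "exp (- (2 * pi * w / a n)\<^sup>2 / 2) \<le> 2 / (2 * pi * w / a n)\<^sup>2" if "w \<noteq> 0" for w n
    using a[of n] that by auto
  then have "k n w \<le> sqrt (2 * pi) / a n * (2 / (2 * pi * w / a n)\<^sup>2)" if "w \<noteq> 0" for w n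
    unfolding k_def using a[of n] that by (intro mult_left_mono) (auto simp del: real_sqrt_mult)
  moreover have "sqrt (2 * pi) / a n * (2 / (2 * pi * w / a n)\<^sup>2) = sqrt (2 * pi) / (2 * pi\<^sup>2 * w\<^sup>2) * a n" for w n
    using a[of n] by (simp add: power2_eq_square field_simps del: real_sqrt_mult)
  ultimately have kb: "k n w \<le> sqrt (2 * pi) / (2 * pi\<^sup>2 * w\<^sup>2) * a n" if "w \<noteq> 0" for w n
    using that by metis
  have kpos: "0 \<le> k n w" for n w using a[of n] by (simp add: k_def)
  have kb2: "k n (y - x) \<le> sqrt (2 * pi) / (2 * pi\<^sup>2 * d\<^sup>2)" if "\<not> \<bar>y - x\<bar> < d" for n y
  proof -
    have "d\<^sup>2 \<le> (y - x)\<^sup>2" using that d by (intro abs_le_square_iff[THEN iffD1]) auto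
    then have "sqrt (2 * pi) / (2 * pi\<^sup>2 * (y - x)\<^sup>2) * a n \<le> sqrt (2 * pi) / (2 * pi\<^sup>2 * d\<^sup>2) * 1"
      using a[of n] d \<open>\<not> \<bar>y - x\<bar> < d\<close> by (intro mult_mono divide_left_mono) auto
    then show ?thesis using kb[of "y - x" n] that d by force
  qed
  have far: "(\<lambda>n. \<integral>y. f2 y * of_real (k n (y - x)) \<partial>lborel) \<longlonglongrightarrow> (\<integral>y. 0 \<partial>(lborel :: real measure))"
  proof (rule integral_dominated_convergence[where w="\<lambda>y. norm (f2 y) * (sqrt (2 * pi) / (2 * pi\<^sup>2 * d\<^sup>2))"])
    show "AE y in lborel. (\<lambda>n. f2 y * of_real (k n (y - x))) \<longlonglongrightarrow> 0"
    proof (intro AE_I2)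
      fix y
      show "(\<lambda>n. f2 y * of_real (k n (y - x))) \<longlonglongrightarrow> 0"
      proof (cases "\<bar>y - x\<bar> < d")
        case False
        then have "y - x \<noteq> 0" using d by auto
        have lim: "(\<lambda>n. sqrt (2 * pi) / (2 * pi\<^sup>2 * (y - x)\<^sup>2) * a n) \<longlonglongrightarrow> 0"
          by (rule tendsto_mult_right_zero[OF a0])
        have "(\<lambda>n. k n (y - x)) \<longlonglongrightarrow> 0"
          by (rule tendsto_sandwich[OF _ _ tendsto_const lim])
             (intro always_eventually allI kb[OF \<open>y - x \<noteq> 0\<close>] kpos)+
        from tendsto_of_real[OF this, where 'a=complex] show ?thesis
          by (intro tendsto_mult_right_zero) simp
      qed (simp add: f2_def)
    qed
    show "AE y in lborel. norm (f2 y * of_real (k n (y - x))) \<le> norm (f2 y) * (sqrt (2 * pi) / (2 * pi\<^sup>2 * d\<^sup>2))" for n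
    proof (intro AE_I2)
      fix y
      show "norm (f2 y * of_real (k n (y - x))) \<le> norm (f2 y) * (sqrt (2 * pi) / (2 * pi\<^sup>2 * d\<^sup>2))"
      proof (cases "\<bar>y - x\<bar> < d")
        case False
        have "norm (f2 y) * \<bar>k n (y - x)\<bar> \<le> norm (f2 y) * (sqrt (2 * pi) / (2 * pi\<^sup>2 * d\<^sup>2))"
          using kb2[OF False, of n] kpos[of n "y - x"] by (intro mult_left_mono) simp_all
        then show ?thesis by (simp only: norm_mult norm_of_real)
      qed (simp add: f2_def)
    qed
    show "integrable lborel (\<lambda>y. norm (f2 y) * (sqrt (2 * pi) / (2 * pi\<^sup>2 * d\<^sup>2)))"
      using i2 by (intro integrable_mult_left integrable_norm)
  qed auto
  have near: "(\<lambda>n. \<integral>s. f1 (x + a n / (2 * pi) * s) * of_real (std_normal_density s) \<partial>lborel) \<longlonglongrightarrow>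
     (LBINT s. f1 x * of_real (std_normal_density s))"
  proof (rule integral_dominated_convergence[where w="\<lambda>s. (norm (f x) + 1) * std_normal_density s"])
    show "AE s in lborel. (\<lambda>n. f1 (x + a n / (2 * pi) * s) * of_real (std_normal_density s)) \<longlonglongrightarrow> f1 x * of_real (std_normal_density s)"
    proof (intro AE_I2 tendsto_mult tendsto_const)
      fix s
      have "(\<lambda>n. x + a n / (2 * pi) * s) \<longlonglongrightarrow> x + 0 / (2 * pi) * s" by (intro tendsto_intros a0) auto
      then show "(\<lambda>n. f1 (x + a n / (2 * pi) * s)) \<longlonglongrightarrow> f1 x"
        using isCont_tendsto_compose[OF c1] by simp
    qed
    show "AE s in lborel. norm (f1 (x + a n / (2 * pi) * s) * of_real (std_normal_density s)) \<le> (norm (f x) + 1) * std_normal_density s" for n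
      by (intro AE_I2) (auto simp: norm_mult intro!: mult_right_mono bound1)
    show "integrable lborel (\<lambda>s. (norm (f x) + 1) * std_normal_density s)"
      by (intro integrable_mult_right) auto
  qed auto
  have "(LBINT s. of_real (std_normal_density s)) = (1::complex)"
    using gaussian_cis_integral[of 0] by simp
  then have near': "(\<lambda>n. \<integral>s. f1 (x + a n / (2 * pi) * s) * of_real (std_normal_density s) \<partial>lborel) \<longlonglongrightarrow> f x"
    using near by (simp add: f1x)
  have sub: "(LBINT s. f1 (x + a n / (2 * pi) * s) * of_real (std_normal_density s)) = (LBINT y. f1 y * of_real (k n (y - x)))" for n
  proof -
    have "(LBINT y. f1 y * of_real (k n (y - x))) =
      \<bar>a n / (2 * pi)\<bar> *\<^sub>R (LBINT s. f1 (x + a n / (2 * pi) * s) * of_real (k n (x + a n / (2 * pi) * s - x)))"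
      using a[of n] by (intro lborel_integral_real_affine) auto
    also have "\<dots> = (LBINT s. \<bar>a n / (2 * pi)\<bar> *\<^sub>R (f1 (x + a n / (2 * pi) * s) * of_real (k n (x + a n / (2 * pi) * s - x))))"
      by simp
    also have "\<dots> = (LBINT s. f1 (x + a n / (2 * pi) * s) * of_real (std_normal_density s))"
    proof (intro Bochner_Integration.integral_cong refl)
      fix s
      have "\<bar>a n / (2 * pi)\<bar> * k n (x + a n / (2 * pi) * s - x) = std_normal_density s"
        using a[of n] real_sqrt_pow2[of "2 * pi"]
        by (simp add: k_def std_normal_density_def field_simps power2_eq_square del: real_sqrt_mult)
      then have e: "of_real \<bar>a n / (2 * pi)\<bar> * of_real (k n (x + a n / (2 * pi) * s - x)) = (of_real (std_normal_density s) :: complex)"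
        by (simp only: flip: of_real_mult)
      show "\<bar>a n / (2 * pi)\<bar> *\<^sub>R (f1 (x + a n / (2 * pi) * s) * of_real (k n (x + a n / (2 * pi) * s - x))) = f1 (x + a n / (2 * pi) * s) * of_real (std_normal_density s)"
        unfolding e[symmetric] scaleR_conv_of_real by (rule mult.left_commute)
    qed
    finally show ?thesis by simp
  qed
  have ik: "integrable lborel (\<lambda>y. h y * of_real (k n (y - x)))" if "integrable lborel h" for h :: "real \<Rightarrow> complex" and n
  proof (rule Bochner_Integration.integrable_bound[where f="\<lambda>y. (sqrt (2 * pi) / a n) *\<^sub>R h y"])
    show "AE y in lborel. norm (h y * of_real (k n (y - x))) \<le> norm ((sqrt (2 * pi) / a n) *\<^sub>R h y)"
    proof (intro AE_I2)
      fix y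
      have "k n (y - x) \<le> sqrt (2 * pi) / a n"
        using a[of n] by (simp add: k_def divide_right_mono mult_left_le del: real_sqrt_mult)
      then show "norm (h y * of_real (k n (y - x))) \<le> norm ((sqrt (2 * pi) / a n) *\<^sub>R h y)"
        using kpos[of n "y - x"] a[of n] by (simp add: norm_mult mult_mono mult.commute[of "norm _"] mult_right_mono del: real_sqrt_mult times_divide_eq_left)
    qed
  qed (use that in \<open>auto dest: borel_measurable_integrable\<close>)
  have "(LBINT t. fourier f t * (cis (2 * pi * t * x) * of_real (exp (- (a n * t)\<^sup>2 / 2))))
     = (LBINT y. f1 y * of_real (k n (y - x))) + (LBINT y. f2 y * of_real (k n (y - x)))" for n
  proof -
    have ig: "integrable lborel (\<lambda>t. cis (2 * pi * t * x) * of_real (exp (- (a n * t)\<^sup>2 / 2)))"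
    proof -
      have "integrable lborel (\<lambda>t. complex_of_real (exp (- (a n * t)\<^sup>2 / 2)))"
        by (rule integrable_of_real[OF gaussian_integrable[OF a(1)]])
      from integrable_mult_cis[OF this, of "\<lambda>t. 2 * pi * t * x"] show ?thesis
        by (simp add: mult.commute)
    qed
    have "(LBINT t. fourier f t * (cis (2 * pi * t * x) * of_real (exp (- (a n * t)\<^sup>2 / 2))))
      = (LBINT y. f y * of_real (k n (y - x)))"
      unfolding fourier_multiplication[OF f ig, symmetric] fourier_gaussian[OF a(1)] k_def ..
    also have "\<dots> = (LBINT y. f1 y * of_real (k n (y - x)) + f2 y * of_real (k n (y - x)))"
      by (intro Bochner_Integration.integral_cong) (auto simp: f1_def f2_def)
    finally show ?thesis using ik[OF i1] ik[OF i2] by simp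
  qed
  then have "(\<lambda>n. \<integral>t. fourier f t * (cis (2 * pi * t * x) * of_real (exp (- (a n * t)\<^sup>2 / 2))) \<partial>lborel) \<longlonglongrightarrow> f x"
    using tendsto_add[OF near'[unfolded sub] far] by (simp only: integral_zero add_0_right)
  moreover have "(\<lambda>n. \<integral>t. fourier f t * (cis (2 * pi * t * x) * of_real (exp (- (a n * t)\<^sup>2 / 2))) \<partial>lborel) \<longlonglongrightarrow>
     (LBINT t. fourier f t * cis (2 * pi * t * x))"
  proof (rule integral_dominated_convergence[where w="\<lambda>t. norm (fourier f t)"])
    show "AE t in lborel. (\<lambda>n. fourier f t * (cis (2 * pi * t * x) * of_real (exp (- (a n * t)\<^sup>2 / 2)))) \<longlonglongrightarrow> fourier f t * cis (2 * pi * t * x)"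
    proof (intro AE_I2)
      fix t
      have "(\<lambda>n. fourier f t * (cis (2 * pi * t * x) * of_real (exp (- (a n * t)\<^sup>2 / 2)))) \<longlonglongrightarrow> fourier f t * (cis (2 * pi * t * x) * of_real (exp (- (0 * t)\<^sup>2 / 2)))"
        by (intro tendsto_intros a0) auto
      then show "(\<lambda>n. fourier f t * (cis (2 * pi * t * x) * of_real (exp (- (a n * t)\<^sup>2 / 2)))) \<longlonglongrightarrow> fourier f t * cis (2 * pi * t * x)" by simp
    qed
  qed (use ff in \<open>auto simp: norm_mult mult_left_le\<close>)
  ultimately show ?thesis by (rule LIMSEQ_unique)
qed

section \<open>Smooth cut-offs and Schwartz seminorms\<close>

abbreviation vderiv :: "(real \<Rightarrow> complex) \<Rightarrow> real \<Rightarrow> complex" where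
  "vderiv f \<equiv> \<lambda>x. vector_derivative f (at x)"

lemma nth_vderiv_0 [simp]: "nth_vderiv 0 f = f"
  by (simp add: nth_vderiv_def)

lemma nth_vderiv_Suc: "nth_vderiv (Suc n) f = nth_vderiv n (vderiv f)"
  by (simp add: nth_vderiv_def funpow_Suc_right del: funpow.simps(2))

lemma nth_vderiv_Suc': "nth_vderiv (Suc n) f = vderiv (nth_vderiv n f)"
  by (simp add: nth_vderiv_def)

text \<open>\<open>Ck n f\<close> asks that the derivatives of orders \<open>0\<close> to \<open>n\<close> be differentiable.  Stratifying smoothness by
  order makes closure under products an induction: each summand of the product rule
  has lost one order in one factor only.\<close>
primrec Ck :: "nat \<Rightarrow> (real \<Rightarrow> complex) \<Rightarrow> bool" where
  "Ck 0 f \<longleftrightarrow> (\<forall>x. f differentiable (at x))"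
| "Ck (Suc n) f \<longleftrightarrow> (\<forall>x. f differentiable (at x)) \<and> Ck n (vderiv f)"

definition smooth :: "(real \<Rightarrow> complex) \<Rightarrow> bool" where
  "smooth f \<longleftrightarrow> (\<forall>n. Ck n f)"

lemma Ck_differentiable: "Ck n f \<Longrightarrow> f differentiable (at x)"
  by (cases n) auto

lemma Ck_Suc_imp: "Ck (Suc n) f \<Longrightarrow> Ck n f"
  by (induction n arbitrary: f) auto

lemma vderiv_eqI: "(\<And>x. (f has_vector_derivative g x) (at x)) \<Longrightarrow> vderiv f = g"
  by (auto intro: vector_derivative_at)

lemma Ck_SucI:
  assumes "\<And>x. (f has_vector_derivative g x) (at x)" "Ck n g"
  shows "Ck (Suc n) f"
  using assms vderiv_eqI[OF assms(1)] by (auto intro: differentiableI_vector)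

lemma Ck_has_vector_derivative: "Ck n f \<Longrightarrow> (f has_vector_derivative vderiv f x) (at x)"
  using Ck_differentiable vector_derivative_works by blast

lemma Ck_vderiv: "Ck (Suc n) f \<Longrightarrow> Ck n (vderiv f)" by simp

lemma Ck_add: "Ck n f \<Longrightarrow> Ck n g \<Longrightarrow> Ck n (\<lambda>x. f x + g x)"
proof (induction n arbitrary: f g)
  case (Suc n)
  show ?case
    by (rule Ck_SucI[OF has_vector_derivative_add[OF Ck_has_vector_derivative[OF Suc.prems(1)] Ck_has_vector_derivative[OF Suc.prems(2)]]])
       (intro Suc.IH Ck_vderiv Suc.prems)
qed auto

lemma Ck_mult: "Ck n f \<Longrightarrow> Ck n g \<Longrightarrow> Ck n (\<lambda>x. f x * g x)"
proof (induction n arbitrary: f g)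
  case (Suc n)
  show ?case
    by (rule Ck_SucI[OF has_vector_derivative_mult[OF Ck_has_vector_derivative[OF Suc.prems(1)] Ck_has_vector_derivative[OF Suc.prems(2)]]])
       (intro Ck_add Suc.IH Ck_vderiv Suc.prems Ck_Suc_imp[OF Suc.prems(1)] Ck_Suc_imp[OF Suc.prems(2)])
qed auto

lemma Ck_const: "Ck n (\<lambda>x. c)"
proof (induction n arbitrary: c)
  case (Suc n)
  show ?case by (rule Ck_SucI[where g="\<lambda>x. 0"]) (auto intro: Suc)
qed auto

lemma Ck_affine: "Ck n f \<Longrightarrow> Ck n (\<lambda>x. f (a * x + b))"
proof (induction n arbitrary: f)
  case 0
  have "((\<lambda>x. f (a * x + b)) has_vector_derivative a *\<^sub>R vderiv f (a * x + b)) (at x)" for x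
  proof -
    have "((\<lambda>x. a * x + b) has_vector_derivative a) (at x)"
      by (auto intro!: derivative_eq_intros simp: has_real_derivative_iff_has_vector_derivative[symmetric])
    from vector_diff_chain_at[OF this Ck_has_vector_derivative[OF 0]] show ?thesis by (simp add: o_def)
  qed
  then show ?case by (auto intro: differentiableI_vector)
next
  case (Suc n)
  have "((\<lambda>x. f (a * x + b)) has_vector_derivative of_real a * vderiv f (a * x + b)) (at x)" for x
  proof -
    have "((\<lambda>x. a * x + b) has_vector_derivative a) (at x)"
      by (auto intro!: derivative_eq_intros simp: has_real_derivative_iff_has_vector_derivative[symmetric])
    from vector_diff_chain_at[OF this Ck_has_vector_derivative[OF Suc.prems]] show ?thesis
      by (simp add: o_def scaleR_conv_of_real)
  qed
  then show ?case by (rule Ck_SucI) (intro Ck_mult Ck_const Suc.IH Ck_vderiv Suc.prems)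
qed

lemma smooth_differentiable: "smooth f \<Longrightarrow> f differentiable (at x)"
  by (auto simp: smooth_def intro: Ck_differentiable)

lemma smooth_has_vector_derivative: "smooth f \<Longrightarrow> (f has_vector_derivative vderiv f x) (at x)"
  by (auto simp: smooth_def intro: Ck_has_vector_derivative)

lemma smooth_vderiv: "smooth f \<Longrightarrow> smooth (vderiv f)"
  unfolding smooth_def using Ck_vderiv by blast

lemma smoothI_vderiv:
  assumes "\<And>x. (f has_vector_derivative g x) (at x)" "smooth g"
  shows "smooth f"
  unfolding smooth_def
proof
  fix n show "Ck n f"
    using Ck_Suc_imp[OF Ck_SucI[OF assms(1)]] assms(2) by (auto simp: smooth_def)
qed

lemma smooth_add: "smooth f \<Longrightarrow> smooth g \<Longrightarrow> smooth (\<lambda>x. f x + g x)"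
  by (auto simp: smooth_def intro: Ck_add)

lemma smooth_mult: "smooth f \<Longrightarrow> smooth g \<Longrightarrow> smooth (\<lambda>x. f x * g x)"
  by (auto simp: smooth_def intro: Ck_mult)

lemma smooth_const: "smooth (\<lambda>x. c)"
  by (auto simp: smooth_def intro: Ck_const)

lemma smooth_affine: "smooth f \<Longrightarrow> smooth (\<lambda>x. f (a * x + b))"
  by (auto simp: smooth_def intro: Ck_affine)

lemma smooth_of_real: "smooth of_real"
  by (rule smoothI_vderiv[where g="\<lambda>x. 1"]) (auto intro!: derivative_eq_intros smooth_const)

lemma smooth_power: "smooth f \<Longrightarrow> smooth (\<lambda>x. f x ^ n)"
  by (induction n) (auto intro: smooth_const smooth_mult)

lemma smooth_sum: "(\<And>i. i \<in> S \<Longrightarrow> smooth (f i)) \<Longrightarrow> smooth (\<lambda>x. \<Sum>i\<in>S. f i x)"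
  by (induction S rule: infinite_finite_induct) (auto intro: smooth_const smooth_add)

lemma smooth_cis: "smooth (\<lambda>t. cis (t * c))"
proof -
  have "Ck n (\<lambda>t. cis (t * c))" for n
  proof (induction n)
    case 0
    show ?case using cis_has_vector_derivative by (auto intro: differentiableI_vector)
  next
    case (Suc n)
    show ?case by (rule Ck_SucI[OF cis_has_vector_derivative]) (intro Ck_mult Ck_const Suc)
  qed
  then show ?thesis by (simp add: smooth_def)
qed

lemma smooth_continuous: "smooth f \<Longrightarrow> continuous_on A f"
  by (meson smooth_has_vector_derivative has_vector_derivative_continuous continuous_at_imp_continuous_on)

lemma smooth_nth_vderiv: "smooth f \<Longrightarrow> smooth (nth_vderiv n f)"
  by (induction n arbitrary: f) (auto simp: nth_vderiv_Suc intro: smooth_vderiv)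

text \<open>A bound for the \<open>C\<^sup>k\<close> norm on \<open>[-R, R]\<close>, as a relation: only upper bounds are ever combined, and
  they need not be attained.\<close>
definition Ck_bound :: "real \<Rightarrow> nat \<Rightarrow> (real \<Rightarrow> complex) \<Rightarrow> real \<Rightarrow> bool" where
  "Ck_bound R k f A \<longleftrightarrow> (\<forall>j\<le>k. \<forall>t. \<bar>t\<bar> \<le> R \<longrightarrow> norm (nth_vderiv j f t) \<le> A)"

lemma Ck_bound_0: "Ck_bound R 0 f A \<longleftrightarrow> (\<forall>t. \<bar>t\<bar> \<le> R \<longrightarrow> norm (f t) \<le> A)"
  by (simp add: Ck_bound_def)

lemma Ck_bound_Suc: "Ck_bound R (Suc k) f A \<longleftrightarrow> Ck_bound R 0 f A \<and> Ck_bound R k (vderiv f) A"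
proof -
  have "(\<forall>j\<le>Suc k. P j) \<longleftrightarrow> P 0 \<and> (\<forall>j\<le>k. P (Suc j))" for P
    by (metis (full_types) Suc_le_mono not0_implies_Suc zero_le)
  then show ?thesis by (simp add: Ck_bound_def nth_vderiv_Suc)
qed

lemma Ck_bound_mono: "Ck_bound R k f A \<Longrightarrow> A \<le> B \<Longrightarrow> l \<le> k \<Longrightarrow> Ck_bound R l f B"
  unfolding Ck_bound_def by (meson order_trans)

lemma Ck_bound_add:
  "smooth f \<Longrightarrow> smooth g \<Longrightarrow> Ck_bound R k f A \<Longrightarrow> Ck_bound R k g B \<Longrightarrow> Ck_bound R k (\<lambda>x. f x + g x) (A + B)"
proof (induction k arbitrary: f g)
  case 0 then show ?case by (auto simp: Ck_bound_0 intro: norm_triangle_mono)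
next
  case (Suc k)
  have v: "vderiv (\<lambda>x. f x + g x) = (\<lambda>x. vderiv f x + vderiv g x)"
    by (intro vderiv_eqI has_vector_derivative_add smooth_has_vector_derivative Suc.prems)
  show ?case
    using Suc.prems Suc.IH[OF smooth_vderiv smooth_vderiv, of f g] unfolding Ck_bound_Suc v
    by (auto simp: Ck_bound_0 intro: norm_triangle_mono)
qed

text \<open>Leibniz: a derivative of order \<open>k\<close> of a product is a sum of \<open>2\<^sup>k\<close> products of derivatives.\<close>
lemma Ck_bound_mult:
  assumes "0 \<le> A" "0 \<le> B"
  shows "smooth f \<Longrightarrow> smooth g \<Longrightarrow> Ck_bound R k f A \<Longrightarrow> Ck_bound R k g B \<Longrightarrow> Ck_bound R k (\<lambda>x. f x * g x) (2 ^ k * (A * B))"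
proof (induction k arbitrary: f g)
  case 0 then show ?case using assms by (auto simp: Ck_bound_0 norm_mult intro!: mult_mono)
next
  case (Suc k)
  have v: "vderiv (\<lambda>x. f x * g x) = (\<lambda>x. f x * vderiv g x + vderiv f x * g x)"
    by (intro vderiv_eqI has_vector_derivative_mult smooth_has_vector_derivative Suc.prems)
  have "Ck_bound R k (\<lambda>x. f x * vderiv g x + vderiv f x * g x) (2 ^ k * (A * B) + 2 ^ k * (A * B))"
  proof (intro Ck_bound_add Suc.IH smooth_mult smooth_vderiv Suc.prems(1,2))
    show "Ck_bound R k (vderiv f) A" "Ck_bound R k (vderiv g) B"
      using Suc.prems by (auto simp: Ck_bound_Suc)
    show "Ck_bound R k f A" "Ck_bound R k g B"
      using Suc.prems(3,4) Ck_bound_mono[OF _ order_refl le_SucI[OF order_refl]] by blast+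
  qed
  moreover have "norm (f t) * norm (g t) \<le> 2 * 2 ^ k * (A * B)" if "\<bar>t\<bar> \<le> R" for t
  proof -
    have "norm (f t) * norm (g t) \<le> A * B"
      using Suc.prems(3,4) assms that by (intro mult_mono) (auto simp: Ck_bound_Suc Ck_bound_0)
    also have "\<dots> \<le> 2 ^ Suc k * (A * B)"
      using assms mult_right_mono[of 1 "2 ^ Suc k" "A * B"] one_le_power[of "2::real" "Suc k"] by simp
    finally show ?thesis by simp
  qed
  moreover have "2 ^ k * (A * B) + 2 ^ k * (A * B) = 2 ^ Suc k * (A * B)" by simp
  ultimately show ?case
    unfolding Ck_bound_Suc v by (simp add: Ck_bound_0 norm_mult)
qed

lemma Ck_bound_exists: "smooth f \<Longrightarrow> \<exists>A\<ge>0. Ck_bound R k f A"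
proof (induction k arbitrary: f)
  case 0
  have "bounded (f ` {-R..R})"
    by (intro compact_imp_bounded compact_continuous_image smooth_continuous 0) auto
  then obtain A where "A > 0" "\<And>t. t \<in> {-R..R} \<Longrightarrow> norm (f t) \<le> A"
    by (auto simp: bounded_pos)
  then show ?case by (intro exI[of _ A]) (auto simp: Ck_bound_0 abs_le_iff)
next
  case (Suc k)
  from Suc.IH[OF smooth_vderiv[OF Suc.prems]] obtain A where A: "A \<ge> 0" "Ck_bound R k (vderiv f) A"
    by auto
  have "bounded (f ` {-R..R})"
    by (intro compact_imp_bounded compact_continuous_image smooth_continuous Suc) auto
  then obtain B where B: "B > 0" "\<And>t. t \<in> {-R..R} \<Longrightarrow> norm (f t) \<le> B"
    by (auto simp: bounded_pos)
  have "norm (f t) \<le> A + B" if "\<bar>t\<bar> \<le> R" for t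
    using B(2)[of t] that A by (auto simp: abs_le_iff)
  then have "Ck_bound R 0 f (A + B)" by (simp add: Ck_bound_0)
  moreover have "Ck_bound R k (vderiv f) (A + B)" by (rule Ck_bound_mono[OF A(2)]) (use B in auto)
  ultimately show ?case using A B by (intro exI[of _ "A + B"]) (auto simp: Ck_bound_Suc)
qed

definition test_fun :: "real \<Rightarrow> (real \<Rightarrow> complex) \<Rightarrow> bool" where
  "test_fun R f \<longleftrightarrow> smooth f \<and> (\<forall>t. R < \<bar>t\<bar> \<longrightarrow> f t = 0)"

lemma test_fun_vderiv:
  assumes "test_fun R f"
  shows "test_fun R (vderiv f)"
  unfolding test_fun_def
proof (intro conjI allI impI)
  show "smooth (vderiv f)" using assms by (simp add: test_fun_def smooth_vderiv)
  fix t :: real assume t: "R < \<bar>t\<bar>"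
  have "open {t. R < \<bar>t\<bar>}" by (intro open_Collect_less continuous_intros)
  then have "(f has_vector_derivative 0) (at t)"
    by (rule has_vector_derivative_transform_within_open[OF has_vector_derivative_const[of 0]])
       (use t assms in \<open>auto simp: test_fun_def\<close>)
  then show "vderiv f t = 0" by (rule vector_derivative_at)
qed

lemma test_fun_nth_vderiv: "test_fun R f \<Longrightarrow> test_fun R (nth_vderiv n f)"
  by (induction n arbitrary: f) (auto simp: nth_vderiv_Suc intro: test_fun_vderiv)

lemma test_fun_mult: "test_fun R f \<Longrightarrow> smooth g \<Longrightarrow> test_fun R (\<lambda>t. g t * f t)"
  by (auto simp: test_fun_def intro: smooth_mult)

lemma integrable_support_Icc:
  fixes f :: "real \<Rightarrow> complex"
  assumes "continuous_on UNIV f" "\<And>t. R < \<bar>t\<bar> \<Longrightarrow> f t = 0"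
  shows "integrable lborel f"
proof -
  have "integrable lborel (\<lambda>x. indicator {-R..R} x *\<^sub>R f x)"
    by (intro borel_integrable_compact continuous_on_subset[OF assms(1)]) auto
  moreover have "(\<lambda>x. indicator {-R..R} x *\<^sub>R f x) = f"
    using assms(2) by (auto simp: indicator_def fun_eq_iff)
  ultimately show ?thesis by simp
qed

lemma test_fun_integrable: "test_fun R f \<Longrightarrow> integrable lborel f"
  by (auto simp: test_fun_def intro!: integrable_support_Icc[of f R] smooth_continuous)

lemma norm_fourier_support_le:
  assumes "integrable lborel f" "\<And>t. R < \<bar>t\<bar> \<Longrightarrow> f t = 0" "\<And>t. \<bar>t\<bar> \<le> R \<Longrightarrow> norm (f t) \<le> A" "0 \<le> R"
  shows "norm (fourier f x) \<le> 2 * R * A"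
proof -
  have "(LBINT t. norm (f t)) \<le> (LBINT t. A * indicator {-R..R} t)"
  proof (rule integral_mono)
    show "integrable lborel (\<lambda>t. norm (f t))" using assms by simp
    show "integrable lborel (\<lambda>t. A * indicator {-R..R} t)"
      using assms(4) by (intro integrable_mult_right integrable_real_indicator) auto
    show "norm (f t) \<le> A * indicator {-R..R} t" for t
      using assms(2,3)[of t] by (cases "\<bar>t\<bar> \<le> R") (auto simp: indicator_def abs_le_iff)
  qed
  also have "\<dots> = 2 * R * A" using assms(4) by simp
  finally show ?thesis using norm_fourier_le[of f x] by simp
qed

text \<open>Integration by parts on an interval beyond whose ends \<open>f\<close> vanishes.\<close>
lemma fourier_vderiv:
  assumes f: "test_fun R f"
  shows "fourier (vderiv f) x = 2 * pi * \<i> * of_real x * fourier f x"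
proof -
  define S where "S = \<bar>R\<bar> + 1"
  let ?D = "\<lambda>t. f t * (\<i> * of_real (- (2 * pi * x)) * cis (t * (- (2 * pi * x)))) + vderiv f t * cis (t * (- (2 * pi * x)))"
  have sm: "smooth f" using f by (simp add: test_fun_def)
  have D: "((\<lambda>t. f t * cis (t * (- (2 * pi * x)))) has_vector_derivative ?D t) (at t within B)" for t B
    by (rule has_vector_derivative_at_within[OF has_vector_derivative_mult[OF smooth_has_vector_derivative[OF sm] cis_has_vector_derivative]])
  have "(LBINT t. indicator {-S..S} t *\<^sub>R ?D t) = f S * cis (S * (- (2 * pi * x))) - f (-S) * cis (-S * (- (2 * pi * x)))"
    using sm by (intro integral_FTC_Icc D continuous_intros smooth_continuous smooth_vderiv) (auto simp: S_def)
  also have "\<dots> = 0" using f by (auto simp: test_fun_def S_def)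
  also have "(\<lambda>t. indicator {-S..S} t *\<^sub>R ?D t) = ?D"
  proof
    fix t show "indicator {-S..S} t *\<^sub>R ?D t = ?D t"
      using f test_fun_vderiv[OF f] by (cases "t \<in> {-S..S}") (auto simp: test_fun_def S_def)
  qed
  also have "(LBINT t. ?D t) = (LBINT t. \<i> * of_real (- (2 * pi * x)) * (f t * cis (- (2 * pi * t * x))) + vderiv f t * cis (- (2 * pi * t * x)))"
    by (intro Bochner_Integration.integral_cong refl) (simp add: mult_ac)
  also have "\<dots> = \<i> * of_real (- (2 * pi * x)) * fourier f x + fourier (vderiv f) x"
    unfolding fourier_cis
    by (subst Bochner_Integration.integral_add)
       (intro integrable_mult_right integrable_mult_cis test_fun_integrable[OF f] test_fun_integrable[OF test_fun_vderiv[OF f]] | simp)+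
  finally show ?thesis by (simp add: algebra_simps)
qed

lemma fourier_nth_vderiv:
  "test_fun R f \<Longrightarrow> fourier (nth_vderiv k f) x = (2 * pi * \<i> * of_real x) ^ k * fourier f x"
proof (induction k)
  case (Suc k)
  then show ?case by (simp add: nth_vderiv_Suc' fourier_vderiv[OF test_fun_nth_vderiv] mult_ac)
qed simp

lemma smooth_monomial: "smooth (\<lambda>t. (c * of_real t) ^ n)"
  by (intro smooth_power smooth_mult smooth_const smooth_of_real)

lemma test_fun_monomial: "test_fun R f \<Longrightarrow> test_fun R (\<lambda>t. (c * of_real t) ^ n * f t)"
  by (intro test_fun_mult smooth_monomial)

lemma test_fun_times_t: "test_fun R f \<Longrightarrow> test_fun R (\<lambda>t. c * of_real t * f t)"
  using test_fun_monomial[of R f c 1] by simp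

lemma fourier_test_has_vector_derivative:
  assumes "test_fun R f"
  shows "(fourier f has_vector_derivative fourier (\<lambda>t. - 2 * pi * \<i> * of_real t * f t) x) (at x)"
  using test_fun_times_t[OF assms, of 1] by (intro fourier_has_vector_derivative test_fun_integrable) (auto intro: assms)

lemma nth_vderiv_fourier:
  "test_fun R f \<Longrightarrow> nth_vderiv n (fourier f) = fourier (\<lambda>t. (- 2 * pi * \<i> * of_real t) ^ n * f t)"
proof (induction n arbitrary: f)
  case (Suc n)
  have "vderiv (fourier f) = fourier (\<lambda>t. - 2 * pi * \<i> * of_real t * f t)"
    by (rule vderiv_eqI) (rule fourier_test_has_vector_derivative[OF Suc.prems])
  then show ?case
    using Suc.IH[OF test_fun_times_t[OF Suc.prems, of "- 2 * pi * \<i>"]]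
    by (simp add: nth_vderiv_Suc mult_ac)
qed simp

lemma smooth_fourier:
  assumes "test_fun R f"
  shows "smooth (fourier f)"
proof -
  have "test_fun R f \<Longrightarrow> Ck n (fourier f)" for n f
  proof (induction n arbitrary: f)
    case 0
    then show ?case using fourier_test_has_vector_derivative by (auto intro: differentiableI_vector)
  next
    case (Suc n)
    show ?case
      by (rule Ck_SucI[OF fourier_test_has_vector_derivative[OF Suc.prems]])
         (intro Suc.IH test_fun_times_t Suc.prems)
  qed
  then show ?thesis using assms by (simp add: smooth_def)
qed

text \<open>Multiplying the transform by \<open>x\<close> amounts to differentiating \<open>f\<close>; the powers of \<open>2 \<pi> \<ge> 1\<close> gained on the way
  are discarded.\<close>
lemma fourier_decay:
  assumes "test_fun R f" "Ck_bound R k f A" "0 \<le> R"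
  shows "norm (x ^ k *\<^sub>R fourier f x) \<le> 2 * R * A"
proof -
  have "norm (x ^ k *\<^sub>R fourier f x) \<le> (2 * pi) ^ k * (\<bar>x\<bar> ^ k * norm (fourier f x))"
    using mult_right_mono[OF one_le_power[of "2 * pi" k], of "\<bar>x\<bar> ^ k * norm (fourier f x)"] pi_ge_two
    by (simp add: power_abs)
  also have "\<dots> = norm (fourier (nth_vderiv k f) x)"
    by (simp add: fourier_nth_vderiv[OF assms(1)] norm_mult norm_power power_mult_distrib)
  also have "\<dots> \<le> 2 * R * A"
    using test_fun_nth_vderiv[OF assms(1), of k] assms(2,3)
    by (intro norm_fourier_support_le) (auto simp: test_fun_def Ck_bound_def intro: test_fun_integrable[of R])
  finally show ?thesis .
qed

lemma fourier_seminorm_bound: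
  assumes "0 \<le> R"
  obtains C where "C \<ge> 0" "\<And>f A x. test_fun R f \<Longrightarrow> Ck_bound R k f A \<Longrightarrow> A \<ge> 0 \<Longrightarrow>
     norm (x ^ k *\<^sub>R nth_vderiv n (fourier f) x) \<le> C * A"
proof -
  obtain B where B: "B \<ge> 0" "Ck_bound R k (\<lambda>t. (- 2 * pi * \<i> * of_real t) ^ n) B"
    using Ck_bound_exists[OF smooth_monomial] by meson
  show ?thesis
  proof (rule that[of "2 * R * (2 ^ k * B)"])
    show "0 \<le> 2 * R * (2 ^ k * B)" using assms B by simp
    fix f A x assume f: "test_fun R f" "Ck_bound R k f A" "A \<ge> 0"
    have "Ck_bound R k (\<lambda>t. (- 2 * pi * \<i> * of_real t) ^ n * f t) (2 ^ k * (B * A))"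
      using f B by (intro Ck_bound_mult smooth_monomial) (auto simp: test_fun_def)
    then have "norm (x ^ k *\<^sub>R fourier (\<lambda>t. (- 2 * pi * \<i> * of_real t) ^ n * f t) x) \<le> 2 * R * (2 ^ k * (B * A))"
      using assms f by (intro fourier_decay test_fun_monomial)
    then show "norm (x ^ k *\<^sub>R nth_vderiv n (fourier f) x) \<le> 2 * R * (2 ^ k * B) * A"
      by (simp add: nth_vderiv_fourier[OF f(1)] mult_ac)
  qed
qed

lemma schwartz_fourier:
  assumes f: "test_fun R f"
  shows "schwartz (fourier f)"
proof -
  have f': "test_fun \<bar>R\<bar> f" using f by (auto simp: test_fun_def)
  show ?thesis
    unfolding schwartz_def
  proof (intro conjI allI)
    show "nth_vderiv n (fourier f) differentiable at x" for n x
      by (intro smooth_differentiable smooth_nth_vderiv smooth_fourier[OF f])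
    fix k n
    obtain C where C: "C \<ge> 0" "\<And>f A x. test_fun \<bar>R\<bar> f \<Longrightarrow> Ck_bound \<bar>R\<bar> k f A \<Longrightarrow> A \<ge> 0 \<Longrightarrow>
       norm (x ^ k *\<^sub>R nth_vderiv n (fourier f) x) \<le> C * A"
      using fourier_seminorm_bound[of "\<bar>R\<bar>" k n] by auto
    obtain A where "A \<ge> 0" "Ck_bound \<bar>R\<bar> k f A"
      using Ck_bound_exists f' unfolding test_fun_def by meson
    then show "bounded (range (\<lambda>x. x ^ k *\<^sub>R nth_vderiv n (fourier f) x))"
      using C(2)[OF f'] by (intro boundedI) auto
  qed
qed

lemma schwartz_test_fun:
  assumes f: "test_fun R f"
  shows "schwartz f"
  unfolding schwartz_def
proof (intro conjI allI)
  show "nth_vderiv n f differentiable at x" for n x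
    using f by (intro smooth_differentiable smooth_nth_vderiv) (auto simp: test_fun_def)
  fix k n
  obtain A where A: "A \<ge> 0" "Ck_bound \<bar>R\<bar> 0 (\<lambda>x. (1 * of_real x) ^ k * nth_vderiv n f x) A"
    using Ck_bound_exists[OF smooth_mult[OF smooth_monomial smooth_nth_vderiv]] f unfolding test_fun_def by meson
  show "bounded (range (\<lambda>x. x ^ k *\<^sub>R nth_vderiv n f x))"
  proof (rule boundedI, safe)
    fix x
    show "norm (x ^ k *\<^sub>R nth_vderiv n f x) \<le> A"
      using A test_fun_nth_vderiv[OF f, of n]
      by (cases "\<bar>x\<bar> \<le> \<bar>R\<bar>") (auto simp: Ck_bound_0 scaleR_conv_of_real test_fun_def)
  qed
qed

text \<open>A tempered distribution acts on the transforms of test functions with support in a fixed interval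
  continuously in a \<open>C\<^sup>N\<close> norm.  In this form temperedness controls the Taylor
  coefficients of the entire extension.\<close>
lemma tempered_fourier_bound:
  assumes u: "defines_tempered_distribution u" and R: "0 \<le> R"
  obtains C N where "C \<ge> 0" "\<And>f A. test_fun R f \<Longrightarrow> Ck_bound R N f A \<Longrightarrow> A \<ge> 0 \<Longrightarrow> norm (pairing u (fourier f)) \<le> C * A"
proof -
  obtain C N where C: "\<And>\<phi>. schwartz \<phi> \<Longrightarrow> norm (pairing u \<phi>) \<le> C * (\<Sum>k\<le>N. \<Sum>n\<le>N. schwartz_seminorm k n \<phi>)"
    using u unfolding defines_tempered_distribution_def by blast
  have "\<exists>D\<ge>0. \<forall>f A x. test_fun R f \<longrightarrow> Ck_bound R k f A \<longrightarrow> A \<ge> 0 \<longrightarrow>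
     norm (x ^ k *\<^sub>R nth_vderiv n (fourier f) x) \<le> D * A" for k n
    by (rule fourier_seminorm_bound[OF R, of k n]) blast
  then obtain D where D: "\<And>k n. D k n \<ge> 0" "\<And>k n f A x. test_fun R f \<Longrightarrow> Ck_bound R k f A \<Longrightarrow> A \<ge> 0 \<Longrightarrow>
     norm (x ^ k *\<^sub>R nth_vderiv n (fourier f) x) \<le> D k n * A"
    by metis
  show ?thesis
  proof (rule that[of "\<bar>C\<bar> * (\<Sum>k\<le>N. \<Sum>n\<le>N. D k n)" N])
    show "0 \<le> \<bar>C\<bar> * (\<Sum>k\<le>N. \<Sum>n\<le>N. D k n)" by (intro mult_nonneg_nonneg sum_nonneg D) auto
    fix f A assume f: "test_fun R f" "Ck_bound R N f A" "(A::real) \<ge> 0"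
    have sn: "schwartz_seminorm k n (fourier f) \<le> D k n * A" if "k \<le> N" for k n
      unfolding schwartz_seminorm_def
      using that f Ck_bound_mono[OF f(2) order_refl that] by (intro cSUP_least D) auto
    have nn: "0 \<le> schwartz_seminorm k n (fourier f)" for k n
    proof -
      have "bdd_above (range (\<lambda>x. norm (x ^ k *\<^sub>R nth_vderiv n (fourier f) x)))"
        using schwartz_fourier[OF f(1)] unfolding schwartz_def by (auto simp: bounded_iff bdd_above_def)
      then show ?thesis unfolding schwartz_seminorm_def
        by (rule order_trans[OF norm_ge_zero cSUP_upper[of 0], rotated]) auto
    qed
    have "norm (pairing u (fourier f)) \<le> C * (\<Sum>k\<le>N. \<Sum>n\<le>N. schwartz_seminorm k n (fourier f))"
      by (rule C[OF schwartz_fourier[OF f(1)]])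
    also have "\<dots> \<le> \<bar>C\<bar> * (\<Sum>k\<le>N. \<Sum>n\<le>N. schwartz_seminorm k n (fourier f))"
      by (intro mult_right_mono sum_nonneg nn) auto
    also have "\<dots> \<le> \<bar>C\<bar> * (\<Sum>k\<le>N. \<Sum>n\<le>N. D k n * A)"
      by (intro mult_left_mono sum_mono sn) auto
    finally show "norm (pairing u (fourier f)) \<le> \<bar>C\<bar> * (\<Sum>k\<le>N. \<Sum>n\<le>N. D k n) * A"
      by (simp add: sum_distrib_right mult.assoc)
  qed
qed

text \<open>The functions \<open>p(1/x) exp(-1/x)\<close> on the positive half-line, extended by zero.  The family is closed under
  differentiation, with \<open>p\<close> replaced by \<open>X\<^sup>2 (p - p')\<close>, so that all its members are smooth.\<close>
definition flat_exp :: "real poly \<Rightarrow> real \<Rightarrow> complex" where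
  "flat_exp p x = (if x \<le> 0 then 0 else of_real (poly p (1 / x) * exp (- (1 / x))))"

lemma poly_div_exp_tendsto: "((\<lambda>y. y ^ k * poly p y / exp y) \<longlongrightarrow> (0::real)) at_top"
proof (induction p arbitrary: k)
  case (pCons a p)
  have "((\<lambda>y. a * (y ^ k / exp y) + y ^ Suc k * poly p y / exp y) \<longlongrightarrow> a * 0 + 0) at_top"
    by (rule tendsto_add[OF tendsto_mult[OF tendsto_const tendsto_power_div_exp_0] pCons.IH])
  moreover have "(\<lambda>y. y ^ k * poly (pCons a p) y / exp y) = (\<lambda>y. a * (y ^ k / exp y) + y ^ Suc k * poly p y / exp y)"
    by (simp add: fun_eq_iff distrib_left add_divide_distrib mult_ac)
  ultimately show ?case by simp
qed simp

lemma flat_exp_has_vector_derivative: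
  "(flat_exp p has_vector_derivative flat_exp (monom 1 2 * (p - pderiv p)) x) (at x)"
proof -
  consider "x < 0" | "x = 0" | "x > 0" by linarith
  then show ?thesis
  proof cases
    case 1
    have "(flat_exp p has_vector_derivative 0) (at x)"
      by (rule has_vector_derivative_transform_within_open[OF has_vector_derivative_const[of 0], where S="{..<0}"])
         (use 1 in \<open>auto simp: flat_exp_def\<close>)
    then show ?thesis using 1 by (simp add: flat_exp_def)
  next
    case 3
    let ?r = "\<lambda>x. poly p (1 / x) * exp (- (1 / x))"
    have "(?r has_real_derivative poly (monom 1 2 * (p - pderiv p)) (1 / x) * exp (- (1 / x))) (at x)"
      using 3 by (auto intro!: derivative_eq_intros simp: poly_monom field_simps power2_eq_square)
    then have "((\<lambda>x. complex_of_real (?r x)) has_vector_derivative of_real (poly (monom 1 2 * (p - pderiv p)) (1 / x) * exp (- (1 / x)))) (at x)"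
      by (intro has_vector_derivative_of_real) (simp add: has_real_derivative_iff_has_vector_derivative)
    then have "(flat_exp p has_vector_derivative of_real (poly (monom 1 2 * (p - pderiv p)) (1 / x) * exp (- (1 / x)))) (at x)"
      by (rule has_vector_derivative_transform_within_open[where S="{0<..}"])
         (use 3 in \<open>auto simp: flat_exp_def\<close>)
    then show ?thesis using 3 by (simp add: flat_exp_def)
  next
    case 2
    have "((\<lambda>h. (flat_exp p (0 + h) - flat_exp p 0) / of_real h) \<longlongrightarrow> 0) (at 0)"
    proof (rule filterlim_split_at)
      have "eventually (\<lambda>h. (flat_exp p (0 + h) - flat_exp p 0) / of_real h = 0) (at_left 0)"
        by (auto simp: eventually_at_filter flat_exp_def intro!: always_eventually)
      then show "((\<lambda>h. (flat_exp p (0 + h) - flat_exp p 0) / of_real h) \<longlongrightarrow> 0) (at_left 0)"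
        by (rule tendsto_eventually)
      have "((\<lambda>y. of_real (y ^ 1 * poly p y / exp y)) \<longlongrightarrow> complex_of_real 0) at_top"
        by (intro tendsto_of_real poly_div_exp_tendsto)
      then have "((\<lambda>h. of_real (inverse h ^ 1 * poly p (inverse h) / exp (inverse h))) \<longlongrightarrow> (0::complex)) (at_right 0)"
        by (subst filterlim_at_right_to_top) simp
      moreover have "eventually (\<lambda>h. of_real (inverse h ^ 1 * poly p (inverse h) / exp (inverse h)) = (flat_exp p (0 + h) - flat_exp p 0) / of_real h) (at_right 0)"
        by (auto simp: eventually_at_filter flat_exp_def exp_minus field_simps intro!: always_eventually)
      ultimately show "((\<lambda>h. (flat_exp p (0 + h) - flat_exp p 0) / of_real h) \<longlongrightarrow> 0) (at_right 0)"
        using tendsto_cong by force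
    qed
    then show ?thesis using 2 by (intro has_vector_derivative_quotient) (simp add: flat_exp_def)
  qed
qed

lemma smooth_flat_exp: "smooth (flat_exp p)"
proof -
  have "Ck n (flat_exp p)" for n
  proof (induction n arbitrary: p)
    case 0
    show ?case using flat_exp_has_vector_derivative by (auto intro: differentiableI_vector)
  next
    case (Suc n)
    show ?case by (rule Ck_SucI[OF flat_exp_has_vector_derivative Suc])
  qed
  then show ?thesis by (simp add: smooth_def)
qed

lemma smooth_bump_exists:
  assumes d: "0 < d"
  obtains b :: "real \<Rightarrow> real" where "test_fun d (\<lambda>x. of_real (b x))" "\<And>x. 0 \<le> b x" "\<And>x. \<bar>x\<bar> < d \<Longrightarrow> 0 < b x"
     "\<And>x. d \<le> \<bar>x\<bar> \<Longrightarrow> b x = 0" "continuous_on UNIV b"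
proof -
  define b where "b x = Re (flat_exp 1 (1 * x + d) * flat_exp 1 ((-1) * x + d))" for x
  have eq: "of_real (b x) = flat_exp 1 (1 * x + d) * flat_exp 1 ((-1) * x + d)" for x
    by (simp add: b_def flat_exp_def)
  have sm: "smooth (\<lambda>x. of_real (b x))"
    unfolding eq by (intro smooth_mult smooth_affine smooth_flat_exp)
  show ?thesis
  proof (rule that[of b])
    show "continuous_on UNIV b"
      using continuous_on_Re[OF smooth_continuous[OF sm]] by simp
    show "test_fun d (\<lambda>x. of_real (b x))"
      unfolding test_fun_def using sm by (auto simp: b_def flat_exp_def)
  qed (auto simp: b_def flat_exp_def)
qed

text \<open>\<open>\<kappa>\<close> is the difference of the primitive of the bump \<open>\<eta>\<close> shifted by \<open>1 + d\<close> to the left and to the right,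
  in other words the convolution of \<open>\<eta>\<close> with the indicator of \<open>[-1-d, 1+d]\<close>.  The formula for its derivative
  is what identifies its transform as a product in \<open>reproducing_formula\<close>.\<close>
lemma plateau_exists:
  assumes d: "0 < d"
  obtains \<eta> \<kappa> :: "real \<Rightarrow> real" where
    "test_fun d (\<lambda>t. of_real (\<eta> t))" "fourier (\<lambda>t. of_real (\<eta> t)) 0 = 1"
    "test_fun (1 + 2 * d) (\<lambda>t. of_real (\<kappa> t))"
    "\<And>t. \<bar>t\<bar> \<le> 1 \<Longrightarrow> \<kappa> t = 1" "\<And>t. 0 \<le> \<kappa> t" "\<And>t. \<kappa> t \<le> 1"
    "\<And>t. vderiv (\<lambda>t. of_real (\<kappa> t)) t = of_real (\<eta> (t + (1 + d))) - of_real (\<eta> (t - (1 + d)))"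
proof -
  obtain b :: "real \<Rightarrow> real" where b: "test_fun d (\<lambda>x. of_real (b x))" "\<And>x. 0 \<le> b x" "\<And>x. \<bar>x\<bar> < d \<Longrightarrow> 0 < b x"
     "\<And>x. d \<le> \<bar>x\<bar> \<Longrightarrow> b x = 0" "continuous_on UNIV b"
    using smooth_bump_exists[OF d] by blast
  obtain H where H: "\<And>x. (H has_vector_derivative b x) (at x)"
    using einterval_antiderivative[of "-\<infinity>" "\<infinity>" b] b(5) by (auto simp: continuous_on_eq_continuous_at)
  have HD: "(H has_real_derivative b x) (at x)" for x
    using H by (simp add: has_real_derivative_iff_has_vector_derivative)
  have mono: "H x \<le> H y" if "x \<le> y" for x y
    by (rule DERIV_nonneg_imp_nondecreasing[OF that, of H]) (use HD b in auto)
  have up: "H x = H d" if "d \<le> x" for x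
  proof -
    have "(H has_field_derivative 0) (at y within {d..})" if "y \<in> {d..}" for y
      using HD[of y] b(4)[of y] that d by (auto intro: DERIV_subset)
    from has_field_derivative_zero_constant[OF _ this] show ?thesis
      using that by (metis atLeast_iff convex_real_interval(1) order_refl)
  qed
  have lo: "H x = H (-d)" if "x \<le> -d" for x
  proof -
    have "(H has_field_derivative 0) (at y within {..-d})" if "y \<in> {..-d}" for y
      using HD[of y] b(4)[of y] that d by (auto intro: DERIV_subset)
    from has_field_derivative_zero_constant[OF _ this] show ?thesis
      using that by (metis atMost_iff convex_real_interval(2) order_refl)
  qed
  define Z where "Z = H d - H (-d)"
  have "H (-d/2) < H (d/2)"
  proof (rule DERIV_pos_imp_increasing[of "-d/2" "d/2" H])
    fix x assume "-d/2 \<le> x" "x \<le> d/2"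
    then show "\<exists>y. (H has_real_derivative y) (at x) \<and> 0 < y"
      using HD[of x] b(3)[of x] d by (intro exI[of _ "b x"]) auto
  qed (use d in auto)
  then have "H (-d) < H d"
    using mono[of "-d" "-d/2"] mono[of "d/2" d] d by linarith
  then have Z: "Z > 0" by (simp add: Z_def)
  define \<eta> where "\<eta> t = b t / Z" for t
  define \<kappa> where "\<kappa> t = (H (t + (1 + d)) - H (t - (1 + d))) / Z" for t
  have eta: "test_fun d (\<lambda>t. of_real (\<eta> t))"
    using test_fun_mult[OF b(1) smooth_const[of "of_real (1 / Z)"]] by (simp add: \<eta>_def)
  have "(H has_vector_derivative b x) (at x within {-d..d})" for x
    using H has_vector_derivative_at_within by blast
  from integral_FTC_Icc[OF _ this continuous_on_subset[OF b(5)]]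
  have "(LBINT x. indicator {-d..d} x *\<^sub>R b x) = Z"
    using d unfolding Z_def by force
  moreover have "(\<lambda>x. indicator {-d..d} x *\<^sub>R b x) = b"
  proof
    fix x show "indicator {-d..d} x *\<^sub>R b x = b x"
      using b(4)[of x] by (cases "x \<in> {-d..d}") auto
  qed
  ultimately have "(LBINT x. b x) = Z" by simp
  then have f0: "fourier (\<lambda>t. of_real (\<eta> t)) 0 = 1"
    using Z unfolding fourier_cis \<eta>_def by simp
  have kd: "((\<lambda>t. complex_of_real (\<kappa> t)) has_vector_derivative of_real (\<eta> (t + (1 + d))) - of_real (\<eta> (t - (1 + d)))) (at t)" for t
  proof -
    have "(\<kappa> has_real_derivative (\<eta> (t + (1 + d))) - (\<eta> (t - (1 + d)))) (at t)"
      unfolding \<kappa>_def \<eta>_def using Z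
      by (auto intro!: derivative_eq_intros DERIV_chain2[OF HD] simp: diff_divide_distrib)
    from has_vector_derivative_of_real[OF this] show ?thesis by simp
  qed
  have smk: "smooth (\<lambda>t. of_real (\<kappa> t))"
  proof (rule smoothI_vderiv[OF kd])
    have s: "smooth (\<lambda>t. of_real (\<eta> t))" using eta by (simp add: test_fun_def)
    show "smooth (\<lambda>t. of_real (\<eta> (t + (1 + d))) - of_real (\<eta> (t - (1 + d))))"
      using smooth_add[OF smooth_affine[OF s, of 1 "1 + d"] smooth_mult[OF smooth_const[of "-1"] smooth_affine[OF s, of 1 "- (1 + d)"]]]
      by (simp add: algebra_simps)
  qed
  show ?thesis
  proof (rule that[of \<eta> \<kappa>])
    show "test_fun (1 + 2 * d) (\<lambda>t. of_real (\<kappa> t))"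
      unfolding test_fun_def
    proof (intro conjI smk allI impI)
      fix t :: real assume t: "1 + 2 * d < \<bar>t\<bar>"
      show "of_real (\<kappa> t) = (0::complex)"
      proof (cases "t > 0")
        case True
        then show ?thesis using t d up[of "t + (1 + d)"] up[of "t - (1 + d)"] by (simp add: \<kappa>_def)
      next
        case False
        then show ?thesis using t d lo[of "t + (1 + d)"] lo[of "t - (1 + d)"] by (simp add: \<kappa>_def)
      qed
    qed
    show "\<kappa> t = 1" if "\<bar>t\<bar> \<le> 1" for t
      using that up[of "t + (1 + d)"] lo[of "t - (1 + d)"] Z by (simp add: \<kappa>_def Z_def)
    show "0 \<le> \<kappa> t" for t using mono[of "t - (1 + d)" "t + (1 + d)"] d Z by (simp add: \<kappa>_def)
    show "\<kappa> t \<le> 1" for t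
    proof -
      have "H x \<le> H d" for x using mono[of x d] up[of x] by linarith
      moreover have "H (-d) \<le> H x" for x using mono[of "-d" x] lo[of x] by linarith
      ultimately have "H (t + (1 + d)) - H (t - (1 + d)) \<le> Z" unfolding Z_def by (metis diff_mono)
      then show ?thesis using Z by (simp add: \<kappa>_def)
    qed
    show "vderiv (\<lambda>t. of_real (\<kappa> t)) t = of_real (\<eta> (t + (1 + d))) - of_real (\<eta> (t - (1 + d)))" for t
      by (rule vector_derivative_at[OF kd])
  qed (use eta f0 in auto)
qed

section \<open>Continuous tempered functions with bounded spectrum\<close>

lemma fourier_shift: "fourier (\<lambda>t. f (t - s)) x = cis (- (2 * pi * s * x)) * fourier f x"
proof -
  have "fourier (\<lambda>t. f (t - s)) x = (LBINT t. f (s + 1 * t - s) * cis (- (2 * pi * (s + 1 * t) * x)))"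
    unfolding fourier_cis
    by (subst lborel_integral_real_affine[of 1 "\<lambda>t. f (t - s) * cis (- (2 * pi * t * x))" s]) auto
  also have "\<dots> = (LBINT t. cis (- (2 * pi * s * x)) * (f t * cis (- (2 * pi * t * x))))"
  proof (intro Bochner_Integration.integral_cong refl)
    fix t
    have "- (2 * pi * (s + 1 * t) * x) = - (2 * pi * s * x) + - (2 * pi * t * x)" by (simp add: algebra_simps)
    then have "cis (- (2 * pi * (s + 1 * t) * x)) = cis (- (2 * pi * s * x)) * cis (- (2 * pi * t * x))"
      by (simp only: cis_mult)
    then show "f (s + 1 * t - s) * cis (- (2 * pi * (s + 1 * t) * x)) = cis (- (2 * pi * s * x)) * (f t * cis (- (2 * pi * t * x)))"
      by simp
  qed
  finally show ?thesis unfolding fourier_cis by simp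
qed

lemma fourier_modulate: "fourier (\<lambda>t. cis (t * (2 * pi * c)) * f t) x = fourier f (x - c)"
  unfolding fourier_cis
proof (intro Bochner_Integration.integral_cong refl)
  fix t
  have "t * (2 * pi * c) + - (2 * pi * t * x) = - (2 * pi * t * (x - c))" by (simp add: algebra_simps)
  then have "cis (t * (2 * pi * c)) * cis (- (2 * pi * t * x)) = cis (- (2 * pi * t * (x - c)))" by (simp only: cis_mult)
  then show "cis (t * (2 * pi * c)) * f t * cis (- (2 * pi * t * x)) = f t * cis (- (2 * pi * t * (x - c)))"
    by (metis mult.assoc mult.commute)
qed

lemma fourier_add:
  "integrable lborel f \<Longrightarrow> integrable lborel g \<Longrightarrow> fourier (\<lambda>t. f t + g t) x = fourier f x + fourier g x"
  unfolding fourier_cis by (simp add: distrib_right integrable_mult_cis)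

lemma fourier_cmult: "fourier (\<lambda>t. c * f t) x = c * fourier f x"
  unfolding fourier_cis by (simp add: mult.assoc)

lemma fourier_indicator:
  assumes a: "0 \<le> a"
  shows "2 * pi * \<i> * of_real y * fourier (\<lambda>t. indicator {-a..a} t) y = cis (2 * pi * a * y) - cis (- (2 * pi * a * y))"
proof -
  let ?w = "- (2 * pi * y)"
  have d: "((\<lambda>t. cis (t * ?w)) has_vector_derivative \<i> * of_real ?w * cis (t * ?w)) (at t within A)" for t A
    by (rule has_vector_derivative_at_within[OF cis_has_vector_derivative])
  have "(LBINT t. indicator {-a..a} t *\<^sub>R (\<i> * of_real ?w * cis (t * ?w))) = cis (a * ?w) - cis (-a * ?w)"
    using a by (intro integral_FTC_Icc d continuous_intros) auto
  also have "(\<lambda>t. indicator {-a..a} t *\<^sub>R (\<i> * of_real ?w * cis (t * ?w))) = (\<lambda>t. \<i> * of_real ?w * (indicator {-a..a} t * cis (- (2 * pi * t * y))))"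
    by (auto simp: fun_eq_iff indicator_def mult_ac)
  also have "(LBINT t. \<i> * of_real ?w * (indicator {-a..a} t * cis (- (2 * pi * t * y)))) = \<i> * of_real ?w * fourier (\<lambda>t. indicator {-a..a} t) y"
    unfolding fourier_cis by (rule integral_mult_right_zero)
  finally have "\<i> * of_real ?w * fourier (\<lambda>t. indicator {-a..a} t) y = cis (- (2 * pi * a * y)) - cis (2 * pi * a * y)"
    by (simp add: mult_ac)
  then have "- (\<i> * of_real ?w * fourier (\<lambda>t. indicator {-a..a} t) y) = cis (2 * pi * a * y) - cis (- (2 * pi * a * y))"
    by simp
  then show ?thesis by (simp add: mult_ac)
qed

lemma pairing_integrable: "defines_tempered_distribution u \<Longrightarrow> schwartz \<phi> \<Longrightarrow> integrable lborel (\<lambda>x. of_real (u x) * \<phi> x)"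
  by (simp add: defines_tempered_distribution_def)

lemma pairing_fourier_add:
  assumes "defines_tempered_distribution u" "test_fun R f" "test_fun R g"
  shows "pairing u (fourier (\<lambda>t. f t + g t)) = pairing u (fourier f) + pairing u (fourier g)"
proof -
  have "fourier (\<lambda>t. f t + g t) = (\<lambda>x. fourier f x + fourier g x)"
    using assms by (intro ext fourier_add test_fun_integrable)
  then show ?thesis
    unfolding pairing_def using assms
    by (simp add: distrib_left pairing_integrable schwartz_fourier)
qed

lemma pairing_fourier_cmult: "pairing u (fourier (\<lambda>t. c * f t)) = c * pairing u (fourier f)"
proof -
  have "fourier (\<lambda>t. c * f t) = (\<lambda>x. c * fourier f x)" by (intro ext fourier_cmult)
  then show ?thesis unfolding pairing_def by (simp add: mult.left_commute)
qed

lemma pairing_fourier_sum: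
  assumes "defines_tempered_distribution u" "finite S" "\<And>i. i \<in> S \<Longrightarrow> test_fun R (f i)"
  shows "pairing u (fourier (\<lambda>t. \<Sum>i\<in>S. f i t)) = (\<Sum>i\<in>S. pairing u (fourier (f i)))"
  using assms(2,3)
proof (induction S)
  case empty
  have "pairing u (fourier (\<lambda>t. 0 * 0)) = 0" by (subst pairing_fourier_cmult) simp
  then show ?case by simp
next
  case (insert i S)
  have "test_fun R (\<lambda>t. \<Sum>i\<in>S. f i t)"
    using insert.prems by (auto simp: test_fun_def intro!: smooth_sum)
  then show ?case using insert by (simp add: pairing_fourier_add[OF assms(1), of R])
qed

text \<open>Let \<open>ch\<close> be the transform of \<open>\<eta>\<close>, so that \<open>ch(0) = 1\<close>.  Then \<open>f(x) = u(x) ch(x - c)\<close> is integrable and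
  continuous with \<open>f(c) = u(c)\<close>.  The value of its transform at \<open>t\<close> is the spectrum of \<open>u\<close>
  tested against a bump around \<open>t\<close> of radius \<open>d\<close>, which is zero for \<open>\<bar>t\<bar> > 1 + d\<close>.  So inverting the transform of \<open>f\<close> at \<open>c\<close>
  is an integration over \<open>[-1-d, 1+d]\<close> only; moving the transform to the other factor leaves
  the kernel \<open>ch\<close> times the transform of an indicator, and this product is the transform of \<open>\<kappa>\<close>.\<close>
lemma reproducing_formula:
  fixes \<eta> \<kappa> :: "real \<Rightarrow> real"
  assumes cont: "continuous_on UNIV u" and temp: "defines_tempered_distribution u"
    and spec: "\<And>\<phi> R. test_fun R \<phi> \<Longrightarrow> closure {x. \<phi> x \<noteq> 0} \<subseteq> {..< - 1} \<union> {1 <..} \<Longrightarrow> distr_fourier u \<phi> = 0"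
    and d: "0 < d" and eta: "test_fun d (\<lambda>t. of_real (\<eta> t))" and eta0: "fourier (\<lambda>t. of_real (\<eta> t)) 0 = 1"
    and kap: "test_fun (1 + 2 * d) (\<lambda>t. of_real (\<kappa> t))"
    and kd: "\<And>t. vderiv (\<lambda>t. of_real (\<kappa> t)) t = of_real (\<eta> (t + (1 + d))) - of_real (\<eta> (t - (1 + d)))"
  shows "of_real (u c) = pairing u (fourier (\<lambda>t. cis (t * (2 * pi * c)) * of_real (\<kappa> t)))"
proof -
  define ch where "ch = fourier (\<lambda>t. of_real (\<eta> t))"
  define a where "a = 1 + d"
  define w where "w t = indicator {-a..a} t * cis (2 * pi * t * c)" for t :: real
  let ?h = "\<lambda>t. cis (t * (2 * pi * c)) * of_real (\<eta> t)"
  have th: "test_fun d ?h" using test_fun_mult[OF eta smooth_cis] by simp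
  have fh: "fourier ?h x = ch (x - c)" for x unfolding ch_def by (rule fourier_modulate)
  define f where "f x = of_real (u x) * ch (x - c)" for x
  have f_int: "integrable lborel f"
    using pairing_integrable[OF temp schwartz_fourier[OF th]] unfolding f_def fh .
  have contx: "continuous_on UNIV ch" unfolding ch_def
    by (intro continuous_fourier test_fun_integrable[OF eta])
  have f_cont: "continuous_on UNIV f" unfolding f_def
    by (intro continuous_intros cont continuous_on_compose2[OF contx]) auto
  have ff0: "fourier f t = 0" if t: "a < \<bar>t\<bar>" for t
  proof -
    have "(\<lambda>s. ?h (s - t)) = (\<lambda>s. ?h (1 * s + (-t)))" by simp
    then have "smooth (\<lambda>s. ?h (s - t))"
      using smooth_affine[of ?h 1 "-t"] th unfolding test_fun_def by (simp only:)
    then have tt: "test_fun (\<bar>t\<bar> + d) (\<lambda>s. ?h (s - t))"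
      using th unfolding test_fun_def by auto
    have "{x. ?h (x - t) \<noteq> 0} \<subseteq> {t - d..t + d}"
      using th by (auto simp: test_fun_def abs_if not_less split: if_splits) (smt (verit))+
    then have "closure {x. ?h (x - t) \<noteq> 0} \<subseteq> {t - d..t + d}"
      by (rule closure_minimal) auto
    also have "\<dots> \<subseteq> {..< - 1} \<union> {1 <..}" using t by (auto simp: a_def)
    finally have "0 = distr_fourier u (\<lambda>s. ?h (s - t))" using spec[OF tt] by simp
    also have "\<dots> = fourier f t"
      unfolding distr_fourier_def pairing_def fourier_shift[of ?h t] fh unfolding f_def fourier_cis[of _ t]
      by (intro Bochner_Integration.integral_cong refl) (simp add: mult_ac)
    finally show ?thesis by simp
  qed
  have ff_int: "integrable lborel (fourier f)"
    by (rule integrable_support_Icc[OF continuous_fourier[OF f_int] ff0])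
  have w_int: "integrable lborel w" unfolding w_def
  proof (rule integrable_mult_cis)
    have "integrable lborel (\<lambda>t. indicator {-a..a} t *\<^sub>R (1::complex))"
      by (intro borel_integrable_compact continuous_intros) auto
    moreover have "(\<lambda>t. indicator {-a..a} t *\<^sub>R (1::complex)) = indicator {-a..a}"
      by (auto simp: fun_eq_iff indicator_def)
    ultimately show "integrable lborel (\<lambda>t. indicator {-a..a} t :: complex)" by simp
  qed simp
  have fw: "fourier w x = fourier (\<lambda>t. indicator {-a..a} t) (x - c)" for x
    unfolding fourier_modulate[symmetric] w_def by (simp add: mult_ac)
  have key: "ch y * fourier (\<lambda>t. indicator {-a..a} t) y = fourier (\<lambda>t. of_real (\<kappa> t)) y" if "y \<noteq> 0" for y
  proof -
    have i: "integrable lborel (\<lambda>t. of_real (\<eta> (t - s)) :: complex)" for s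
      using lborel_integrable_real_affine[OF test_fun_integrable[OF eta], of 1 "-s"] by simp
    have i2: "integrable lborel (\<lambda>t. (-1) * of_real (\<eta> (t - s)) :: complex)" for s
      using i by (rule integrable_mult_right)
    have e: "t - (-a) = t + (1 + d)" "t - a = t - (1 + d)" for t by (simp_all add: a_def)
    have "2 * pi * \<i> * of_real y * fourier (\<lambda>t. of_real (\<kappa> t)) y = fourier (\<lambda>t. of_real (\<eta> (t - (-a))) + (-1) * of_real (\<eta> (t - a))) y"
      unfolding fourier_vderiv[OF kap, symmetric] kd e by (simp only: mult_minus1 add_uminus_conv_diff)
    also have "\<dots> = cis (2 * pi * a * y) * ch y - cis (- (2 * pi * a * y)) * ch y"
      unfolding fourier_add[OF i i2] fourier_cmult ch_def
      using fourier_shift[of "\<lambda>t. of_real (\<eta> t)" "-a" y] fourier_shift[of "\<lambda>t. of_real (\<eta> t)" a y] by simp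
    also have "\<dots> = 2 * pi * \<i> * of_real y * (ch y * fourier (\<lambda>t. indicator {-a..a} t) y)"
    proof -
      have "2 * pi * \<i> * of_real y * (ch y * fourier (\<lambda>t. indicator {-a..a} t) y) =
        ch y * (2 * pi * \<i> * of_real y * fourier (\<lambda>t. indicator {-a..a} t) y)"
        by (simp only: mult_ac)
      also have "\<dots> = ch y * (cis (2 * pi * a * y) - cis (- (2 * pi * a * y)))"
        using d by (subst fourier_indicator) (simp_all add: a_def)
      finally show ?thesis by (simp only: right_diff_distrib mult.commute[of "ch y"])
    qed
    finally show ?thesis using that by simp
  qed
  have "of_real (u c) = f c" using eta0 by (simp add: f_def ch_def)
  also have "f c = (LBINT t. fourier f t * cis (2 * pi * t * c))"
    using f_cont by (intro fourier_inversion f_int ff_int) (auto simp: continuous_on_eq_continuous_at)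
  also have "\<dots> = (LBINT t. fourier f t * w t)"
  proof (intro Bochner_Integration.integral_cong refl)
    fix t show "fourier f t * cis (2 * pi * t * c) = fourier f t * w t"
      using ff0[of t] by (cases "a < \<bar>t\<bar>") (auto simp: w_def indicator_def)
  qed
  also have "\<dots> = (LBINT x. f x * fourier w x)"
    by (rule fourier_multiplication[OF f_int w_int, symmetric])
  also have "\<dots> = (LBINT x. of_real (u x) * fourier (\<lambda>t. of_real (\<kappa> t)) (x - c))"
  proof (rule integral_cong_AE)
    show "(\<lambda>x. f x * fourier w x) \<in> borel_measurable lborel"
      using f_int w_int by (auto dest: borel_measurable_integrable)
    have "continuous_on UNIV (fourier (\<lambda>t. of_real (\<kappa> t)))"
      by (intro continuous_fourier test_fun_integrable[OF kap])
    then show "(\<lambda>x. of_real (u x) * fourier (\<lambda>t. of_real (\<kappa> t)) (x - c)) \<in> borel_measurable lborel"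
      unfolding measurable_lborel2
      by (intro borel_measurable_continuous_onI continuous_intros cont) (erule continuous_on_compose2, auto intro: continuous_intros)
    show "AE x in lborel. f x * fourier w x = of_real (u x) * fourier (\<lambda>t. of_real (\<kappa> t)) (x - c)"
      using AE_lborel_singleton[of c]
    proof eventually_elim
      case (elim x)
      then show ?case using key[of "x - c"] by (simp add: f_def fw mult.assoc)
    qed
  qed
  also have "\<dots> = pairing u (fourier (\<lambda>t. cis (t * (2 * pi * c)) * of_real (\<kappa> t)))"
    unfolding pairing_def fourier_modulate ..
  finally show ?thesis .
qed

lemma Ck_bound_cmult:
  assumes "smooth f" "Ck_bound R k f A"
  shows "Ck_bound R k (\<lambda>t. c * f t) (norm c * A)"
  using assms
proof (induction k arbitrary: f)
  case 0 then show ?case by (auto simp: Ck_bound_0 norm_mult mult_left_mono)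
next
  case (Suc k)
  have v: "vderiv (\<lambda>t. c * f t) = (\<lambda>t. c * vderiv f t)"
    by (intro vderiv_eqI has_vector_derivative_mult_right smooth_has_vector_derivative Suc.prems)
  show ?case
    using Suc.prems Suc.IH[OF smooth_vderiv, of f] unfolding Ck_bound_Suc v
    by (auto simp: Ck_bound_0 norm_mult mult_left_mono)
qed

lemma monomial_has_vector_derivative:
  "((\<lambda>t. (w * of_real t) ^ n) has_vector_derivative (of_nat n * w) * (w * of_real t) ^ (n - 1)) (at t)" for w :: complex
  by (rule has_vector_derivative_real_field) (auto intro!: derivative_eq_intros)

text \<open>Differentiation multiplies the bound \<open>M\<^sup>n\<close> by polynomial factors in \<open>n\<close> only; therefore the exponential type
  of the extension is governed by the support of the cut-off alone.\<close>
lemma Ck_bound_monomial: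
  assumes M: "norm w \<le> M" "norm w * R \<le> M" "1 \<le> M"
  shows "Ck_bound R k (\<lambda>t. (w * of_real t) ^ n) ((real (n + 1) * M) ^ k * M ^ n)"
proof (induction k arbitrary: n)
  case 0
  show ?case
  proof (unfold Ck_bound_0, intro allI impI)
    fix t assume "\<bar>t\<bar> \<le> R"
    then have "norm w * \<bar>t\<bar> \<le> M" using M mult_left_mono[of "\<bar>t\<bar>" R "norm w"] by auto
    then show "norm ((w * of_real t) ^ n) \<le> (real (n + 1) * M) ^ 0 * M ^ n"
      by (simp add: norm_power norm_mult power_mono del: power_mult_distrib)
  qed
next
  case (Suc k)
  have M1: "1 \<le> real (n + 1) * M" using M mult_mono[of 1 "real (n + 1)" 1 M] by simp
  have v: "vderiv (\<lambda>t. (w * of_real t) ^ n) = (\<lambda>t. (of_nat n * w) * (w * of_real t) ^ (n - 1))"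
    by (intro vderiv_eqI monomial_has_vector_derivative)
  have "Ck_bound R k (\<lambda>t. (of_nat n * w) * (w * of_real t) ^ (n - 1)) (norm (of_nat n * w) * ((real (n - 1 + 1) * M) ^ k * M ^ (n - 1)))"
    by (intro Ck_bound_cmult smooth_monomial Suc.IH)
  moreover have "norm (of_nat n * w) * ((real (n - 1 + 1) * M) ^ k * M ^ (n - 1)) \<le> (real (n + 1) * M) ^ Suc k * M ^ n"
  proof (cases "n = 0")
    case False
    have "norm (of_nat n * w) * ((real (n - 1 + 1) * M) ^ k * M ^ (n - 1)) \<le> (real (n + 1) * M) * ((real (n + 1) * M) ^ k * M ^ n)"
      using M by (intro mult_mono power_mono power_increasing mult_nonneg_nonneg) (auto simp: norm_mult intro!: mult_mono)
    then show ?thesis by (simp add: mult.assoc)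
  qed (use M in auto)
  ultimately have 1: "Ck_bound R k (vderiv (\<lambda>t. (w * of_real t) ^ n)) ((real (n + 1) * M) ^ Suc k * M ^ n)"
    unfolding v by (rule Ck_bound_mono) simp
  have "(real (n + 1) * M) ^ k * M ^ n \<le> (real (n + 1) * M) ^ Suc k * M ^ n"
    using M M1 by (intro mult_right_mono power_increasing) auto
  then have "Ck_bound R 0 (\<lambda>t. (w * of_real t) ^ n) ((real (n + 1) * M) ^ Suc k * M ^ n)"
    using Ck_bound_mono[OF Suc.IH[of n], of _ 0] by simp
  then show ?case using 1 by (simp add: Ck_bound_Suc)
qed

text \<open>The remainder of order \<open>L\<close> in the exponential series of \<open>cis (t c)\<close>.  Its derivative is a multiple of the
  remainder of order \<open>L - 1\<close>, so that it tends to zero in every \<open>C\<^sup>k\<close> norm on bounded intervals.\<close>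
definition cis_remainder :: "real \<Rightarrow> nat \<Rightarrow> real \<Rightarrow> complex" where
  "cis_remainder c L t = cis (t * c) - (\<Sum>n<L. (\<i> * of_real c * of_real t) ^ n / fact n)"

lemma norm_cis_remainder: "norm (cis_remainder c L t) \<le> \<bar>t * c\<bar> ^ L / fact L"
proof (cases L)
  case (Suc n)
  then show ?thesis using iexp_approx1[of "t * c" n]
    by (simp add: cis_remainder_def cis_conv_exp lessThan_Suc_atMost mult_ac)
qed (simp add: cis_remainder_def)

lemma smooth_cis_remainder: "smooth (cis_remainder c L)"
proof -
  have "smooth (\<lambda>t. cis (t * c) + (-1) * (\<Sum>n<L. (1 / fact n) * (\<i> * of_real c * of_real t) ^ n))"
    by (intro smooth_add smooth_cis smooth_mult smooth_const smooth_sum smooth_monomial)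
  then show ?thesis by (simp add: cis_remainder_def[abs_def])
qed

lemma vderiv_cis_remainder: "vderiv (cis_remainder c (Suc L)) = (\<lambda>t. (\<i> * of_real c) * cis_remainder c L t)"
proof (rule vderiv_eqI)
  fix t
  let ?w = "\<i> * of_real c"
  have "((\<lambda>t. (?w * of_real t) ^ n / fact n) has_vector_derivative (of_nat n * ?w) * (?w * of_real t) ^ (n - 1) / fact n) (at t)" for n
    by (intro has_vector_derivative_divide monomial_has_vector_derivative)
  then have "(cis_remainder c (Suc L) has_vector_derivative
     ?w * cis (t * c) - (\<Sum>n<Suc L. (of_nat n * ?w) * (?w * of_real t) ^ (n - 1) / fact n)) (at t)"
    unfolding cis_remainder_def[abs_def]
    by (rule has_vector_derivative_diff[OF cis_has_vector_derivative has_vector_derivative_sum])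
  also have "(\<Sum>n<Suc L. (of_nat n * ?w) * (?w * of_real t) ^ (n - 1) / fact n) = (\<Sum>n<L. ?w * ((?w * of_real t) ^ n / fact n))"
    unfolding sum.lessThan_Suc_shift by (simp add: field_simps del: of_nat_Suc)
  also have "?w * cis (t * c) - (\<Sum>n<L. ?w * ((?w * of_real t) ^ n / fact n)) = ?w * cis_remainder c L t"
    by (simp add: cis_remainder_def right_diff_distrib sum_distrib_left)
  finally show "(cis_remainder c (Suc L) has_vector_derivative ?w * cis_remainder c L t) (at t)" .
qed

lemma Ck_bound_cis_remainder:
  assumes R: "0 \<le> R"
  shows "k \<le> L \<Longrightarrow> Ck_bound R k (cis_remainder c L) (\<Sum>j\<le>k. \<bar>c\<bar> ^ j * ((R * \<bar>c\<bar>) ^ (L - j) / fact (L - j)))"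
proof (induction k arbitrary: L)
  case 0
  show ?case
  proof (unfold Ck_bound_0, intro allI impI)
    fix t assume "\<bar>t\<bar> \<le> R"
    then have "\<bar>t * c\<bar> ^ L / fact L \<le> (R * \<bar>c\<bar>) ^ L / fact L"
      using R by (intro divide_right_mono power_mono) (auto simp: abs_mult mult_right_mono)
    then show "norm (cis_remainder c L t) \<le> (\<Sum>j\<le>0. \<bar>c\<bar> ^ j * ((R * \<bar>c\<bar>) ^ (L - j) / fact (L - j)))"
      using norm_cis_remainder[of c L t] by simp
  qed
next
  case (Suc k)
  let ?e = "\<lambda>L. (R * \<bar>c\<bar>) ^ L / fact L"
  obtain L' where L: "L = Suc L'" "k \<le> L'" using Suc.prems by (cases L) auto
  have S: "(\<Sum>j\<le>Suc k. \<bar>c\<bar> ^ j * ?e (L - j)) = ?e L + \<bar>c\<bar> * (\<Sum>j\<le>k. \<bar>c\<bar> ^ j * ?e (L' - j))"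
    unfolding sum.atMost_Suc_shift L by (simp add: sum_distrib_left mult.assoc)
  have nn: "0 \<le> (\<Sum>j\<le>k. \<bar>c\<bar> ^ j * ?e (L' - j))" "0 \<le> ?e L"
    using R by (auto intro!: sum_nonneg)
  have "Ck_bound R k (vderiv (cis_remainder c L)) (norm (\<i> * complex_of_real c) * (\<Sum>j\<le>k. \<bar>c\<bar> ^ j * ?e (L' - j)))"
    unfolding L(1) vderiv_cis_remainder by (intro Ck_bound_cmult smooth_cis_remainder Suc.IH L)
  then have 1: "Ck_bound R k (vderiv (cis_remainder c L)) (\<Sum>j\<le>Suc k. \<bar>c\<bar> ^ j * ?e (L - j))"
  proof (rule Ck_bound_mono)
    have "norm (\<i> * complex_of_real c) = \<bar>c\<bar>" by (simp add: norm_mult)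
    then show "norm (\<i> * complex_of_real c) * (\<Sum>j\<le>k. \<bar>c\<bar> ^ j * ?e (L' - j)) \<le> (\<Sum>j\<le>Suc k. \<bar>c\<bar> ^ j * ?e (L - j))"
      unfolding S using nn(2) by simp
  qed simp
  have "norm (cis_remainder c L t) \<le> (\<Sum>j\<le>Suc k. \<bar>c\<bar> ^ j * ?e (L - j))" if "\<bar>t\<bar> \<le> R" for t
  proof -
    have "\<bar>t * c\<bar> ^ L / fact L \<le> ?e L"
      using R that by (intro divide_right_mono power_mono) (auto simp: abs_mult mult_right_mono)
    also have "\<dots> \<le> (\<Sum>j\<le>Suc k. \<bar>c\<bar> ^ j * ?e (L - j))" unfolding S using mult_nonneg_nonneg[OF abs_ge_zero[of c] nn(1)] by linarith
    finally show ?thesis using norm_cis_remainder[of c L t] by simp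
  qed
  then show ?case using 1 by (simp add: Ck_bound_Suc Ck_bound_0)
qed

lemma cis_remainder_bound_tendsto:
  "(\<lambda>L. \<Sum>j\<le>k. \<bar>c\<bar> ^ j * ((R * \<bar>c\<bar>) ^ (L - j) / fact (L - j))) \<longlonglongrightarrow> (0::real)"
proof -
  have "(\<lambda>L. (R * \<bar>c\<bar>) ^ (L - j) / fact (L - j)) \<longlonglongrightarrow> 0" for j
  proof -
    have "(\<lambda>n. (R * \<bar>c\<bar>) ^ n /\<^sub>R fact n) \<longlonglongrightarrow> 0" using summable_LIMSEQ_zero[OF summable_exp_generic] .
    then have "(\<lambda>n. (R * \<bar>c\<bar>) ^ n / fact n) \<longlonglongrightarrow> 0" by (simp add: field_simps)
    then show ?thesis using LIMSEQ_offset[of "\<lambda>L. (R * \<bar>c\<bar>) ^ (L - j) / fact (L - j)" j 0] by simp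
  qed
  then have "(\<lambda>L. \<Sum>j\<le>k. \<bar>c\<bar> ^ j * ((R * \<bar>c\<bar>) ^ (L - j) / fact (L - j))) \<longlonglongrightarrow> (\<Sum>j\<le>k. \<bar>c\<bar> ^ j * 0)"
    by (intro tendsto_sum tendsto_mult tendsto_const)
  then show ?thesis by simp
qed

lemma exp_type_power_series:
  fixes a :: "nat \<Rightarrow> complex"
  assumes "\<And>\<epsilon>. \<epsilon> > 0 \<Longrightarrow> \<exists>C. \<forall>n. norm (a n) \<le> C * (\<tau> + \<epsilon>) ^ n"
  shows "exp_type_at_most \<tau> (\<lambda>z. \<Sum>n. a n * z ^ n / fact n)"
    and "(\<lambda>n. a n * z ^ n / fact n) sums (\<Sum>n. a n * z ^ n / fact n)"
proof -
  have b: "\<exists>C>0. \<forall>z. summable (\<lambda>n. norm (a n * z ^ n / fact n)) \<and> (\<Sum>n. norm (a n * z ^ n / fact n)) \<le> C * exp ((\<tau> + \<epsilon>) * norm z)"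
    if e: "\<epsilon> > 0" for \<epsilon>
  proof -
    obtain C where C: "\<And>n. norm (a n) \<le> C * (\<tau> + \<epsilon>) ^ n" using assms(1)[OF e] by blast
    have C0: "0 \<le> C" using order_trans[OF norm_ge_zero C[of 0]] by simp
    have le: "norm (a n * z ^ n / fact n) \<le> C * (((\<tau> + \<epsilon>) * norm z) ^ n /\<^sub>R fact n)" for n z
    proof -
      have "norm (a n) * (norm z ^ n / fact n) \<le> C * (\<tau> + \<epsilon>) ^ n * (norm z ^ n / fact n)"
        by (intro mult_right_mono C) auto
      moreover have "norm (a n * z ^ n / fact n) = norm (a n) * (norm z ^ n / fact n)"
        by (simp add: norm_mult norm_divide norm_power)
      moreover have "C * (((\<tau> + \<epsilon>) * norm z) ^ n /\<^sub>R fact n) = C * (\<tau> + \<epsilon>) ^ n * (norm z ^ n / fact n)"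
        by (simp add: power_mult_distrib divide_inverse mult_ac)
      ultimately show ?thesis by linarith
    qed
    have s: "(\<lambda>n. C * (((\<tau> + \<epsilon>) * norm z) ^ n /\<^sub>R fact n)) sums (C * exp ((\<tau> + \<epsilon>) * norm z))" for z :: complex
      by (intro sums_mult exp_converges)
    show ?thesis
    proof (intro exI[of _ "C + 1"] conjI allI)
      show "0 < C + 1" using C0 by simp
      fix z
      show sm: "summable (\<lambda>n. norm (a n * z ^ n / fact n))"
        by (rule summable_comparison_test'[OF sums_summable[OF s[of z]], of 0]) (use le in auto)
      have "(\<Sum>n. norm (a n * z ^ n / fact n)) \<le> C * exp ((\<tau> + \<epsilon>) * norm z)"
        using suminf_le[OF le sm sums_summable[OF s]] sums_unique[OF s[of z]] by simp
      also have "\<dots> \<le> (C + 1) * exp ((\<tau> + \<epsilon>) * norm z)" by simp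
      finally show "(\<Sum>n. norm (a n * z ^ n / fact n)) \<le> (C + 1) * exp ((\<tau> + \<epsilon>) * norm z)" .
    qed
  qed
  have sm: "summable (\<lambda>n. norm (a n * z ^ n / fact n))" for z using b[of 1] by auto
  show S: "(\<lambda>n. a n * z ^ n / fact n) sums (\<Sum>n. a n * z ^ n / fact n)" for z
    by (rule summable_sums[OF summable_norm_cancel[OF sm]])
  show "exp_type_at_most \<tau> (\<lambda>z. \<Sum>n. a n * z ^ n / fact n)"
    unfolding exp_type_at_most_def
  proof (intro conjI allI impI)
    have "(\<lambda>z. \<Sum>n. a n * z ^ n / fact n) holomorphic_on ball 0 r" for r
      by (rule power_series_holomorphic[of _ _ "\<lambda>n. a n / fact n"]) (use S in \<open>simp add: field_simps\<close>)
    then have "(\<lambda>z. \<Sum>n. a n * z ^ n / fact n) field_differentiable (at z)" for z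
      by (rule holomorphic_on_imp_differentiable_at[of _ "ball 0 (norm z + 1)"]) auto
    then show "(\<lambda>z. \<Sum>n. a n * z ^ n / fact n) holomorphic_on UNIV"
      by (simp add: holomorphic_on_def)
    fix \<epsilon> :: real assume "\<epsilon> > 0"
    from b[OF this] obtain C where C: "C > 0" "\<And>z. (\<Sum>n. norm (a n * z ^ n / fact n)) \<le> C * exp ((\<tau> + \<epsilon>) * norm z)"
      by blast
    show "\<exists>C>0. \<forall>z. norm (\<Sum>n. a n * z ^ n / fact n) \<le> C * exp ((\<tau> + \<epsilon>) * norm z)"
      using C summable_norm[OF sm] by (meson order_trans)
  qed
qed

text \<open>Apply \<open>x\<^sup>N \<le> N! e\<^sup>x\<close> to \<open>x = (n + 1) ln ((M + \<epsilon>) / M)\<close>.\<close>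
lemma polynomial_le_geometric:
  fixes M \<epsilon> :: real
  assumes "0 < M" "0 < \<epsilon>"
  shows "\<exists>C\<ge>0. \<forall>n. (real (n + 1)) ^ N * M ^ n \<le> C * (M + \<epsilon>) ^ n"
proof -
  define s where "s = ln ((M + \<epsilon>) / M)"
  have s: "s > 0" using assms by (simp add: s_def)
  have es: "exp s = (M + \<epsilon>) / M" using assms by (simp add: s_def)
  have p: "x ^ N \<le> fact N * exp x" if "x \<ge> 0" for x :: real
  proof -
    have "(\<Sum>n\<in>{N}. x ^ n /\<^sub>R fact n) \<le> (\<Sum>n. x ^ n /\<^sub>R fact n)"
      using that by (intro sum_le_suminf summable_exp_generic) auto
    then show ?thesis by (simp add: exp_def field_simps)
  qed
  show ?thesis
  proof (intro exI[of _ "fact N * exp s / s ^ N"] conjI allI)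
    show "0 \<le> fact N * exp s / s ^ N" using s by simp
    fix n
    have "(real (n + 1) * s) ^ N \<le> fact N * exp (real (n + 1) * s)" using s by (intro p) auto
    also have "exp (real (n + 1) * s) = exp s * ((M + \<epsilon>) / M) ^ n"
      by (simp add: es[symmetric] exp_of_nat_mult[symmetric] exp_add[symmetric] algebra_simps)
    finally have "real (n + 1) ^ N * s ^ N \<le> fact N * (exp s * ((M + \<epsilon>) / M) ^ n)"
      by (simp only: power_mult_distrib)
    then have "real (n + 1) ^ N \<le> fact N * exp s / s ^ N * ((M + \<epsilon>) / M) ^ n"
      using s by (simp add: pos_le_divide_eq mult.assoc)
    then have "real (n + 1) ^ N * M ^ n \<le> fact N * exp s / s ^ N * ((M + \<epsilon>) / M) ^ n * M ^ n"
      using assms by (intro mult_right_mono) auto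
    then show "real (n + 1) ^ N * M ^ n \<le> fact N * exp s / s ^ N * (M + \<epsilon>) ^ n"
      using assms by (simp add: power_divide)
  qed
qed

lemma entire_eq_on_reals:
  assumes "f holomorphic_on UNIV" "g holomorphic_on UNIV" "\<And>x::real. f (of_real x) = g (of_real x)"
  shows "f = g"
proof
  fix w
  have "(\<lambda>z. f z - g z) w = 0"
  proof (rule analytic_continuation[of "\<lambda>z. f z - g z" UNIV "range of_real" 0 w])
    show "(0::complex) islimpt range of_real"
    proof (unfold islimpt_approachable, intro allI impI)
      fix e :: real assume "e > 0"
      then show "\<exists>x'\<in>range complex_of_real. x' \<noteq> 0 \<and> dist x' 0 < e"
        by (intro bexI[of _ "of_real (e / 2)"] conjI rangeI) auto
    qed
  qed (use assms in \<open>auto intro!: holomorphic_intros\<close>)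
  then show "f w = g w" by simp
qed

text \<open>For fixed \<open>d\<close>, expand the modulation in the reproducing formula into its power series in \<open>c\<close>.  By the continuity of the
  tempered distribution the series may be paired term by term, which exhibits \<open>u(c)\<close> as a power series whose
  coefficients have the growth of exponential type \<open>2 \<pi> (1 + 2 d)\<close>.  The extensions for different
  \<open>d\<close> agree on the real line, hence everywhere, so the type is at most \<open>2 \<pi>\<close>.\<close>
theorem paley_wiener_tempered:
  assumes cont: "continuous_on UNIV u" and temp: "defines_tempered_distribution u"
    and spec: "\<And>\<phi> R. test_fun R \<phi> \<Longrightarrow> closure {x. \<phi> x \<noteq> 0} \<subseteq> {..< - 1} \<union> {1 <..} \<Longrightarrow> distr_fourier u \<phi> = 0"
  obtains m where "exp_type_at_most (2 * pi) m" "\<And>x. m (of_real x) = of_real (u x)"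
proof -
  have ex: "\<exists>U. exp_type_at_most (2 * pi * (1 + 2 * d)) U \<and> (\<forall>x::real. U (of_real x) = of_real (u x))" if d: "0 < d" for d
  proof -
    obtain \<eta> \<kappa> :: "real \<Rightarrow> real" where
      eta: "test_fun d (\<lambda>t. of_real (\<eta> t))" and eta0: "fourier (\<lambda>t. of_real (\<eta> t)) 0 = 1"
      and kap: "test_fun (1 + 2 * d) (\<lambda>t. of_real (\<kappa> t))"
      and kd: "\<And>t. vderiv (\<lambda>t. of_real (\<kappa> t)) t = of_real (\<eta> (t + (1 + d))) - of_real (\<eta> (t - (1 + d)))"
      using plateau_exists[OF d] by (smt (verit, best))
    define R where "R = 1 + 2 * d"
    have R: "1 \<le> R" "0 \<le> R" using d by (auto simp: R_def)
    have kap': "test_fun R (\<lambda>t. of_real (\<kappa> t))" using kap by (simp add: R_def)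
    have ksm: "smooth (\<lambda>t. of_real (\<kappa> t))" using kap by (simp add: test_fun_def)
    obtain C N where C: "C \<ge> 0" "\<And>f A. test_fun R f \<Longrightarrow> Ck_bound R N f A \<Longrightarrow> A \<ge> 0 \<Longrightarrow> norm (pairing u (fourier f)) \<le> C * A"
      using tempered_fourier_bound[OF temp R(2)] by blast
    obtain B where B: "B \<ge> 0" "Ck_bound R N (\<lambda>t. of_real (\<kappa> t)) B"
      using Ck_bound_exists[OF ksm] by meson
    define w where "w = 2 * pi * \<i>"
    define M where "M = 2 * pi * R"
    have M: "norm w \<le> M" "norm w * R \<le> M" "1 \<le> M" "M > 0"
      using R pi_ge_two mult_mono[of 1 "2 * pi" 1 R] by (auto simp: w_def M_def norm_mult)
    define a where "a n = pairing u (fourier (\<lambda>t. (w * of_real t) ^ n * of_real (\<kappa> t)))" for n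
    have a_bound: "norm (a n) \<le> C * (2 ^ N * ((real (n + 1) * M) ^ N * M ^ n * B))" for n
      unfolding a_def using M B
      by (intro C test_fun_monomial kap' Ck_bound_mult Ck_bound_monomial smooth_monomial ksm mult_nonneg_nonneg) auto
    have a_exp: "\<exists>D. \<forall>n. norm (a n) \<le> D * (M + \<epsilon>) ^ n" if "\<epsilon> > 0" for \<epsilon>
    proof -
      obtain D where D: "D \<ge> 0" "\<And>n. (real (n + 1)) ^ N * M ^ n \<le> D * (M + \<epsilon>) ^ n"
        using polynomial_le_geometric[OF M(4) \<open>\<epsilon> > 0\<close>, of N] by blast
      have "norm (a n) \<le> (C * 2 ^ N * M ^ N * B * D) * (M + \<epsilon>) ^ n" for n
      proof -
        have "norm (a n) \<le> (C * 2 ^ N * M ^ N * B) * (real (n + 1) ^ N * M ^ n)"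
          using a_bound[of n] by (simp add: power_mult_distrib mult_ac)
        also have "\<dots> \<le> (C * 2 ^ N * M ^ N * B) * (D * (M + \<epsilon>) ^ n)"
          using C B M by (intro mult_left_mono D) auto
        finally show ?thesis by (simp add: mult_ac)
      qed
      then show ?thesis by blast
    qed
    have "(\<Sum>n. a n * of_real c ^ n / fact n) = of_real (u c)" for c :: real
    proof (rule sums_unique2)
      show "(\<lambda>n. a n * of_real c ^ n / fact n) sums (\<Sum>n. a n * of_real c ^ n / fact n)"
        using exp_type_power_series(2)[of a M] a_exp M by auto
      define s where "s = 2 * pi * c"
      have part: "of_real (u c) - (\<Sum>n<L. a n * of_real c ^ n / fact n) = pairing u (fourier (\<lambda>t. cis_remainder s L t * of_real (\<kappa> t)))" for L
      proof -
        let ?p = "\<lambda>n t. (of_real c ^ n / fact n) * ((w * of_real t) ^ n * of_real (\<kappa> t))"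
        have tp: "test_fun R (?p n)" for n
          by (intro test_fun_mult[OF test_fun_monomial[OF kap'] smooth_const])
        have "pairing u (fourier (\<lambda>t. \<Sum>n<L. ?p n t)) = (\<Sum>n<L. pairing u (fourier (?p n)))"
          by (intro pairing_fourier_sum[OF temp, where R=R] tp) auto
        also have "\<dots> = (\<Sum>n<L. a n * of_real c ^ n / fact n)"
          unfolding pairing_fourier_cmult a_def by (simp add: mult_ac)
        finally have 1: "pairing u (fourier (\<lambda>t. \<Sum>n<L. ?p n t)) = (\<Sum>n<L. a n * of_real c ^ n / fact n)" .
        have eq: "(\<lambda>t. cis (t * (2 * pi * c)) * of_real (\<kappa> t)) = (\<lambda>t. cis_remainder s L t * of_real (\<kappa> t) + (\<Sum>n<L. ?p n t))"
        proof
          fix t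
          have "?p n t = ((\<i> * of_real s * of_real t) ^ n / fact n) * of_real (\<kappa> t)" for n
            by (simp add: s_def w_def power_mult_distrib mult_ac)
          then have "(\<Sum>n<L. ?p n t) = (\<Sum>n<L. (\<i> * of_real s * of_real t) ^ n / fact n) * of_real (\<kappa> t)"
            by (simp only: sum_distrib_right)
          then show "cis (t * (2 * pi * c)) * of_real (\<kappa> t) = cis_remainder s L t * of_real (\<kappa> t) + (\<Sum>n<L. ?p n t)"
            by (simp add: cis_remainder_def s_def algebra_simps)
        qed
        have tr: "test_fun R (\<lambda>t. cis_remainder s L t * of_real (\<kappa> t))"
          by (rule test_fun_mult[OF kap' smooth_cis_remainder])
        have ts: "test_fun R (\<lambda>t. \<Sum>n<L. ?p n t)"
          using tp unfolding test_fun_def by (intro conjI smooth_sum allI impI sum.neutral ballI) blast+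
        have "of_real (u c) = pairing u (fourier (\<lambda>t. cis (t * (2 * pi * c)) * of_real (\<kappa> t)))"
          by (rule reproducing_formula[OF cont temp spec d eta eta0 kap kd])
        also have "\<dots> = pairing u (fourier (\<lambda>t. cis_remainder s L t * of_real (\<kappa> t))) + (\<Sum>n<L. a n * of_real c ^ n / fact n)"
          unfolding eq pairing_fourier_add[OF temp tr ts] 1 ..
        finally show ?thesis by simp
      qed
      define E where "E L = (\<Sum>j\<le>N. \<bar>s\<bar> ^ j * ((R * \<bar>s\<bar>) ^ (L - j) / fact (L - j)))" for L
      have E: "0 \<le> E L" for L unfolding E_def using R by (auto intro!: sum_nonneg)
      have "norm ((\<Sum>n<L. a n * of_real c ^ n / fact n) - of_real (u c)) \<le> C * (2 ^ N * (E L * B))" if "N \<le> L" for L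
      proof -
        have "norm (pairing u (fourier (\<lambda>t. cis_remainder s L t * of_real (\<kappa> t)))) \<le> C * (2 ^ N * (E L * B))"
          unfolding E_def using R B that E[of L, unfolded E_def]
          by (intro C test_fun_mult kap' Ck_bound_mult Ck_bound_cis_remainder smooth_cis_remainder ksm mult_nonneg_nonneg) auto
        then show ?thesis unfolding part[symmetric] by (subst norm_minus_commute)
      qed
      then have ev: "eventually (\<lambda>L. norm ((\<Sum>n<L. a n * of_real c ^ n / fact n) - of_real (u c)) \<le> C * (2 ^ N * (E L * B))) sequentially"
        unfolding eventually_sequentially by blast
      have E0: "E \<longlonglongrightarrow> 0"
        unfolding E_def by (rule cis_remainder_bound_tendsto)
      have "(\<lambda>L. C * (2 ^ N * (E L * B))) \<longlonglongrightarrow> C * (2 ^ N * (0 * B))"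
        by (rule tendsto_mult[OF tendsto_const tendsto_mult[OF tendsto_const tendsto_mult[OF E0 tendsto_const]]])
      then have "(\<lambda>L. C * (2 ^ N * (E L * B))) \<longlonglongrightarrow> 0" by simp
      from Lim_null_comparison[OF ev this]
      show "(\<lambda>n. a n * of_real c ^ n / fact n) sums of_real (u c)"
        unfolding sums_def by (rule LIM_zero_cancel)
    qed
    moreover have "exp_type_at_most M (\<lambda>z. \<Sum>n. a n * z ^ n / fact n)"
      using exp_type_power_series(1)[of a M] a_exp M by auto
    ultimately show ?thesis unfolding M_def R_def by blast
  qed
  obtain U where U: "exp_type_at_most (2 * pi * (1 + 2 * 1)) U" "\<And>x::real. U (of_real x) = of_real (u x)"
    using ex[of 1] by auto
  show ?thesis
  proof (rule that[of U])
    show "exp_type_at_most (2 * pi) U"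
      unfolding exp_type_at_most_def
    proof (intro conjI allI impI)
      show hol: "U holomorphic_on UNIV" using U by (simp add: exp_type_at_most_def)
      fix \<epsilon> :: real assume e: "\<epsilon> > 0"
      \<comment> \<open>Half of \<open>\<epsilon>\<close> pays for the widening of the spectrum by \<open>2 d\<close>, the other half for the definition of the type.\<close>
      define d where "d = \<epsilon> / (8 * pi)"
      have d: "d > 0" using e by (simp add: d_def)
      obtain V where V: "exp_type_at_most (2 * pi * (1 + 2 * d)) V" "\<And>x::real. V (of_real x) = of_real (u x)"
        using ex[OF d] by auto
      have "V = U" using V U by (intro entire_eq_on_reals) (auto simp: exp_type_at_most_def)
      moreover have "2 * pi * (1 + 2 * d) + \<epsilon> / 2 = 2 * pi + \<epsilon>" by (simp add: d_def field_simps)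
      ultimately show "\<exists>C>0. \<forall>z. norm (U z) \<le> C * exp ((2 * pi + \<epsilon>) * norm z)"
        using V(1) e unfolding exp_type_at_most_def by (metis half_gt_zero)
    qed
  qed (rule U)
qed

section \<open>The Borel transform and integrable functions of exponential type\<close>

text \<open>A form of Stirling's bound, by induction from \<open>(1 + 1/n)\<^sup>n\<^sup>+\<^sup>1 \<ge> e\<close>.\<close>
lemma fact_exp_le:
  assumes "1 \<le> n"
  shows "fact n * exp (real n) \<le> exp 1 * real n * real n ^ n"
  using assms
proof (induction n rule: dec_induct)
  case base then show ?case by simp
next
  case (step n)
  have n: "real n > 0" using step by simp
  have "real n / (real n + 1) \<le> exp (- (1 / (real n + 1)))"
    using exp_ge_add_one_self[of "- (1 / (real n + 1))"] n by (simp add: field_simps)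
  then have "(real n / (real n + 1)) ^ Suc n \<le> exp (- (1 / (real n + 1))) ^ Suc n"
    using n by (intro power_mono) auto
  also have "\<dots> = exp (-1)"
    using n by (simp add: exp_of_nat_mult[symmetric] del: power_Suc)
  finally have "real n ^ Suc n \<le> exp (-1) * (real n + 1) ^ Suc n"
    using n by (simp add: power_divide pos_divide_le_eq del: power_Suc)
  then have key: "exp 1 * real n ^ Suc n \<le> (real n + 1) ^ Suc n"
    by (simp add: exp_minus field_simps del: power_Suc)
  have "fact (Suc n) * exp (real (Suc n)) = (real n + 1) * exp 1 * (fact n * exp (real n))"
    by (simp add: exp_add algebra_simps)
  also have "\<dots> \<le> (real n + 1) * exp 1 * (exp 1 * real n * real n ^ n)"
    using step.IH by (intro mult_left_mono) auto
  also have "\<dots> = (real n + 1) * exp 1 * (exp 1 * real n ^ Suc n)" by simp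
  also have "\<dots> \<le> (real n + 1) * exp 1 * (real n + 1) ^ Suc n"
    using key by (intro mult_left_mono) auto
  finally show ?case by (simp add: algebra_simps)
qed

text \<open>Cauchy's estimate on the circle of radius \<open>n / T\<close>, where \<open>exp (T r) / r\<^sup>n\<close> is smallest.\<close>
lemma exp_type_coefficients:
  assumes F: "exp_type_at_most \<tau> F" and T: "\<tau> < T" "0 < T"
  obtains a C where "0 \<le> C" "\<And>n. norm (a n) \<le> C * (real (n + 1) * T ^ n)"
    "\<And>z. (\<lambda>n. a n * z ^ n / fact n) sums F z"
proof -
  have hol: "F holomorphic_on A" for A
    using F holomorphic_on_subset by (auto simp: exp_type_at_most_def)
  obtain C where C: "C > 0" "\<And>z. norm (F z) \<le> C * exp (T * norm z)"
    using F T unfolding exp_type_at_most_def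
    by (metis add.commute diff_add_cancel diff_gt_0_iff_gt)
  define a where "a n = (deriv ^^ n) F 0" for n
  have bound: "norm (a n) \<le> C * exp 1 * (real (n + 1) * T ^ n)" for n
  proof (cases "n = 0")
    case True
    have "norm (a 0) \<le> C" using C(2)[of 0] by (simp add: a_def)
    also have "\<dots> \<le> C * exp 1" using C(1) by simp
    finally show ?thesis using True by simp
  next
    case False
    define r where "r = real n / T"
    have r: "r > 0" using False T by (simp add: r_def)
    have "norm (a n) \<le> fact n * (C * exp (T * r)) / r ^ n"
      unfolding a_def
    proof (rule Cauchy_inequality)
      show "norm (F x) \<le> C * exp (T * r)" if "norm (0 - x) = r" for x
        using C(2)[of x] that by simp
    qed (intro hol holomorphic_on_imp_continuous_on r)+
    also have "\<dots> = C * (fact n * exp (real n)) / real n ^ n * T ^ n"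
      using T by (simp add: r_def power_divide mult_ac)
    also have "\<dots> \<le> C * (exp 1 * real n * real n ^ n) / real n ^ n * T ^ n"
      using fact_exp_le[of n] False C T
      by (intro mult_right_mono divide_right_mono mult_left_mono) auto
    also have "\<dots> = C * exp 1 * (real n * T ^ n)" using False by simp
    also have "\<dots> \<le> C * exp 1 * (real (n + 1) * T ^ n)"
      using C T by (intro mult_left_mono mult_right_mono) auto
    finally show ?thesis .
  qed
  show ?thesis
  proof (rule that[of "C * exp 1" a])
    fix z
    have "(\<lambda>n. (deriv ^^ n) F 0 / fact n * (z - 0) ^ n) sums F z"
      by (rule holomorphic_power_series[of _ _ "norm z + 1"]) (auto intro: hol)
    then show "(\<lambda>n. a n * z ^ n / fact n) sums F z" by (simp add: a_def)
  qed (use bound C in auto)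
qed

definition laplace :: "(real \<Rightarrow> complex) \<Rightarrow> complex \<Rightarrow> complex" where
  "laplace f s = (LBINT x. indicator {0..} x *\<^sub>R (f x * exp (- (s * of_real x))))"

text \<open>Expanded about a real point \<open>c > 0\<close>, the transform is a power series that converges in the disc of radius \<open>c\<close>; these
  discs exhaust the half-plane.\<close>
lemma laplace_holomorphic:
  assumes f: "integrable lborel (\<lambda>x. indicator {0..} x *\<^sub>R f x)"
  shows "laplace f holomorphic_on {s. 0 < Re s}"
proof -
  define g where "g x = indicator {0..} x *\<^sub>R f x" for x :: real
  have g: "integrable lborel g" using f by (simp add: g_def[abs_def])
  then have [measurable]: "g \<in> borel_measurable borel" by (auto dest: borel_measurable_integrable)
  have lap: "laplace f s = (LBINT x. g x * exp (- (s * of_real x)))" for s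
    by (simp add: laplace_def g_def)
  have hol: "laplace f holomorphic_on ball (of_real c) c" if c: "0 < c" for c
  proof (rule power_series_holomorphic)
    fix s assume "s \<in> ball (complex_of_real c) c"
    then have s: "norm (s - of_real c) < c" by (simp add: dist_norm norm_minus_commute)
    let ?t = "\<lambda>k x. g x * exp (- (of_real c * of_real x)) * ((of_real c - s) * of_real x) ^ k / fact k"
    have ser: "(\<lambda>k. norm (?t k x)) sums (norm (g x) * exp (- c * x) * exp (norm (s - of_real c) * x))" if "0 \<le> x" for x
    proof -
      have "(\<lambda>k. norm (g x) * exp (- c * x) * ((norm (s - of_real c) * x) ^ k /\<^sub>R fact k)) sums (norm (g x) * exp (- c * x) * exp (norm (s - of_real c) * x))"
        by (intro sums_mult exp_converges)
      moreover have "norm (?t k x) = norm (g x) * exp (- c * x) * ((norm (s - of_real c) * x) ^ k /\<^sub>R fact k)" for k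
        using that by (simp add: norm_mult norm_divide norm_power norm_minus_commute[of s] divide_inverse norm_inverse mult_ac)
      ultimately show ?thesis by simp
    qed
    have g0: "g x = 0" if "x < 0" for x using that by (simp add: g_def)
    have sm: "summable (\<lambda>k. norm (?t k x))" for x
      using ser[of x] g0[of x] by (cases "0 \<le> x") (auto intro: sums_summable)
    have le: "(\<Sum>k. norm (?t k x)) \<le> norm (g x)" for x
    proof (cases "0 \<le> x")
      case True
      have "norm (s - of_real c) * x \<le> c * x" using s True by (intro mult_right_mono) auto
      then have "exp (- c * x) * exp (norm (s - of_real c) * x) \<le> 1" by (simp add: exp_add[symmetric])
      then have "norm (g x) * (exp (- c * x) * exp (norm (s - of_real c) * x)) \<le> norm (g x) * 1"
        by (intro mult_left_mono) auto
      then show ?thesis using sums_unique[OF ser[OF True]] by (simp add: mult.assoc)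
    qed (use g0[of x] in auto)
    have le1: "norm (?t k x) \<le> norm (g x)" for k x
      using sum_le_suminf[OF sm, of "{k}" x] le[of x] by simp
    have ti: "integrable lborel (?t k)" for k
      by (rule Bochner_Integration.integrable_bound[OF g]) (use le1 in auto)
    have "(\<lambda>k. \<integral>x. ?t k x \<partial>lborel) sums (LBINT x. (\<Sum>k. ?t k x))"
    proof (rule sums_integral[OF ti])
      show "AE x in lborel. summable (\<lambda>k. norm (?t k x))" using sm by (intro AE_I2)
      show "summable (\<lambda>k. \<integral>x. norm (?t k x) \<partial>lborel)"
      proof (rule summableI_nonneg_bounded)
        fix n
        have "(\<Sum>k<n. \<integral>x. norm (?t k x) \<partial>lborel) = (LBINT x. (\<Sum>k<n. norm (?t k x)))"
          using ti by (intro Bochner_Integration.integral_sum[symmetric]) auto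
        also have "\<dots> \<le> (LBINT x. norm (g x))"
        proof (rule integral_mono)
          fix x show "(\<Sum>k<n. norm (?t k x)) \<le> norm (g x)"
            using sum_le_suminf[OF sm, of "{..<n}" x] le[of x] by simp
        qed (use ti g in auto)
        finally show "(\<Sum>k<n. \<integral>x. norm (?t k x) \<partial>lborel) \<le> (LBINT x. norm (g x))" .
      qed auto
    qed
    also have "(LBINT x. (\<Sum>k. ?t k x)) = laplace f s"
      unfolding lap
    proof (intro Bochner_Integration.integral_cong refl)
      fix x
      have "(\<lambda>k. g x * exp (- (of_real c * of_real x)) * (((of_real c - s) * of_real x) ^ k /\<^sub>R fact k)) sums
         (g x * exp (- (of_real c * of_real x)) * exp ((of_real c - s) * of_real x))"
        by (intro sums_mult exp_converges)
      then have "(\<lambda>k. ?t k x) sums (g x * exp (- (of_real c * of_real x)) * exp ((of_real c - s) * of_real x))"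
        by (simp add: scaleR_conv_of_real divide_inverse mult_ac)
      also have "g x * exp (- (of_real c * of_real x)) * exp ((of_real c - s) * of_real x) = g x * exp (- (s * of_real x))"
        by (simp add: mult.assoc exp_add[symmetric] algebra_simps)
      finally show "(\<Sum>k. ?t k x) = g x * exp (- (s * of_real x))" by (rule sums_unique[symmetric])
    qed
    also have "(\<lambda>k. \<integral>x. ?t k x \<partial>lborel) = (\<lambda>k. (LBINT x. g x * exp (- (of_real c * of_real x)) * (- of_real x) ^ k / fact k) * (s - of_real c) ^ k)"
    proof
      fix k
      have "?t k x = (g x * exp (- (of_real c * of_real x)) * (- of_real x) ^ k / fact k) * (s - of_real c) ^ k" for x
      proof -
        have "(of_real c - s) * of_real x = (- of_real x) * (s - of_real c)" by (simp add: algebra_simps)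
        then have "((of_real c - s) * of_real x) ^ k = (- of_real x) ^ k * (s - of_real c) ^ k"
          by (simp only: power_mult_distrib)
        then show ?thesis by (simp only: mult.assoc times_divide_eq_left)
      qed
      then show "(LBINT x. ?t k x) = (LBINT x. g x * exp (- (of_real c * of_real x)) * (- of_real x) ^ k / fact k) * (s - of_real c) ^ k"
        by (simp only: integral_mult_left_zero)
    qed
    finally show "(\<lambda>k. (LBINT x. g x * exp (- (of_real c * of_real x)) * (- of_real x) ^ k / fact k) * (s - of_real c) ^ k) sums laplace f s" .
  qed
  have "laplace f field_differentiable (at s)" if s: "0 < Re s" for s
  proof -
    \<comment> \<open>Any \<open>c > (norm s)\<^sup>2 / (2 Re s)\<close> puts \<open>s\<close> into the disc of radius \<open>c\<close> about \<open>c\<close>.\<close>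
    define c where "c = ((norm s)\<^sup>2 + 1) / (2 * Re s)"
    have c: "c > 0" using s by (simp add: c_def add_nonneg_pos)
    have c2: "2 * c * Re s = (norm s)\<^sup>2 + 1" using s by (simp add: c_def)
    have "(norm (s - of_real c))\<^sup>2 = (Re s - c)\<^sup>2 + (Im s)\<^sup>2" by (simp add: cmod_power2)
    also have "\<dots> = (norm s)\<^sup>2 - 2 * c * Re s + c\<^sup>2" unfolding cmod_power2[of s] by (simp add: power2_eq_square algebra_simps)
    also have "\<dots> < c\<^sup>2" using c2 by simp
    finally have "norm (s - of_real c) < c" using c by (meson power2_less_imp_less less_imp_le)
    then have "s \<in> ball (of_real c) c" by (simp add: dist_norm norm_minus_commute)
    then show ?thesis using hol[OF c] by (auto intro: holomorphic_on_imp_differentiable_at)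
  qed
  then show ?thesis
    by (auto simp: holomorphic_on_def intro: field_differentiable_at_within)
qed

lemma power_integral_exp:
  fixes r :: real
  assumes r: "0 < r"
  shows "has_bochner_integral lborel (\<lambda>x. indicator {0..} x *\<^sub>R (x ^ n * exp (- (r * x)) / fact n)) (1 / r ^ Suc n)"
proof -
  interpret prob_space "density lborel (erlang_density n r)" by (rule prob_space_erlang_density[OF r])
  have "(\<integral>\<^sup>+x. ennreal (erlang_density n r x) \<partial>lborel) = ennreal 1"
    using emeasure_space_1 r by (simp add: emeasure_density)
  then have "has_bochner_integral lborel (erlang_density n r) 1"
    using r by (intro has_bochner_integral_nn_integral) auto
  then have "has_bochner_integral lborel (\<lambda>x. (1 / r ^ Suc n) * erlang_density n r x) ((1 / r ^ Suc n) * 1)"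
    by (intro has_bochner_integral_mult_right) auto
  moreover have "(1 / r ^ Suc n) * erlang_density n r x = indicator {0..} x *\<^sub>R (x ^ n * exp (- (r * x)) / fact n)" for x
    using r by (simp add: erlang_density_def indicator_def del: power_Suc)
  ultimately show ?thesis by simp
qed

text \<open>The Borel transform of \<open>\<Sum> a n z\<^sup>n / n!\<close>, which continues its Laplace transform to the exterior of a disc.\<close>
definition borel_transform :: "(nat \<Rightarrow> complex) \<Rightarrow> complex \<Rightarrow> complex" where
  "borel_transform a s = (\<Sum>n. a n * (1 / s) ^ n) / s"

lemma borel_transform_summable:
  fixes w :: complex
  assumes a: "\<And>n. norm (a n) \<le> C * (real (n + 1) * T ^ n)" and T: "0 < T" and w: "norm w < 1 / T"
  shows "summable (\<lambda>n. norm (a n * w ^ n))"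
proof (rule summable_comparison_test'[of "\<lambda>n. C * (real (Suc n) * (T * norm w) ^ n)" 0])
  have "norm (T * norm w) < 1" using w T by (simp add: abs_mult field_simps)
  then show "summable (\<lambda>n. C * (real (Suc n) * (T * norm w) ^ n))"
    by (intro summable_mult sums_summable[OF geometric_deriv_sums])
  fix n :: nat
  have "norm (a n) * norm w ^ n \<le> C * (real (n + 1) * T ^ n) * norm w ^ n"
    by (intro mult_right_mono a) auto
  then show "norm (norm (a n * w ^ n)) \<le> C * (real (Suc n) * (T * norm w) ^ n)"
    by (simp add: norm_mult norm_power power_mult_distrib mult.assoc)
qed

lemma borel_transform_holomorphic:
  assumes a: "\<And>n. norm (a n) \<le> C * (real (n + 1) * T ^ n)" and T: "0 < T"
  shows "borel_transform a holomorphic_on {s. T < norm s}"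
proof -
  have G: "(\<lambda>w. \<Sum>n. a n * w ^ n) holomorphic_on ball 0 (1 / T)"
  proof (rule power_series_holomorphic)
    fix w :: complex assume "w \<in> ball 0 (1 / T)"
    then have "summable (\<lambda>n. norm (a n * w ^ n))"
      by (intro borel_transform_summable[OF a T]) auto
    then show "(\<lambda>n. a n * (w - 0) ^ n) sums (\<Sum>n. a n * w ^ n)"
      using summable_norm_cancel summable_sums by fastforce
  qed
  have "(\<lambda>w. \<Sum>n. a n * w ^ n) \<circ> (\<lambda>s. 1 / s) holomorphic_on {s. T < norm s}"
  proof (rule holomorphic_on_compose_gen[OF _ G])
    show "(\<lambda>s. 1 / s) holomorphic_on {s. T < norm s}"
      using T by (intro holomorphic_intros) auto
    show "(\<lambda>s. 1 / s) ` {s. T < norm s} \<subseteq> ball (0::complex) (1 / T)"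
    proof safe
      fix s :: complex assume "T < norm s"
      then show "1 / s \<in> ball 0 (1 / T)" using T by (auto simp: norm_divide intro!: divide_strict_left_mono mult_pos_pos)
    qed
  qed
  then show ?thesis
    unfolding borel_transform_def[abs_def] using T
    by (intro holomorphic_intros) (auto simp: o_def)
qed

lemma laplace_eq_borel_transform_real:
  assumes a: "\<And>n. norm (a n) \<le> C * (real (n + 1) * T ^ n)" and T: "0 < T" "T < r"
    and f: "\<And>x. (\<lambda>n. a n * of_real x ^ n / fact n) sums f x"
  shows "laplace f (of_real r) = borel_transform a (of_real r)"
proof -
  let ?e = "\<lambda>n x. indicator {0..} x *\<^sub>R (x ^ n * exp (- (r * x)) / fact n)"
  let ?t = "\<lambda>n x. a n * complex_of_real (?e n x)"
  have e: "has_bochner_integral lborel (?e n) (1 / r ^ Suc n)" for n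
    using T by (intro power_integral_exp) auto
  have ei: "integrable lborel (?e n)" "(LBINT x. ?e n x) = 1 / r ^ Suc n" for n
    using e[of n] by (auto simp: has_bochner_integral_iff)
  have e0: "0 \<le> ?e n x" for n x by (simp add: indicator_def)
  have ti: "integrable lborel (?t n)" for n
    by (intro integrable_mult_right integrable_of_real ei)
  have fs: "(\<lambda>n. ?t n x) sums (indicator {0..} x *\<^sub>R (f x * exp (- (of_real r * of_real x))))" for x
  proof (cases "0 \<le> x")
    case True
    have "(\<lambda>n. a n * of_real x ^ n / fact n * exp (- (of_real r * of_real x))) sums (f x * exp (- (of_real r * of_real x)))"
      by (intro sums_mult2 f)
    moreover have "?t n x = a n * of_real x ^ n / fact n * exp (- (of_real r * of_real x))" for n
    proof -
      have "complex_of_real (exp (- (r * x))) = exp (- (of_real r * of_real x))"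
        by (metis exp_of_real of_real_minus of_real_mult)
      then show ?thesis using True by simp
    qed
    ultimately show ?thesis using True by (simp only: indicator_simps atLeast_iff scaleR_one)
  qed simp
  have sint: "(\<lambda>n. \<integral>x. ?t n x \<partial>lborel) sums (LBINT x. (\<Sum>n. ?t n x))"
  proof (rule sums_integral[OF ti])
    show "AE x in lborel. summable (\<lambda>n. norm (?t n x))"
    proof (intro AE_I2)
      fix x
      have s: "summable (\<lambda>n. norm (a n * of_real x ^ n / fact n))" 
      proof -
        have "summable (\<lambda>n. (a n / fact n) * of_real (\<bar>x\<bar> + 1) ^ n)"
          using sums_summable[OF f[of "\<bar>x\<bar> + 1"]] by (simp add: field_simps)
        then have "summable (\<lambda>n. norm ((a n / fact n) * of_real x ^ n))"
          by (rule powser_insidea) (simp add: norm_of_real del: of_real_add)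
        then show ?thesis by (simp add: field_simps)
      qed
      have "norm (?t n x) = indicator {0..} x * exp (- (r * x)) * norm (a n * of_real x ^ n / fact n)" for n
        by (simp add: norm_mult norm_divide norm_power indicator_def abs_mult)
      then show "summable (\<lambda>n. norm (?t n x))" using summable_mult[OF s] by simp
    qed
    have "norm (?t n x) = norm (a n) * ?e n x" for n x
      using e0[of x n] by (simp only: norm_mult norm_of_real abs_of_nonneg)
    then have "(LBINT x. norm (?t n x)) = norm (a n) * (1 / r ^ Suc n)" for n
      by (simp only: integral_mult_right_zero ei(2))
    moreover have "summable (\<lambda>n. norm (a n) * (1 / r ^ Suc n))"
    proof -
      have "summable (\<lambda>n. norm (a n * complex_of_real (1 / r) ^ n))"
        using T by (intro borel_transform_summable[OF a T(1)]) (auto simp: norm_divide intro!: divide_strict_left_mono)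
      from summable_mult[OF this, of "1 / r"] show ?thesis
        using T by (simp add: norm_mult norm_power norm_divide power_divide field_simps)
    qed
    ultimately show "summable (\<lambda>n. \<integral>x. norm (?t n x) \<partial>lborel)" by simp
  qed
  have lap: "(LBINT x. (\<Sum>n. ?t n x)) = laplace f (of_real r)"
    unfolding laplace_def by (intro Bochner_Integration.integral_cong refl sums_unique[symmetric] fs)
  have tn: "(LBINT x. ?t n x) = a n * (1 / of_real r) ^ n / of_real r" for n
  proof -
    have "(LBINT x. ?t n x) = a n * of_real (LBINT x. ?e n x)"
      by (subst integral_mult_right_zero) (simp only: integral_complex_of_real)
    then show ?thesis unfolding ei(2) by (simp add: power_divide)
  qed
  have "(\<lambda>n. a n * (1 / of_real r) ^ n / of_real r) sums laplace f (of_real r)"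
    using sint unfolding lap tn .
  moreover have "(\<lambda>n. a n * (1 / of_real r) ^ n / of_real r) sums borel_transform a (of_real r)"
    unfolding borel_transform_def
  proof (rule sums_divide[OF summable_sums[OF summable_norm_cancel[OF borel_transform_summable[OF a T(1)]]]])
    show "norm (1 / complex_of_real r) < 1 / T" using T by (auto simp: norm_divide intro!: divide_strict_left_mono)
  qed
  ultimately show ?thesis by (rule sums_unique2)
qed

text \<open>Continue from the real axis to the boundary point \<open>\<i> y\<close> through a convex region
  that avoids the disc of radius \<open>T\<close>.\<close>
lemma laplace_boundary:
  assumes a: "\<And>n. norm (a n) \<le> C * (real (n + 1) * T ^ n)" and T: "0 < T" "T < \<bar>y\<bar>"
    and f: "\<And>x. (\<lambda>n. a n * of_real x ^ n / fact n) sums f x"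
    and fi: "integrable lborel (\<lambda>x. indicator {0..} x *\<^sub>R f x)"
  shows "laplace f (\<i> * of_real y) = borel_transform a (\<i> * of_real y)"
proof -
  \<comment> \<open>The unit vector \<open>(p, q)\<close> is normal to a line that separates the disc of radius \<open>T\<close> from both
    \<open>\<i> y\<close> and all large positive reals.\<close>
  define q where "q = (T + \<bar>y\<bar>) / 2 / y"
  have y: "y \<noteq> 0" using T by auto
  have qy: "T < q * y" using T y by (simp add: q_def)
  have q1: "\<bar>q\<bar> < 1" using T y by (simp add: q_def abs_mult)
  define p where "p = sqrt (1 - q\<^sup>2)"
  have q2: "q\<^sup>2 < 1" using q1 by (simp add: abs_square_less_1)
  have p: "p > 0" "p\<^sup>2 + q\<^sup>2 = 1" using q2 by (auto simp: p_def)
  define S where "S = {s. 0 < Re s} \<inter> {s. T < p * Re s + q * Im s}"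
  have lin: "p * Re s + q * Im s = inner (Complex p q) s" for s by (simp add: inner_complex_def)
  have norm_S: "T < norm s" if "s \<in> S" for s
  proof -
    have "p * Re s + q * Im s \<le> norm (Complex p q) * norm s"
      unfolding lin by (rule norm_cauchy_schwarz)
    also have "norm (Complex p q) = 1" using p by (simp add: complex_norm)
    finally show ?thesis using that by (simp add: S_def)
  qed
  have eq: "laplace f s = borel_transform a s" if s: "s \<in> S" for s
  proof -
    define r0 where "r0 = T / p"
    have r0: "r0 > 0" using T p by (simp add: r0_def)
    have "(\<lambda>s. laplace f s - borel_transform a s) s = 0"
    proof (rule analytic_continuation[of "\<lambda>s. laplace f s - borel_transform a s" S "of_real ` {r0<..}" "of_real (r0 + 1)" s])
      show "(\<lambda>s. laplace f s - borel_transform a s) holomorphic_on S"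
        by (intro holomorphic_on_diff holomorphic_on_subset[OF laplace_holomorphic[OF fi]]
              holomorphic_on_subset[OF borel_transform_holomorphic[OF a T(1)]])
           (use norm_S in \<open>auto simp: S_def\<close>)
      show "open S"
        unfolding S_def by (intro open_Int open_Collect_less continuous_intros)
      have "S = {s. inner (Complex 1 0) s > 0} \<inter> {s. inner (Complex p q) s > T}"
        unfolding S_def lin[symmetric] by (simp add: inner_complex_def)
      then have "convex S" by (simp add: convex_Int convex_halfspace_gt)
      then show "connected S" by (rule convex_connected)
      have in_S: "of_real r \<in> S" if "r > r0" for r
        using that r0 p less_trans[OF r0 that] by (simp add: S_def r0_def pos_divide_less_eq mult.commute)
      then show "of_real ` {r0<..} \<subseteq> S" "of_real (r0 + 1) \<in> S" using in_S[of "r0 + 1"] by auto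
      show "complex_of_real (r0 + 1) islimpt of_real ` {r0<..}"
      proof (unfold islimpt_approachable, intro allI impI)
        fix e :: real assume "e > 0"
        then show "\<exists>x'\<in>of_real ` {r0<..}. x' \<noteq> complex_of_real (r0 + 1) \<and> dist x' (of_real (r0 + 1)) < e"
          by (intro bexI[of _ "of_real (r0 + 1 + e / 2)"]) (auto simp: dist_norm simp flip: of_real_add of_real_diff)
      qed
      fix z assume "z \<in> complex_of_real ` {r0<..}"
      then obtain r where r: "z = of_real r" "r > r0" by auto
      have "T < r" using norm_S[OF in_S[OF r(2)]] r r0 by simp
      then show "laplace f z - borel_transform a z = 0"
        using laplace_eq_borel_transform_real[OF a T(1) _ f] r by simp
    qed (rule s)
    then show ?thesis by simp
  qed
  define X where "X n = of_real (1 / real (Suc n)) + \<i> * of_real y" for n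
  have "(\<lambda>n. complex_of_real (1 / real (Suc n))) \<longlonglongrightarrow> of_real 0"
    by (rule tendsto_of_real) (use LIMSEQ_inverse_real_of_nat in \<open>simp add: inverse_eq_divide\<close>)
  then have X: "X \<longlonglongrightarrow> of_real 0 + \<i> * of_real y"
    unfolding X_def by (rule tendsto_add[OF _ tendsto_const])
  have XS: "X n \<in> S" for n
  proof -
    have "0 < p * (1 / real (Suc n))" using p by simp
    then have "T < p * (1 / real (Suc n)) + q * y" using qy by linarith
    then show ?thesis by (simp add: X_def S_def)
  qed
  have "(\<lambda>n. laplace f (X n)) \<longlonglongrightarrow> laplace f (\<i> * of_real y)"
    unfolding laplace_def
  proof (rule integral_dominated_convergence[where w="\<lambda>x. norm (indicator {0..} x *\<^sub>R f x)"])
    have meas: "(\<lambda>x. (indicator {0..} x *\<^sub>R f x) * exp (- (s * complex_of_real x))) \<in> borel_measurable lborel" for s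
      using borel_measurable_integrable[OF fi] by measurable
    then show "(\<lambda>x. indicator {0..} x *\<^sub>R (f x * exp (- (s * complex_of_real x)))) \<in> borel_measurable lborel"
      "(\<lambda>x. indicator {0..} x *\<^sub>R (f x * exp (- (X n * complex_of_real x)))) \<in> borel_measurable lborel" for s n
      by simp_all
    show "integrable lborel (\<lambda>x. norm (indicator {0..} x *\<^sub>R f x))" using fi by (rule integrable_norm)
    show "AE x in lborel. (\<lambda>n. indicator {0..} x *\<^sub>R (f x * exp (- (X n * complex_of_real x)))) \<longlonglongrightarrow>
        indicator {0..} x *\<^sub>R (f x * exp (- (\<i> * of_real y * complex_of_real x)))"
      using X by (intro AE_I2 tendsto_intros) auto
    show "AE x in lborel. norm (indicator {0..} x *\<^sub>R (f x * exp (- (X n * complex_of_real x)))) \<le> norm (indicator {0..} x *\<^sub>R f x)" for n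
    proof (intro AE_I2)
      fix x :: real
      have "norm (exp (- (X n * complex_of_real x))) \<le> 1" if "0 \<le> x"
        using that by (simp add: X_def)
      then show "norm (indicator {0..} x *\<^sub>R (f x * exp (- (X n * complex_of_real x)))) \<le> norm (indicator {0..} x *\<^sub>R f x)"
        by (auto simp: indicator_def norm_mult mult_left_le)
    qed
  qed
  moreover have "isCont (borel_transform a) (\<i> * of_real y)"
  proof -
    have "open {s::complex. T < norm s}" by (intro open_Collect_less continuous_intros)
    moreover have "\<i> * of_real y \<in> {s. T < norm s}" using T by (simp add: norm_mult)
    ultimately show ?thesis
      using holomorphic_on_imp_continuous_on[OF borel_transform_holomorphic[OF a T(1)]]
      by (simp add: continuous_on_eq_continuous_at)
  qed
  then have "(\<lambda>n. borel_transform a (X n)) \<longlonglongrightarrow> borel_transform a (\<i> * of_real y)"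
    by (rule isCont_tendsto_compose) (use X in simp)
  then have "(\<lambda>n. laplace f (X n)) \<longlonglongrightarrow> borel_transform a (\<i> * of_real y)"
    by (simp only: eq[OF XS])
  ultimately show ?thesis by (rule LIMSEQ_unique)
qed

text \<open>Split the integral at the origin.  The two halves are Laplace transforms of \<open>F(x)\<close> at \<open>2 \<pi> \<i> t\<close> and of \<open>F(-x)\<close> at
  \<open>-2 \<pi> \<i> t\<close>.  Beyond the type both are given by the Borel transform of \<open>F\<close>, with opposite signs.\<close>
theorem fourier_exp_type_zero:
  assumes F: "exp_type_at_most (2 * pi) F" and int: "integrable lborel (\<lambda>x. F (of_real x))" and t: "1 < \<bar>t\<bar>"
  shows "fourier (\<lambda>x. F (of_real x)) t = 0"
proof -
  define y where "y = 2 * pi * t"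
  define T where "T = pi * (1 + \<bar>t\<bar>)"
  have T: "2 * pi < T" "0 < T" "T < \<bar>y\<bar>" using t by (auto simp: T_def y_def abs_mult)
  obtain a C where a: "\<And>n. norm (a n) \<le> C * (real (n + 1) * T ^ n)" and s: "\<And>z. (\<lambda>n. a n * z ^ n / fact n) sums F z"
    using exp_type_coefficients[OF F T(1,2)] by metis
  define f where "f x = F (of_real x)" for x :: real
  have fi: "integrable lborel f" using int by (simp add: f_def[abs_def])
  have [measurable]: "f \<in> borel_measurable borel" using fi by (auto dest: borel_measurable_integrable)
  have fi': "integrable lborel (\<lambda>x. f (- x))"
    using lborel_integrable_real_affine[OF fi, of "-1" 0] by simp
  define b where "b n = (-1) ^ n * a n" for n
  have b: "norm (b n) \<le> C * (real (n + 1) * T ^ n)" for n using a[of n] by (simp add: b_def norm_mult norm_power)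
  have 1: "laplace f (\<i> * of_real y) = borel_transform a (\<i> * of_real y)"
    by (rule laplace_boundary[OF a T(2,3)]) (use s in \<open>auto simp: f_def intro!: integrable_mult_indicator fi[unfolded f_def]\<close>)
  have 2: "laplace (\<lambda>x. f (- x)) (\<i> * of_real (- y)) = borel_transform b (\<i> * of_real (- y))"
  proof (rule laplace_boundary[OF b T(2)])
    fix x
    have "b n * of_real x ^ n / fact n = a n * of_real (- x) ^ n / fact n" for n
      by (simp add: b_def power_minus[of "of_real x"] mult_ac)
    then show "(\<lambda>n. b n * of_real x ^ n / fact n) sums f (- x)" using s[of "of_real (- x)"] by (simp add: f_def)
  qed (use T in \<open>auto intro!: integrable_mult_indicator fi'\<close>)
  have 3: "borel_transform b (\<i> * of_real (- y)) = - borel_transform a (\<i> * of_real y)"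
  proof -
    have "b n * (1 / (\<i> * of_real (- y))) ^ n = a n * (1 / (\<i> * of_real y)) ^ n" for n
    proof -
      have "(-1) * (1 / (\<i> * of_real (- y))) = 1 / (\<i> * of_real y)" by simp
      then have "(-1) ^ n * (1 / (\<i> * of_real (- y))) ^ n = (1 / (\<i> * of_real y)) ^ n"
        by (simp only: power_mult_distrib[symmetric])
      then show ?thesis unfolding b_def by (metis mult.assoc mult.commute)
    qed
    then show ?thesis unfolding borel_transform_def by simp
  qed
  have 4: "laplace (\<lambda>x. f (- x)) (\<i> * of_real (- y)) = (LBINT x. indicator {..0} x *\<^sub>R (f x * exp (- (\<i> * of_real y * of_real x))))"
  proof -
    have "(LBINT x. indicator {..0} x *\<^sub>R (f x * exp (- (\<i> * of_real y * of_real x)))) =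
      \<bar>-1\<bar> *\<^sub>R (LBINT x. indicator {..0} (0 + (-1) * x) *\<^sub>R (f (0 + (-1) * x) * exp (- (\<i> * of_real y * of_real (0 + (-1) * x)))))"
      by (rule lborel_integral_real_affine) simp
    also have "\<dots> = laplace (\<lambda>x. f (- x)) (\<i> * of_real (- y))"
      unfolding laplace_def abs_minus_cancel abs_one scaleR_one
      by (intro Bochner_Integration.integral_cong refl) (auto simp: indicator_def)
    finally show ?thesis ..
  qed
  have i: "integrable lborel (\<lambda>x. indicator A x *\<^sub>R (f x * exp (- (\<i> * of_real y * of_real x))))" if "A \<in> sets borel" for A
    using integrable_mult_cis[OF fi, of "\<lambda>x. - (y * x)"] that
    by (intro integrable_mult_indicator) (auto simp: cis_conv_exp mult_ac)
  have "fourier f t = (LBINT x. indicator {0..} x *\<^sub>R (f x * exp (- (\<i> * of_real y * of_real x))) + indicator {..0} x *\<^sub>R (f x * exp (- (\<i> * of_real y * of_real x))))"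
    unfolding fourier_cis
  proof (rule integral_cong_AE)
    show "AE x in lborel. f x * cis (- (2 * pi * x * t)) = indicator {0..} x *\<^sub>R (f x * exp (- (\<i> * of_real y * of_real x))) + indicator {..0} x *\<^sub>R (f x * exp (- (\<i> * of_real y * of_real x)))"
      using AE_lborel_singleton[of 0]
      by eventually_elim (auto simp: indicator_def cis_conv_exp y_def mult_ac)
  qed auto
  also have "\<dots> = laplace f (\<i> * of_real y) + laplace (\<lambda>x. f (- x)) (\<i> * of_real (- y))"
    unfolding 4 unfolding laplace_def by (intro Bochner_Integration.integral_add i) auto
  also have "\<dots> = 0" unfolding 1 2 3 by simp
  finally show ?thesis by (simp add: f_def[abs_def])
qed

section \<open>Fourier series on the unit interval\<close>

lemma integrable_indicator_Icc:
  fixes h :: "real \<Rightarrow> complex"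
  assumes "continuous_on {a..b} h"
  shows "integrable lborel (\<lambda>t. indicator {a..b} t *\<^sub>R h t)"
  using assms by (intro borel_integrable_compact) auto

text \<open>The sign convention fits the samples of a function with spectrum \<open>h\<close>: the coefficient pairs with \<open>cis (2 \<pi> n t)\<close>,
  so the Fourier series of \<open>h\<close> runs over \<open>cis (- 2 \<pi> n t)\<close>.\<close>
definition circle_coeff :: "(real \<Rightarrow> complex) \<Rightarrow> int \<Rightarrow> complex" where
  "circle_coeff h n = (LBINT t. indicator {0..1} t *\<^sub>R (h t * cis (2 * pi * of_int n * t)))"

lemma circle_coeff_cis: "circle_coeff (\<lambda>t. cis (2 * pi * of_int m * t)) n = (if m + n = 0 then 1 else 0)"
proof -
  define c where "c = 2 * pi * real_of_int (m + n)"
  have "circle_coeff (\<lambda>t. cis (2 * pi * of_int m * t)) n = (LBINT t. indicator {0..1} t *\<^sub>R cis (t * c))"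
    unfolding circle_coeff_def cis_mult by (simp add: c_def algebra_simps)
  also have "\<dots> = (if m + n = 0 then 1 else 0)"
  proof (cases "m + n = 0")
    case True
    then show ?thesis by (simp add: c_def)
  next
    case False
    then have c: "c \<noteq> 0" by (simp add: c_def)
    have d: "((\<lambda>t. cis (t * c) / (\<i> * of_real c)) has_vector_derivative cis (t * c)) (at t within A)" for t A
    proof -
      have "((\<lambda>t. cis (t * c) / (\<i> * of_real c)) has_vector_derivative \<i> * of_real c * cis (t * c) / (\<i> * of_real c)) (at t)"
        by (intro has_vector_derivative_divide cis_has_vector_derivative)
      from has_vector_derivative_at_within[OF this] show ?thesis using c by simp
    qed
    have "(LBINT t. indicator {0..1} t *\<^sub>R cis (t * c)) = cis (1 * c) / (\<i> * of_real c) - cis (0 * c) / (\<i> * of_real c)"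
      by (intro integral_FTC_Icc d continuous_intros) auto
    also have "cis (1 * c) = 1" unfolding c_def by (simp only: mult_1 cis_multiple_2pi Ints_of_int)
    finally show ?thesis using False by simp
  qed
  finally show ?thesis .
qed

lemma circle_coeff_integrable:
  "continuous_on {0..1} h \<Longrightarrow> integrable lborel (\<lambda>t. indicator {0..1} t *\<^sub>R (h t * cis (2 * pi * of_int n * t)))"
  by (intro integrable_indicator_Icc continuous_intros)

text \<open>If \<open>h x0 \<noteq> 0\<close>, test \<open>h\<close> against high powers of the trigonometric polynomial
  \<open>(1 + cos (2 \<pi> (t - x0))) / 2\<close>, which concentrate at \<open>x0\<close>.\<close>
lemma circle_coeff_unique:
  assumes h: "continuous_on {0..1} h" and 0: "\<And>n. circle_coeff h n = 0" and t: "t \<in> {0..1}"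
  shows "h t = 0"
proof -
  have inner: "h x0 = 0" if x0: "0 < x0" "x0 < 1" for x0
  proof (rule ccontr)
    assume nz: "h x0 \<noteq> 0"
    define P where "P t = (1 + cos (2 * pi * (t - x0))) / 2" for t
    have Pc: "continuous_on A P" for A unfolding P_def by (intro continuous_intros) auto
    have hP: "continuous_on {0..1} (\<lambda>t. h t * of_real (P t) ^ N)" for N
      by (intro continuous_intros h Pc)
    have Pcis: "of_real (P t) = 1 / 2 + cis (- (2 * pi * x0)) / 4 * cis (2 * pi * of_int 1 * t) + cis (2 * pi * x0) / 4 * cis (2 * pi * of_int (-1) * t)" for t
    proof -
      have a: "cis (- (2 * pi * x0)) * cis (2 * pi * of_int 1 * t) = cis (2 * pi * (t - x0))"
        "cis (2 * pi * x0) * cis (2 * pi * of_int (-1) * t) = cis (- (2 * pi * (t - x0)))"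
        unfolding cis_mult by (simp_all add: algebra_simps)
      have "of_real (P t) = 1 / 2 + cis (2 * pi * (t - x0)) / 4 + cis (- (2 * pi * (t - x0))) / 4"
        by (simp add: P_def complex_eq_iff)
      then show ?thesis unfolding a[symmetric] by simp
    qed
    have zero: "circle_coeff (\<lambda>t. h t * of_real (P t) ^ N) n = 0" for N n
    proof (induction N arbitrary: n)
      case 0
      then show ?case using assms(2) by simp
    next
      case (Suc N)
      let ?g = "\<lambda>t. h t * of_real (P t) ^ N"
      let ?I = "\<lambda>n t. indicator {0..1} t *\<^sub>R (?g t * cis (2 * pi * of_int n * t))"
      have "indicator {0..1} t *\<^sub>R (h t * of_real (P t) ^ Suc N * cis (2 * pi * of_int n * t)) =
        (1 / 2) * ?I n t + (cis (- (2 * pi * x0)) / 4) * ?I (n + 1) t + (cis (2 * pi * x0) / 4) * ?I (n - 1) t" for t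
      proof -
        have "cis (2 * pi * of_int (n + 1) * t) = cis (2 * pi * of_int 1 * t) * cis (2 * pi * of_int n * t)"
          "cis (2 * pi * of_int (n - 1) * t) = cis (2 * pi * of_int (-1) * t) * cis (2 * pi * of_int n * t)"
          unfolding cis_mult by (simp_all add: algebra_simps)
        then have "?g t * of_real (P t) * cis (2 * pi * of_int n * t) =
           (1 / 2) * (?g t * cis (2 * pi * of_int n * t)) + (cis (- (2 * pi * x0)) / 4) * (?g t * cis (2 * pi * of_int (n + 1) * t)) + (cis (2 * pi * x0) / 4) * (?g t * cis (2 * pi * of_int (n - 1) * t))"
          unfolding Pcis[of t] by (simp only: distrib_left distrib_right mult_ac)
        then show ?thesis by (cases "t \<in> {0..1}") (simp_all add: mult_ac)
      qed
      then have "circle_coeff (\<lambda>t. h t * of_real (P t) ^ Suc N) n =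
        (LBINT t. (1 / 2) * ?I n t + (cis (- (2 * pi * x0)) / 4) * ?I (n + 1) t + (cis (2 * pi * x0) / 4) * ?I (n - 1) t)"
        unfolding circle_coeff_def by (simp only:)
      also have "\<dots> = (1 / 2) * circle_coeff ?g n + (cis (- (2 * pi * x0)) / 4) * circle_coeff ?g (n + 1) + (cis (2 * pi * x0) / 4) * circle_coeff ?g (n - 1)"
      proof -
        have i: "integrable lborel (\<lambda>t. c * ?I n t)" for c n
          by (intro integrable_mult_right circle_coeff_integrable hP)
        show ?thesis
          unfolding circle_coeff_def
          by (simp only: Bochner_Integration.integral_add[OF Bochner_Integration.integrable_add[OF i i] i] Bochner_Integration.integral_add[OF i i] integral_mult_right_zero)
      qed
      also have "\<dots> = 0" by (simp only: Suc.IH mult_zero_right add_0)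
      finally show ?case .
    qed
    \<comment> \<open>Normalize so that the real part is \<open>1\<close> at \<open>x0\<close>.\<close>
    define c where "c = cnj (h x0) / of_real ((norm (h x0))\<^sup>2)"
    define g where "g t = Re (c * h t)" for t
    have gc: "continuous_on {0..1} g" unfolding g_def by (intro continuous_intros h)
    have gx: "g x0 = 1"
    proof -
      have "c * h x0 = 1" using nz by (simp only: c_def complex_norm_square) simp
      then show ?thesis by (simp add: g_def)
    qed
    have gP: "(LBINT t. indicator {0..1} t *\<^sub>R (g t * P t ^ N)) = 0" for N
    proof -
      have i: "integrable lborel (\<lambda>t. c * (indicator {0..1} t *\<^sub>R (h t * of_real (P t) ^ N)))"
        by (intro integrable_mult_right integrable_indicator_Icc hP)
      have "(LBINT t. indicator {0..1} t *\<^sub>R (h t * of_real (P t) ^ N)) = 0"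
        using zero[of N 0] by (simp add: circle_coeff_def)
      then have "Re (LBINT t. c * (indicator {0..1} t *\<^sub>R (h t * of_real (P t) ^ N))) = 0"
        by (simp only: integral_mult_right_zero mult_zero_right zero_complex.simps)
      then have "(LBINT t. Re (c * (indicator {0..1} t *\<^sub>R (h t * of_real (P t) ^ N)))) = 0"
        unfolding integral_Re[OF i] .
      moreover have "Re (c * (indicator {0..1} t *\<^sub>R (h t * of_real (P t) ^ N))) = indicator {0..1} t *\<^sub>R (g t * P t ^ N)" for t
      proof -
        have "c * (indicator {0..1} t *\<^sub>R (h t * of_real (P t) ^ N)) = of_real (indicator {0..1} t * P t ^ N) * (c * h t)"
          by (simp add: scaleR_conv_of_real mult_ac)
        then show ?thesis by (simp only: g_def) simp
      qed
      ultimately show ?thesis by (simp only:)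
    qed
    have "isCont g x0"
      using gc x0 by (simp add: continuous_on_interior interior_atLeastAtMost_real)
    then obtain d0 where d0: "d0 > 0" "\<And>t. \<bar>t - x0\<bar> < d0 \<Longrightarrow> \<bar>g t - g x0\<bar> < 1 / 2"
      unfolding continuous_at_eps_delta by (metis dist_real_def half_gt_zero zero_less_one)
    \<comment> \<open>With \<open>d \<le> x0\<close> and \<open>d \<le> 1 - x0\<close> no point of \<open>[0, 1]\<close> is closer than \<open>d\<close> to \<open>x0 - 1\<close> or \<open>x0 + 1\<close>, where
      the kernel peaks as well.\<close>
    define d where "d = min (min (d0 / 2) x0) (min (1 - x0) (1 / 4))"
    have d: "0 < d" "d < d0" "d \<le> x0" "d \<le> 1 - x0" "d \<le> 1 / 4"
      using d0 x0 by (auto simp: d_def min_def)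
    have g_near: "1 / 2 \<le> g t" if "\<bar>t - x0\<bar> \<le> d" for t
    proof -
      have "\<bar>g t - 1\<bar> < 1 / 2" using d0(2)[of t] that d gx by simp
      then show ?thesis by linarith
    qed
    obtain B where B: "B > 0" "\<And>t. t \<in> {0..1} \<Longrightarrow> \<bar>g t\<bar> \<le> B"
    proof -
      have "bounded (g ` {0..1})" by (intro compact_imp_bounded compact_continuous_image gc) auto
      then show ?thesis using that by (auto simp: bounded_pos)
    qed
    define q1 where "q1 = (1 + cos (pi * d)) / 2"
    define q2 where "q2 = (1 + cos (2 * pi * d)) / 2"
    have q12: "q2 < q1"
    proof -
      have "cos (2 * pi * d) < cos (pi * d)"
        using d by (intro cos_monotone_0_pi) (auto simp: field_simps)
      then show ?thesis by (simp add: q1_def q2_def)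
    qed
    have cos1: "0 \<le> 1 + cos x" for x :: real using cos_ge_minus_one[of x] by linarith
    have q2: "0 \<le> q2" unfolding q2_def using cos1 by simp
    have q1: "0 < q1" using q12 q2 by simp
    have P0: "0 \<le> P t" for t unfolding P_def using cos1 by simp
    have cosabs: "cos (2 * pi * (t - x0)) = cos (2 * pi * \<bar>t - x0\<bar>)" for t
    proof -
      have "2 * pi * \<bar>t - x0\<bar> = \<bar>2 * pi * (t - x0)\<bar>" by (simp add: abs_mult)
      then show ?thesis by (simp only: cos_abs_real)
    qed
    have P_near: "q1 \<le> P t" if "\<bar>t - x0\<bar> \<le> d / 2" for t
    proof -
      have "2 * \<bar>t - x0\<bar> \<le> d" using that by simp
      then have "pi * (2 * \<bar>t - x0\<bar>) \<le> pi * d" by (intro mult_left_mono) auto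
      moreover have "pi * d \<le> pi" using d by simp
      ultimately have "cos (pi * d) \<le> cos (2 * pi * \<bar>t - x0\<bar>)"
        by (intro cos_monotone_0_pi_le) (auto simp: mult_ac)
      then show ?thesis by (simp add: q1_def P_def cosabs)
    qed
    have P_far: "P t \<le> q2" if "d \<le> \<bar>t - x0\<bar>" "t \<in> {0..1}" for t
    proof -
      define v where "v = \<bar>t - x0\<bar>"
      have v: "d \<le> v" "v \<le> 1 - d" using that d x0 by (auto simp: v_def abs_if)
      have le: "cos (2 * pi * w) \<le> cos (2 * pi * d)" if "d \<le> w" "w \<le> 1 / 2" for w
        using that d mult_left_mono[of w "1/2" "2 * pi"] by (intro cos_monotone_0_pi_le) auto
      have "cos (2 * pi * v) \<le> cos (2 * pi * d)"
      proof (cases "v \<le> 1 / 2")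
        case True then show ?thesis using le v by simp
      next
        case False
        have "cos (2 * pi * v) = cos (2 * pi - 2 * pi * v)" by (simp add: cos_diff)
        also have "\<dots> = cos (2 * pi * (1 - v))" by (simp add: algebra_simps)
        also have "\<dots> \<le> cos (2 * pi * d)" using False v by (intro le) auto
        finally show ?thesis .
      qed
      then show ?thesis by (simp add: q2_def P_def cosabs v_def)
    qed
    have ineq: "q1 ^ N * d / 2 \<le> B * q2 ^ N" for N
    proof -
      let ?L = "\<lambda>t. (q1 ^ N / 2) * indicator {x0 - d / 2..x0 + d / 2} t - (B * q2 ^ N) * indicator {0..1} t"
      have "(LBINT t. ?L t) \<le> (LBINT t. indicator {0..1} t *\<^sub>R (g t * P t ^ N))"
      proof (rule integral_mono)
        show "integrable lborel ?L"
          using d by (intro Bochner_Integration.integrable_diff integrable_mult_right integrable_real_indicator) auto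
        show "integrable lborel (\<lambda>t. indicator {0..1} t *\<^sub>R (g t * P t ^ N))"
          by (intro borel_integrable_compact continuous_intros gc Pc) auto
        fix t
        have Bq: "0 \<le> B * q2 ^ N" using B q2 by simp
        consider "t \<notin> {0..1}" | "t \<in> {0..1}" "\<bar>t - x0\<bar> \<le> d / 2" | "t \<in> {0..1}" "d / 2 < \<bar>t - x0\<bar>" "\<bar>t - x0\<bar> \<le> d" | "t \<in> {0..1}" "d < \<bar>t - x0\<bar>"
          by linarith
        then show "?L t \<le> indicator {0..1} t *\<^sub>R (g t * P t ^ N)"
        proof cases
          case 1
          then have "t \<notin> {x0 - d / 2..x0 + d / 2}" using d unfolding atLeastAtMost_iff by linarith
          then show ?thesis using 1 by simp
        next
          case 2
          have "q1 ^ N \<le> P t ^ N" using P_near[OF 2(2)] q1 by (intro power_mono) auto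
          then have "1 / 2 * q1 ^ N \<le> g t * P t ^ N"
            using g_near[of t] 2 d q1 by (intro mult_mono) auto
          moreover have "t \<in> {x0 - d / 2..x0 + d / 2}" using 2(2) unfolding atLeastAtMost_iff by linarith
          ultimately show ?thesis using 2 Bq by simp
        next
          case 3
          have "0 \<le> g t * P t ^ N" using g_near[of t] 3 P0[of t] by simp
          moreover have "t \<notin> {x0 - d / 2..x0 + d / 2}" using 3(2) unfolding atLeastAtMost_iff by linarith
          ultimately show ?thesis using 3 Bq by simp
        next
          case 4
          have "P t ^ N \<le> q2 ^ N" using P_far[of t] 4 P0[of t] by (intro power_mono) auto
          then have "\<bar>g t\<bar> * P t ^ N \<le> B * q2 ^ N" using B 4 P0[of t] by (intro mult_mono) auto
          moreover have "- (\<bar>g t\<bar> * P t ^ N) \<le> g t * P t ^ N"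
            using mult_right_mono[of "- \<bar>g t\<bar>" "g t" "P t ^ N"] P0[of t] by simp
          moreover have "t \<notin> {x0 - d / 2..x0 + d / 2}" using 4(2) d(1) unfolding atLeastAtMost_iff by linarith
          ultimately show ?thesis using 4 by simp
        qed
      qed
      moreover have "(LBINT t. ?L t) = (q1 ^ N / 2) * d - (B * q2 ^ N) * 1"
      proof (subst Bochner_Integration.integral_diff)
        show "integrable lborel (\<lambda>t. (q1 ^ N / 2) * indicator {x0 - d / 2..x0 + d / 2} t)"
          using d by (intro integrable_mult_right integrable_real_indicator) auto
        show "integrable lborel (\<lambda>t. (B * q2 ^ N) * indicator {0..1::real} t :: real)"
          by (intro integrable_mult_right integrable_real_indicator) auto
      qed (use d in simp)
      ultimately show ?thesis unfolding gP by simp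
    qed
    have "(\<lambda>N. (q2 / q1) ^ N * B) \<longlonglongrightarrow> 0 * B"
      using q1 q2 q12 by (intro tendsto_mult tendsto_const LIMSEQ_power_zero) auto
    moreover have "0 < d / 2" using d by simp
    ultimately obtain N where "(q2 / q1) ^ N * B < d / 2"
      using order_tendstoD(2)[of "\<lambda>N. (q2 / q1) ^ N * B" 0 sequentially "d / 2"] by (auto simp: eventually_sequentially)
    moreover have "d / 2 \<le> (q2 / q1) ^ N * B"
      using ineq[of N] q1 by (simp add: power_divide field_simps)
    ultimately show False by simp
  qed
  show ?thesis
  proof (rule continuous_constant_on_closure[where S="{0<..<1::real}" and a=0 and f=h])
    show "continuous_on (closure {0<..<1}) h" using h by simp
  qed (use inner t in auto)
qed

lemma summable_int_decode:
  fixes g :: "int \<Rightarrow> real"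
  assumes "\<And>n. 0 \<le> g n" "\<And>J. finite J \<Longrightarrow> (\<Sum>n\<in>J. g n) \<le> C"
  shows "summable (\<lambda>k. g (int_decode k))"
proof (rule summableI_nonneg_bounded)
  fix N
  have "(\<Sum>k<N. g (int_decode k)) = (\<Sum>n\<in>int_decode ` {..<N}. g n)"
    by (subst sum.reindex) (auto simp: inj_on_def int_decode_eq)
  then show "(\<Sum>k<N. g (int_decode k)) \<le> C" using assms(2) by simp
qed (use assms in auto)

text \<open>Sums over the integers are taken along the enumeration \<open>int_decode\<close>; all of them converge absolutely.\<close>
abbreviation int_cis_series :: "(int \<Rightarrow> complex) \<Rightarrow> real \<Rightarrow> nat \<Rightarrow> complex" where
  "int_cis_series c t \<equiv> \<lambda>k. c (int_decode k) * cis (- (2 * pi * of_int (int_decode k) * t))"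

text \<open>The sum of an absolutely convergent Fourier series is continuous and has the coefficients of \<open>h\<close>.\<close>
lemma fourier_series_circle:
  assumes h: "continuous_on {0..1} h" and s: "summable (\<lambda>k. norm (circle_coeff h (int_decode k)))" and t: "t \<in> {0..1}"
  shows "int_cis_series (circle_coeff h) t sums h t"
proof -
  let ?c = "circle_coeff h"
  let ?u = "\<lambda>k t. int_cis_series ?c t k"
  define A where "A t = (\<Sum>k. ?u k t)" for t
  have nu: "norm (?u k t) = norm (?c (int_decode k))" for k t by (simp add: norm_mult)
  have us: "summable (\<lambda>k. norm (?u k t))" for t unfolding nu by (rule s)
  have sums: "(\<lambda>k. ?u k t) sums A t" for t
    unfolding A_def by (rule summable_sums[OF summable_norm_cancel[OF us]])
  have "uniform_limit UNIV (\<lambda>n t. \<Sum>k<n. ?u k t) A sequentially"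
    unfolding A_def[abs_def] by (rule Weierstrass_m_test[OF _ s]) (simp add: nu)
  then have Ac: "continuous_on UNIV A"
    by (rule uniform_limit_theorem[rotated]) (auto intro!: always_eventually continuous_intros)
  have coeff: "circle_coeff A n = ?c n" for n
  proof -
    let ?v = "\<lambda>k t. indicator {0..1} t *\<^sub>R (?u k t * cis (2 * pi * of_int n * t))"
    have vi: "integrable lborel (?v k)" for k
      by (intro integrable_indicator_Icc continuous_intros)
    have nv: "norm (?v k t) = norm (?c (int_decode k)) * indicator {0..1} t" for k t
      by (simp add: norm_mult)
    have "(\<lambda>k. \<integral>t. ?v k t \<partial>lborel) sums (LBINT t. (\<Sum>k. ?v k t))"
    proof (rule sums_integral[OF vi])
      show "AE t in lborel. summable (\<lambda>k. norm (?v k t))"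
        unfolding nv by (intro AE_I2 summable_mult2 s)
      show "summable (\<lambda>k. \<integral>t. norm (?v k t) \<partial>lborel)" unfolding nv using s by simp
    qed
    also have "(LBINT t. (\<Sum>k. ?v k t)) = circle_coeff A n"
      unfolding circle_coeff_def[of A]
    proof (intro Bochner_Integration.integral_cong refl)
      fix t
      have "(\<lambda>k. ?v k t) sums (indicator {0..1} t *\<^sub>R (A t * cis (2 * pi * of_int n * t)))"
        by (intro sums_scaleR_right sums_mult2 sums)
      then show "(\<Sum>k. ?v k t) = indicator {0..1} t *\<^sub>R (A t * cis (2 * pi * of_int n * t))"
        by (rule sums_unique[symmetric])
    qed
    also have "(\<lambda>k. \<integral>t. ?v k t \<partial>lborel) = (\<lambda>k. if k = int_encode n then ?c n else 0)"
    proof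
      fix k
      have "(LBINT t. ?v k t) = (LBINT t. ?c (int_decode k) * (indicator {0..1} t *\<^sub>R (cis (2 * pi * of_int (- int_decode k) * t) * cis (2 * pi * of_int n * t))))"
        by (simp add: mult_ac)
      also have "\<dots> = ?c (int_decode k) * circle_coeff (\<lambda>t. cis (2 * pi * of_int (- int_decode k) * t)) n"
        unfolding circle_coeff_def[of "\<lambda>t. cis (2 * pi * of_int (- int_decode k) * t)"] by (rule integral_mult_right_zero)
      also have "\<dots> = (if k = int_encode n then ?c n else 0)"
        unfolding circle_coeff_cis by (auto simp: int_encode_inverse)
      finally show "(LBINT t. ?v k t) = (if k = int_encode n then ?c n else 0)" .
    qed
    finally have "(\<lambda>k. if k = int_encode n then ?c n else 0) sums circle_coeff A n" .
    moreover have "(\<lambda>k. if k = int_encode n then ?c n else 0) sums ?c n"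
      using sums_single[of "int_encode n" "\<lambda>_. ?c n"] by simp
    ultimately show ?thesis by (rule sums_unique2)
  qed
  have "(\<lambda>t. h t - A t) t = 0"
  proof (rule circle_coeff_unique[of "\<lambda>t. h t - A t", OF _ _ t])
    have A1: "continuous_on {0..1} A" using Ac continuous_on_subset by blast
    then show "continuous_on {0..1} (\<lambda>t. h t - A t)" using h by (intro continuous_intros)
    fix n
    have "circle_coeff (\<lambda>t. h t - A t) n = circle_coeff h n - circle_coeff A n"
      unfolding circle_coeff_def
      by (subst Bochner_Integration.integral_diff[OF circle_coeff_integrable[OF h] circle_coeff_integrable[OF A1], symmetric])
         (simp add: algebra_simps)
    then show "circle_coeff (\<lambda>t. h t - A t) n = 0" using coeff by simp
  qed
  then show ?thesis using sums[of t] by simp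
qed

section \<open>Sampling integrable functions of exponential type\<close>

text \<open>Translating by \<open>\<lfloor>y\<rfloor>\<close> changes the summands by a factor of at most \<open>3\<close>, which makes the bound uniform in \<open>y\<close>.\<close>
lemma sum_inverse_square_bound:
  obtains C :: real where "0 \<le> C" "\<And>y J. finite J \<Longrightarrow> (\<Sum>n\<in>J. 1 / (1 + (y - real_of_int n)\<^sup>2)) \<le> C"
proof -
  define a where "a n = 1 / (1 + (real n)\<^sup>2)" for n :: nat
  have a0: "0 \<le> a n" for n by (simp add: a_def)
  have sa: "summable a"
  proof (rule summable_comparison_test'[of "\<lambda>n. inverse ((real n)\<^sup>2)" 1])
    show "summable (\<lambda>n. inverse ((real n)\<^sup>2))" by (rule inverse_power_summable) simp
    show "norm (a n) \<le> inverse ((real n)\<^sup>2)" if "1 \<le> n" for n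
      using that by (simp add: a_def inverse_eq_divide frac_le)
  qed
  have part: "(\<Sum>n\<in>K. a (nat \<bar>n\<bar>)) \<le> suminf a" if "finite K" "inj_on (\<lambda>n. nat \<bar>n\<bar>) K" for K :: "int set"
  proof -
    have "(\<Sum>n\<in>K. a (nat \<bar>n\<bar>)) = sum a ((\<lambda>n. nat \<bar>n\<bar>) ` K)"
      using that by (simp add: sum.reindex)
    also have "\<dots> \<le> suminf a" using that a0 by (intro sum_le_suminf sa) auto
    finally show ?thesis .
  qed
  show ?thesis
  proof (rule that[of "3 * (2 * suminf a)"])
    show "0 \<le> 3 * (2 * suminf a)" using suminf_nonneg[OF sa a0] by simp
    fix y :: real and J :: "int set" assume J: "finite J"
    define K where "K = (\<lambda>n. n - \<lfloor>y\<rfloor>) ` J"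
    have K: "finite K" using J by (simp add: K_def)
    have summand: "1 / (1 + (y - real_of_int n)\<^sup>2) \<le> 3 * a (nat \<bar>n - \<lfloor>y\<rfloor>\<bar>)" for n
    proof -
      define j where "j = real_of_int (n - \<lfloor>y\<rfloor>)"
      define v where "v = y - real_of_int n"
      have "\<bar>j\<bar> \<le> \<bar>v\<bar> + 1" unfolding j_def v_def by linarith
      then have "j\<^sup>2 \<le> (\<bar>v\<bar> + 1)\<^sup>2" by (metis abs_ge_zero abs_le_square_iff abs_of_nonneg add_nonneg_nonneg zero_le_one)
      also have "\<dots> \<le> 2 * v\<^sup>2 + 2"
        using zero_le_power2[of "\<bar>v\<bar> - 1"] by (simp add: power2_eq_square algebra_simps)
      also have "\<dots> \<le> 3 * v\<^sup>2 + 2" by simp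
      finally have "1 + j\<^sup>2 \<le> 3 * (1 + v\<^sup>2)" by (simp add: distrib_left)
      then have "1 / (1 + v\<^sup>2) \<le> 3 / (1 + j\<^sup>2)"
        by (simp add: add_pos_nonneg field_simps)
      moreover have "(real (nat \<bar>n - \<lfloor>y\<rfloor>\<bar>))\<^sup>2 = j\<^sup>2" unfolding j_def by simp
      ultimately show ?thesis unfolding a_def v_def by simp
    qed
    have "(\<Sum>n\<in>J. 1 / (1 + (y - real_of_int n)\<^sup>2)) \<le> (\<Sum>n\<in>J. 3 * a (nat \<bar>n - \<lfloor>y\<rfloor>\<bar>))"
      by (intro sum_mono summand)
    also have "\<dots> = 3 * (\<Sum>n\<in>K. a (nat \<bar>n\<bar>))"
      unfolding K_def by (subst sum.reindex) (auto simp: inj_on_def sum_distrib_left)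
    also have "(\<Sum>n\<in>K. a (nat \<bar>n\<bar>)) = (\<Sum>n\<in>K \<inter> {0..}. a (nat \<bar>n\<bar>)) + (\<Sum>n\<in>K \<inter> {..<0}. a (nat \<bar>n\<bar>))"
    proof -
      have "K = (K \<inter> {0..}) \<union> (K \<inter> {..<0})" by auto
      moreover have "(\<Sum>n\<in>(K \<inter> {0..}) \<union> (K \<inter> {..<0}). a (nat \<bar>n\<bar>)) = (\<Sum>n\<in>K \<inter> {0..}. a (nat \<bar>n\<bar>)) + (\<Sum>n\<in>K \<inter> {..<0}. a (nat \<bar>n\<bar>))"
        using K by (intro sum.union_disjoint) auto
      ultimately show ?thesis by simp
    qed
    also have "\<dots> \<le> 2 * suminf a"
    proof -
      have "(\<Sum>n\<in>K \<inter> {0..}. a (nat \<bar>n\<bar>)) \<le> suminf a" "(\<Sum>n\<in>K \<inter> {..<0}. a (nat \<bar>n\<bar>)) \<le> suminf a"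
        using K by (intro part; auto simp: inj_on_def)+
      then show ?thesis by simp
    qed
    finally show "(\<Sum>n\<in>J. 1 / (1 + (y - real_of_int n)\<^sup>2)) \<le> 3 * (2 * suminf a)" by simp
  qed
qed

lemma fourier_test_decay:
  assumes w: "test_fun R \<omega>"
  obtains C where "0 \<le> C" "\<And>y. norm (fourier \<omega> y) \<le> C / (1 + y\<^sup>2)"
proof -
  have w': "test_fun \<bar>R\<bar> \<omega>" using w by (auto simp: test_fun_def)
  obtain A where A: "A \<ge> 0" "Ck_bound \<bar>R\<bar> 2 \<omega> A"
    using Ck_bound_exists w unfolding test_fun_def by meson
  have A0: "Ck_bound \<bar>R\<bar> 0 \<omega> A" by (rule Ck_bound_mono[OF A(2)]) auto
  show ?thesis
  proof (rule that[of "2 * \<bar>R\<bar> * A + 2 * \<bar>R\<bar> * A"])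
    show "0 \<le> 2 * \<bar>R\<bar> * A + 2 * \<bar>R\<bar> * A" using A by simp
    fix y
    have "norm (fourier \<omega> y) \<le> 2 * \<bar>R\<bar> * A" using fourier_decay[OF w' A0, of y] by simp
    moreover have "y\<^sup>2 * norm (fourier \<omega> y) \<le> 2 * \<bar>R\<bar> * A" using fourier_decay[OF w' A(2), of y] by simp
    ultimately have "(1 + y\<^sup>2) * norm (fourier \<omega> y) \<le> 2 * \<bar>R\<bar> * A + 2 * \<bar>R\<bar> * A"
      unfolding distrib_right mult_1 by (rule add_mono)
    moreover have "0 < 1 + y\<^sup>2" by (simp add: add_pos_nonneg)
    ultimately show "norm (fourier \<omega> y) \<le> (2 * \<bar>R\<bar> * A + 2 * \<bar>R\<bar> * A) / (1 + y\<^sup>2)"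
      by (simp only: pos_le_divide_eq mult.commute)
  qed
qed

text \<open>Folding \<open>[-1, 1]\<close> onto \<open>[0, 1]\<close>.\<close>
lemma integral_split_unit:
  fixes \<phi> :: "real \<Rightarrow> complex"
  assumes i: "integrable lborel \<phi>" and z: "\<And>t. 1 < \<bar>t\<bar> \<Longrightarrow> \<phi> t = 0"
  shows "(LBINT t. \<phi> t) = (LBINT t. indicator {0..1} t *\<^sub>R (\<phi> t + \<phi> (t - 1)))"
proof -
  have ii: "integrable lborel (\<lambda>t. indicator A t *\<^sub>R \<phi> t)" if "A \<in> sets borel" for A
    using i that by (intro integrable_mult_indicator) auto
  have [measurable]: "\<phi> \<in> borel_measurable borel" using i by (auto dest: borel_measurable_integrable)
  have sh: "(LBINT t. indicator {-1..0} t *\<^sub>R \<phi> t) = (LBINT t. indicator {0..1} t *\<^sub>R \<phi> (t - 1))"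
  proof -
    have "(LBINT t. indicator {-1..0} t *\<^sub>R \<phi> t) = \<bar>1\<bar> *\<^sub>R (LBINT t. indicator {-1..0} (-1 + 1 * t) *\<^sub>R \<phi> (-1 + 1 * t))"
      by (rule lborel_integral_real_affine) simp
    also have "\<dots> = (LBINT t. indicator {0..1} t *\<^sub>R \<phi> (t - 1))"
      unfolding abs_one scaleR_one by (intro Bochner_Integration.integral_cong refl) (auto simp: indicator_def)
    finally show ?thesis .
  qed
  have si: "integrable lborel (\<lambda>t. indicator {0..1} t *\<^sub>R \<phi> (t - 1))"
  proof -
    have "integrable lborel (\<lambda>t. \<phi> (-1 + 1 * t))" by (rule lborel_integrable_real_affine[OF i]) simp
    then show ?thesis by (intro integrable_mult_indicator) auto
  qed
  have "(LBINT t. \<phi> t) = (LBINT t. indicator {0..1} t *\<^sub>R \<phi> t + indicator {-1..0} t *\<^sub>R \<phi> t)"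
  proof (rule integral_cong_AE)
    show "AE t in lborel. \<phi> t = indicator {0..1} t *\<^sub>R \<phi> t + indicator {-1..0} t *\<^sub>R \<phi> t"
      using AE_lborel_singleton[of 0]
    proof eventually_elim
      case (elim t)
      then show ?case using z[of t] by (auto simp: indicator_def abs_if not_le split: if_splits)
    qed
  qed auto
  also have "\<dots> = (LBINT t. indicator {0..1} t *\<^sub>R \<phi> t) + (LBINT t. indicator {-1..0} t *\<^sub>R \<phi> t)"
    by (intro Bochner_Integration.integral_add ii) auto
  also have "\<dots> = (LBINT t. indicator {0..1} t *\<^sub>R \<phi> t + indicator {0..1} t *\<^sub>R \<phi> (t - 1))"
    unfolding sh by (intro Bochner_Integration.integral_add[symmetric] ii si) auto
  finally show ?thesis by (simp add: scaleR_add_right)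
qed

locale integrable_exp_type =
  fixes F :: "complex \<Rightarrow> complex"
  assumes type: "exp_type_at_most (2 * pi) F"
    and integrable: "integrable lborel (\<lambda>x. F (of_real x))"
begin

definition spectrum :: "real \<Rightarrow> complex" where
  "spectrum = fourier (\<lambda>x. F (of_real x))"

lemma holomorphic: "F holomorphic_on A"
  using type holomorphic_on_subset by (auto simp: exp_type_at_most_def)

lemma continuous_spectrum: "continuous_on A spectrum"
  unfolding spectrum_def by (rule continuous_fourier[OF integrable])

text \<open>The end points \<open>t = 1\<close> and \<open>t = -1\<close> are included by continuity; Poisson summation depends on them.\<close>
lemma spectrum_zero: 
  assumes "1 \<le> \<bar>t\<bar>"
  shows "spectrum t = 0"
proof -
  have "(\<lambda>n. spectrum (t * (1 + inverse (real (Suc n))))) \<longlonglongrightarrow> spectrum (t * (1 + 0))"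
  proof (rule isCont_tendsto_compose[of _ spectrum])
    show "isCont spectrum (t * (1 + 0))"
      using continuous_spectrum[of UNIV] by (simp add: continuous_on_eq_continuous_at)
    show "(\<lambda>n. t * (1 + inverse (real (Suc n)))) \<longlonglongrightarrow> t * (1 + 0)"
      by (intro tendsto_mult tendsto_add tendsto_const LIMSEQ_inverse_real_of_nat)
  qed
  moreover have "spectrum (t * (1 + inverse (real (Suc n)))) = 0" for n
  proof -
    have "1 * 1 < \<bar>t\<bar> * (1 + inverse (real (Suc n)))"
      using assms by (intro mult_le_less_imp_less) auto
    then have "1 < \<bar>t * (1 + inverse (real (Suc n)))\<bar>" by (simp add: abs_mult)
    then show ?thesis unfolding spectrum_def by (rule fourier_exp_type_zero[OF type integrable])
  qed
  ultimately show ?thesis by (simp add: LIMSEQ_const_iff)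
qed

lemma spectrum_integrable: "integrable lborel spectrum"
  using spectrum_zero by (intro integrable_support_Icc[of _ 1] continuous_spectrum) auto

lemma times_spectrum_integrable: "integrable lborel (\<lambda>t. c * of_real t * spectrum t)"
  using spectrum_zero by (intro integrable_support_Icc[of _ 1] continuous_intros continuous_spectrum) auto

lemma isCont_real: "isCont (\<lambda>x. F (of_real x)) x"
proof -
  have "continuous_on UNIV (\<lambda>x. F (complex_of_real x))"
    by (rule continuous_on_compose2[OF holomorphic_on_imp_continuous_on[OF holomorphic[of UNIV]]])
       (auto intro: continuous_intros)
  then show ?thesis by (simp add: continuous_on_eq_continuous_at)
qed

lemma inversion: "F (of_real x) = (LBINT t. spectrum t * cis (2 * pi * t * x))"
  unfolding spectrum_def
  by (rule fourier_inversion[OF integrable spectrum_integrable[unfolded spectrum_def] isCont_real])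

lemma derivative_inversion:
  "deriv F (of_real x) = (LBINT t. (2 * pi * \<i> * of_real t * spectrum t) * cis (2 * pi * t * x))"
proof -
  have eq: "(\<lambda>x. F (of_real (- x))) = fourier spectrum"
    unfolding inversion fourier_cis by (simp add: fun_eq_iff)
  have "(fourier spectrum has_vector_derivative fourier (\<lambda>t. - 2 * pi * \<i> * of_real t * spectrum t) (- x)) (at (- x))"
    using times_spectrum_integrable[of 1] by (intro fourier_has_vector_derivative spectrum_integrable) simp
  moreover have "((\<lambda>x. F (of_real (- x))) has_vector_derivative - deriv F (of_real x)) (at (- x))"
  proof -
    have "((\<lambda>z. F (- z)) has_field_derivative deriv F (of_real x) * (- 1)) (at (of_real (- x)))"
    proof (rule DERIV_chain2[where f=F])
      show "(F has_field_derivative deriv F (of_real x)) (at (- of_real (- x)))"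
        using holomorphic_derivI[OF holomorphic[of UNIV], of "of_real x"] by simp
    qed (auto intro!: derivative_eq_intros)
    from has_vector_derivative_real_field[OF this] show ?thesis by simp
  qed
  ultimately have "- deriv F (of_real x) = fourier (\<lambda>t. - 2 * pi * \<i> * of_real t * spectrum t) (- x)"
    unfolding eq by (metis vector_derivative_at)
  also have "\<dots> = (LBINT t. (- 1) * ((2 * pi * \<i> * of_real t * spectrum t) * cis (2 * pi * t * x)))"
    unfolding fourier_cis by (simp add: mult_ac)
  also have "\<dots> = (- 1) * (LBINT t. (2 * pi * \<i> * of_real t * spectrum t) * cis (2 * pi * t * x))"
    by (rule integral_mult_right_zero)
  finally show ?thesis by simp
qed

lemma multiplier_formula:
  assumes w: "test_fun R \<omega>"
  shows "(LBINT t. spectrum t * \<omega> t * cis (2 * pi * t * x)) = (LBINT y. F (of_real y) * fourier \<omega> (y - x))"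
proof -
  have "test_fun R (\<lambda>t. cis (t * (2 * pi * x)) * \<omega> t)" by (intro test_fun_mult[OF w smooth_cis])
  then have i: "integrable lborel (\<lambda>t. cis (t * (2 * pi * x)) * \<omega> t)" by (rule test_fun_integrable)
  show ?thesis
    using fourier_multiplication[OF integrable i] unfolding fourier_modulate spectrum_def[symmetric]
    by (simp add: mult_ac)
qed

text \<open>A multiplier acts on \<open>F\<close> as convolution with a kernel of quadratic decay, and the sum of the kernel over the integers is bounded.
  With a cut-off that is \<open>1\<close> on the spectrum, and with \<open>2 \<pi> \<i> t\<close> times it, this yields the absolute
  convergence of the sums of values and of derivatives.\<close>
lemma multiplier_summable:
  assumes w: "test_fun R \<omega>"
  shows "summable (\<lambda>k. norm (LBINT t. spectrum t * \<omega> t * cis (2 * pi * t * of_int (int_decode k))))"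
proof -
  obtain C where C: "0 \<le> C" "\<And>y. norm (fourier \<omega> y) \<le> C / (1 + y\<^sup>2)"
    using fourier_test_decay[OF w] by blast
  obtain D :: real where D: "0 \<le> D" "\<And>y J. finite J \<Longrightarrow> (\<Sum>n\<in>J. 1 / (1 + (y - real_of_int n)\<^sup>2)) \<le> D"
    using sum_inverse_square_bound by blast
  let ?f = "\<lambda>y. F (complex_of_real y)"
  have [measurable]: "?f \<in> borel_measurable borel" using integrable by (auto dest: borel_measurable_integrable)
  have fw: "fourier \<omega> \<in> borel_measurable borel"
    by (rule borel_measurable_fourier[OF test_fun_integrable[OF w]])
  have pi: "integrable lborel (\<lambda>y. norm (?f y) * norm (fourier \<omega> (y - of_int n)))" for n :: int
  proof (rule Bochner_Integration.integrable_bound[where f="\<lambda>y. C *\<^sub>R ?f y"])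
    show "integrable lborel (\<lambda>y. C *\<^sub>R ?f y)" using integrable by simp
    show "AE y in lborel. norm (norm (?f y) * norm (fourier \<omega> (y - of_int n))) \<le> norm (C *\<^sub>R ?f y)"
    proof (intro AE_I2)
      fix y
      have "C / (1 + (y - of_int n)\<^sup>2) \<le> C / 1" using C(1) by (intro divide_left_mono) (auto simp: add_pos_nonneg)
      then have "norm (fourier \<omega> (y - of_int n)) \<le> C" using C(2)[of "y - of_int n"] by simp
      then have "norm (?f y) * norm (fourier \<omega> (y - of_int n)) \<le> norm (?f y) * C" by (intro mult_left_mono) auto
      then show "norm (norm (?f y) * norm (fourier \<omega> (y - of_int n))) \<le> norm (C *\<^sub>R ?f y)"
        using C(1) by (simp add: mult.commute)
    qed
    show "(\<lambda>y. norm (?f y) * norm (fourier \<omega> (y - of_int n))) \<in> borel_measurable lborel"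
      using measurable_compose[OF _ fw, of "\<lambda>y. y - of_int n"] by measurable
  qed
  show ?thesis
  proof (rule summable_int_decode[where g="\<lambda>n. norm (LBINT t. spectrum t * \<omega> t * cis (2 * pi * t * of_int n))" and C="(LBINT y. norm (?f y) * (C * D))"])
    fix J :: "int set" assume J: "finite J"
    have "(\<Sum>n\<in>J. norm (LBINT t. spectrum t * \<omega> t * cis (2 * pi * t * of_int n))) \<le> (\<Sum>n\<in>J. \<integral>y. norm (?f y) * norm (fourier \<omega> (y - of_int n)) \<partial>lborel)"
      unfolding multiplier_formula[OF w]
      by (intro sum_mono order_trans[OF integral_norm_bound]) (simp add: norm_mult)
    also have "\<dots> = (LBINT y. (\<Sum>n\<in>J. norm (?f y) * norm (fourier \<omega> (y - of_int n))))"
      by (rule Bochner_Integration.integral_sum[symmetric]) (rule pi)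
    also have "\<dots> \<le> (LBINT y. norm (?f y) * (C * D))"
    proof (rule integral_mono)
      show "integrable lborel (\<lambda>y. \<Sum>n\<in>J. norm (?f y) * norm (fourier \<omega> (y - of_int n)))"
        by (intro Bochner_Integration.integrable_sum pi)
      show "integrable lborel (\<lambda>y. norm (?f y) * (C * D))" using integrable by simp
      fix y
      have "(\<Sum>n\<in>J. norm (fourier \<omega> (y - of_int n))) \<le> (\<Sum>n\<in>J. C * (1 / (1 + (y - of_int n)\<^sup>2)))"
        using C(2) by (intro sum_mono) simp
      also have "\<dots> \<le> C * D" unfolding sum_distrib_left[symmetric] using C D J by (intro mult_left_mono) auto
      finally show "(\<Sum>n\<in>J. norm (?f y) * norm (fourier \<omega> (y - of_int n))) \<le> norm (?f y) * (C * D)"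
        unfolding sum_distrib_left[symmetric] by (intro mult_left_mono) auto
    qed
    finally show "(\<Sum>n\<in>J. norm (LBINT t. spectrum t * \<omega> t * cis (2 * pi * t * of_int n))) \<le> (LBINT y. norm (?f y) * (C * D))" .
  qed auto
qed

lemma summable_values:
  shows "summable (\<lambda>k. norm (F (of_int (int_decode k))))"
    and "summable (\<lambda>k. norm (deriv F (of_int (int_decode k))))"
proof -
  obtain \<kappa> :: "real \<Rightarrow> real" where k: "test_fun (1 + 2 * 1) (\<lambda>t. of_real (\<kappa> t))" and k1: "\<And>t. \<bar>t\<bar> \<le> 1 \<Longrightarrow> \<kappa> t = 1"
    using plateau_exists[of 1] by (metis zero_less_one)
  have sk: "spectrum t * of_real (\<kappa> t) = spectrum t" for t
    using k1[of t] spectrum_zero[of t] by (cases "\<bar>t\<bar> \<le> 1") auto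
  show "summable (\<lambda>k. norm (F (of_int (int_decode k))))"
    using multiplier_summable[OF k] unfolding sk inversion[symmetric] by simp
  have "test_fun (1 + 2 * 1) (\<lambda>t. 2 * pi * \<i> * of_real t * of_real (\<kappa> t))" by (rule test_fun_times_t[OF k])
  from multiplier_summable[OF this]
  have "summable (\<lambda>n. norm (LBINT t. (2 * pi * \<i> * of_real t * (spectrum t * of_real (\<kappa> t))) * cis (2 * pi * t * of_int (int_decode n))))"
    by (simp only: mult_ac)
  then show "summable (\<lambda>k. norm (deriv F (of_int (int_decode k))))"
    unfolding sk derivative_inversion[symmetric] by simp
qed

text \<open>The integrals \<open>v n\<close> are the Fourier coefficients of the periodization of \<open>\<phi>\<close>, of which only two terms meet \<open>[0, 1]\<close>.\<close>
lemma periodization_series: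
  assumes c: "continuous_on UNIV \<phi>" and i: "integrable lborel \<phi>" and z: "\<And>t. 1 < \<bar>t\<bar> \<Longrightarrow> \<phi> t = 0"
    and v: "\<And>n::int. (LBINT t. \<phi> t * cis (2 * pi * t * of_int n)) = v n"
    and s: "summable (\<lambda>k. norm (v (int_decode k)))" and t: "t \<in> {0..1}"
  shows "int_cis_series v t sums (\<phi> t + \<phi> (t - 1))"
proof -
  have co: "circle_coeff (\<lambda>t. \<phi> t + \<phi> (t - 1)) n = v n" for n
  proof -
    have "v n = (LBINT t. indicator {0..1} t *\<^sub>R (\<phi> t * cis (2 * pi * t * of_int n) + \<phi> (t - 1) * cis (2 * pi * (t - 1) * of_int n)))"
      unfolding v[symmetric] using z by (intro integral_split_unit integrable_mult_cis i) auto
    also have "\<dots> = circle_coeff (\<lambda>t. \<phi> t + \<phi> (t - 1)) n"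
      unfolding circle_coeff_def
    proof (intro Bochner_Integration.integral_cong refl)
      fix t
      have "2 * pi * (t - 1) * real_of_int n = 2 * pi * t * of_int n - 2 * pi * of_int n" by (simp add: algebra_simps)
      then have "cis (2 * pi * (t - 1) * of_int n) = cis (2 * pi * t * of_int n) / cis (2 * pi * of_int n)"
        by (simp only: cis_divide)
      also have "cis (2 * pi * of_int n) = 1" by (rule cis_multiple_2pi) simp
      finally show "indicator {0..1} t *\<^sub>R (\<phi> t * cis (2 * pi * t * of_int n) + \<phi> (t - 1) * cis (2 * pi * (t - 1) * of_int n)) =
        indicator {0..1} t *\<^sub>R ((\<phi> t + \<phi> (t - 1)) * cis (2 * pi * of_int n * t))"
        by (simp add: distrib_right mult_ac)
    qed
    finally show ?thesis ..
  qed
  have "continuous_on {0..1} (\<lambda>t. \<phi> t + \<phi> (t - 1))"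
    by (intro continuous_on_add continuous_on_subset[OF c] continuous_on_compose2[OF c, of _ "\<lambda>t. t - 1"] continuous_intros) auto
  from fourier_series_circle[OF this _ t] show ?thesis
    unfolding co using s by simp
qed

lemma value_series:
  "t \<in> {0..1} \<Longrightarrow> int_cis_series (\<lambda>n. F (of_int n)) t sums (spectrum t + spectrum (t - 1))"
  using spectrum_zero inversion[of "of_int _", symmetric]
  by (intro periodization_series continuous_spectrum spectrum_integrable summable_values) auto

lemma derivative_series:
  "t \<in> {0..1} \<Longrightarrow> int_cis_series (\<lambda>n. deriv F (of_int n)) t sums
     (2 * pi * \<i> * of_real t * spectrum t + 2 * pi * \<i> * of_real (t - 1) * spectrum (t - 1))"
  using spectrum_zero derivative_inversion[of "of_int _", symmetric]
  by (intro periodization_series[where \<phi>="\<lambda>t. 2 * pi * \<i> * of_real t * spectrum t"] continuous_intros continuous_spectrum times_spectrum_integrable summable_values) auto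

text \<open>At \<open>t = 0\<close> the periodized spectrum has the single term \<open>spectrum 0\<close>, as \<open>spectrum (-1) = 0\<close>.\<close>
theorem poisson_sum: "(\<lambda>k. F (of_int (int_decode k))) sums (LBINT x. F (of_real x))"
  using value_series[of 0] spectrum_zero[of "-1"] by (simp add: spectrum_def fourier_cis)

lemma derivative_sum: "(\<lambda>k. deriv F (of_int (int_decode k))) sums 0"
  using derivative_series[of 0] spectrum_zero[of "-1"] by simp

definition value_sum :: "real \<Rightarrow> complex" where
  "value_sum t = (\<Sum>k. int_cis_series (\<lambda>n. F (of_int n)) t k)"

definition derivative_sum_at :: "real \<Rightarrow> complex" where
  "derivative_sum_at t = (\<Sum>k. int_cis_series (\<lambda>n. deriv F (of_int n)) t k)"

text \<open>The series of values and of derivatives give two linear equations for \<open>spectrum t\<close> and \<open>spectrum (t - 1)\<close>, with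
  coefficients \<open>1, 1\<close> and \<open>t, t - 1\<close>, hence with determinant \<open>-1\<close>.\<close>
lemma spectrum_from_samples:
  assumes "t \<in> {0..1}"
  shows "spectrum t = derivative_sum_at t / (2 * pi * \<i>) + of_real (1 - t) * value_sum t"
    and "spectrum (t - 1) = of_real t * value_sum t - derivative_sum_at t / (2 * pi * \<i>)"
proof -
  have A: "value_sum t = spectrum t + spectrum (t - 1)"
    unfolding value_sum_def by (rule sums_unique[symmetric, OF value_series[OF assms]])
  have "derivative_sum_at t = 2 * pi * \<i> * of_real t * spectrum t + 2 * pi * \<i> * of_real (t - 1) * spectrum (t - 1)"
    unfolding derivative_sum_at_def by (rule sums_unique[symmetric, OF derivative_series[OF assms]])
  also have "\<dots> = (2 * pi * \<i>) * (of_real t * spectrum t + of_real (t - 1) * spectrum (t - 1))"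
    by (simp add: algebra_simps)
  finally have B: "derivative_sum_at t / (2 * pi * \<i>) = of_real t * spectrum t + of_real (t - 1) * spectrum (t - 1)"
    by simp
  show "spectrum t = derivative_sum_at t / (2 * pi * \<i>) + of_real (1 - t) * value_sum t"
    "spectrum (t - 1) = of_real t * value_sum t - derivative_sum_at t / (2 * pi * \<i>)"
    unfolding A B by (simp_all add: algebra_simps)
qed

lemma reconstruction:
  "F (of_real x) = (LBINT t. indicator {0..1} t *\<^sub>R
     ((derivative_sum_at t / (2 * pi * \<i>) + of_real (1 - t) * value_sum t) * cis (2 * pi * t * x) +
      (of_real t * value_sum t - derivative_sum_at t / (2 * pi * \<i>)) * cis (2 * pi * (t - 1) * x)))"
proof -
  have "F (of_real x) = (LBINT t. indicator {0..1} t *\<^sub>R (spectrum t * cis (2 * pi * t * x) + spectrum (t - 1) * cis (2 * pi * (t - 1) * x)))"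
    unfolding inversion using spectrum_zero
    by (intro integral_split_unit integrable_mult_cis spectrum_integrable) auto
  also have "\<dots> = (LBINT t. indicator {0..1} t *\<^sub>R
     ((derivative_sum_at t / (2 * pi * \<i>) + of_real (1 - t) * value_sum t) * cis (2 * pi * t * x) +
      (of_real t * value_sum t - derivative_sum_at t / (2 * pi * \<i>)) * cis (2 * pi * (t - 1) * x)))"
  proof (rule Bochner_Integration.integral_cong[OF refl])
    fix t :: real
    show "indicator {0..1} t *\<^sub>R (spectrum t * cis (2 * pi * t * x) + spectrum (t - 1) * cis (2 * pi * (t - 1) * x)) =
      indicator {0..1} t *\<^sub>R
     ((derivative_sum_at t / (2 * pi * \<i>) + of_real (1 - t) * value_sum t) * cis (2 * pi * t * x) +
      (of_real t * value_sum t - derivative_sum_at t / (2 * pi * \<i>)) * cis (2 * pi * (t - 1) * x))"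
      by (cases "t \<in> {0..1}") (simp_all add: spectrum_from_samples)
  qed
  finally show ?thesis .
qed

text \<open>The derivatives at the integers sum to zero, so the one at \<open>0\<close> vanishes with all the others.\<close>
theorem zero_if_samples_zero:
  assumes v: "\<And>n::int. F (of_int n) = 0" and d: "\<And>n::int. n \<noteq> 0 \<Longrightarrow> deriv F (of_int n) = 0"
  shows "F = (\<lambda>_. 0)"
proof -
  have "(\<lambda>k. deriv F (of_int (int_decode k))) = (\<lambda>k. if k = int_encode 0 then deriv F 0 else 0)"
  proof
    fix k show "deriv F (of_int (int_decode k)) = (if k = int_encode 0 then deriv F 0 else 0)"
      using d[of "int_decode k"] by (cases "int_decode k = 0") (auto simp: int_encode_inverse, metis int_decode_inverse)
  qed
  then have "(\<lambda>k. if k = int_encode 0 then deriv F 0 else 0) sums 0" using derivative_sum by simp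
  then have "deriv F 0 = 0" using sums_single[of "int_encode 0" "\<lambda>_. deriv F 0"] sums_unique2 by fastforce
  then have d': "deriv F (of_int n) = 0" for n :: int using d[of n] by (cases "n = 0") auto
  have "F (of_real x) = 0" for x :: real
    unfolding reconstruction value_sum_def derivative_sum_at_def v d' by simp
  then show ?thesis
    by (intro entire_eq_on_reals holomorphic) auto
qed

end

section \<open>A single interpolating majorant\<close>

lemma integrable_powr_tail:
  fixes e :: real
  assumes e: "0 < e"
  shows "integrable lborel (\<lambda>x. (1 + \<bar>x\<bar>) powr (- 1 - e))"
proof -
  define p where "p x = (1 + x) powr (- 1 - e) * indicator {0..} x" for x :: real
  have "(\<integral>\<^sup>+x. ennreal ((1 + x) powr (- 1 - e)) * indicator {0..} x \<partial>lborel) = ennreal (0 - (- ((1 + 0) powr (- e) / e)))"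
  proof (rule nn_integral_FTC_atLeast)
    show "((\<lambda>x. - ((1 + x) powr (- e) / e)) has_real_derivative (1 + x) powr (- 1 - e)) (at x)" if "0 \<le> x" for x
    proof -
      have "((\<lambda>x. (1 + x) powr (- e)) has_real_derivative (- e * (1 + x) powr (- e - 1)) * 1) (at x)"
        using that by (intro DERIV_chain2[OF has_real_derivative_powr]) (auto intro!: derivative_eq_intros)
      moreover have "- e - 1 = - 1 - e" by simp
      ultimately have "((\<lambda>x. (1 + x) powr (- e)) has_real_derivative (- e * (1 + x) powr (- 1 - e)) * 1) (at x)"
        by (simp only:)
      from DERIV_minus[OF DERIV_cdivide[OF this, of e]] show ?thesis
        using e by simp
    qed
    have "LIM x at_top. 1 + x :> (at_top :: real filter)"
      by (rule filterlim_tendsto_add_at_top[OF tendsto_const filterlim_ident])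
    from tendsto_neg_powr[OF _ this, of "- e"] have "((\<lambda>x. (1 + x) powr (- e)) \<longlongrightarrow> 0) at_top" using e by simp
    from tendsto_minus[OF tendsto_divide[OF this tendsto_const[of e]]] show "((\<lambda>x. - ((1 + x) powr (- e) / e)) \<longlongrightarrow> 0) at_top"
      using e by simp
  qed auto
  then have "(\<integral>\<^sup>+x. ennreal (p x) \<partial>lborel) < \<infinity>"
    by (simp add: p_def ennreal_mult'' ennreal_indicator less_top[symmetric])
  then have p: "integrable lborel p"
    by (intro integrableI_nonneg) (auto simp: p_def[abs_def])
  have p': "integrable lborel (\<lambda>x. p (- x))"
    using lborel_integrable_real_affine[OF p, of "-1" 0] by simp
  show ?thesis
    by (rule Bochner_Integration.integrable_bound[OF Bochner_Integration.integrable_add[OF p p']])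
       (auto simp: p_def indicator_def)
qed

lemma integrable_of_decay:
  fixes h :: "real \<Rightarrow> 'a::{banach, second_countable_topology}"
  assumes "h \<in> borel_measurable lborel" "0 < e" "0 \<le> C" "\<And>x. norm (h x) \<le> C * (1 + \<bar>x\<bar>) powr (- 1 - e)"
  shows "integrable lborel h"
  by (rule Bochner_Integration.integrable_bound[OF integrable_mult_right[OF integrable_powr_tail[OF assms(2)], of C]])
     (use assms in auto)

lemma exp_type_add:
  assumes "exp_type_at_most \<tau> F" "exp_type_at_most \<tau> H"
  shows "exp_type_at_most \<tau> (\<lambda>z. F z + H z)"
  unfolding exp_type_at_most_def
proof (intro conjI allI impI)
  show "(\<lambda>z. F z + H z) holomorphic_on UNIV"
    using assms by (auto simp: exp_type_at_most_def intro: holomorphic_intros)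
  fix e :: real assume "0 < e"
  then obtain C D where C: "C > 0" "\<And>z. norm (F z) \<le> C * exp ((\<tau> + e) * norm z)"
     and D: "D > 0" "\<And>z. norm (H z) \<le> D * exp ((\<tau> + e) * norm z)"
    using assms unfolding exp_type_at_most_def by meson
  show "\<exists>C>0. \<forall>z. norm (F z + H z) \<le> C * exp ((\<tau> + e) * norm z)"
  proof (intro exI[of _ "C + D"] conjI allI)
    fix z
    show "norm (F z + H z) \<le> (C + D) * exp ((\<tau> + e) * norm z)"
      using norm_triangle_ineq[of "F z" "H z"] C(2)[of z] D(2)[of z] unfolding distrib_right by linarith
  qed (use C D in simp)
qed

lemma exp_type_uminus: "exp_type_at_most \<tau> F \<Longrightarrow> exp_type_at_most \<tau> (\<lambda>z. - F z)"
  by (auto simp: exp_type_at_most_def intro: holomorphic_intros)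

lemma exp_type_sin_squared: "exp_type_at_most (2 * pi) (\<lambda>z. (sin (of_real pi * z))\<^sup>2)"
  unfolding exp_type_at_most_def
proof (intro conjI allI impI)
  show "(\<lambda>z. (sin (of_real pi * z))\<^sup>2) holomorphic_on UNIV" by (intro holomorphic_intros)
  fix e :: real assume e: "0 < e"
  have sin_le: "norm (sin w) \<le> exp (norm w)" for w :: complex
  proof -
    have "norm (exp u) \<le> exp (norm w)" if "norm u = norm w" for u :: complex
      using that complex_Re_le_cmod[of u] by simp
    then have "norm (exp (\<i> * w)) \<le> exp (norm w)" "norm (exp (- (\<i> * w))) \<le> exp (norm w)"
      by (simp_all only: norm_mult norm_minus_cancel norm_ii mult_1)
    then have "norm (exp (\<i> * w) - exp (- (\<i> * w))) \<le> 2 * exp (norm w)"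
      using norm_triangle_ineq4[of "exp (\<i> * w)" "exp (- (\<i> * w))"] by linarith
    then show ?thesis unfolding sin_exp_eq by (simp add: norm_divide norm_mult)
  qed
  have "norm ((sin (of_real pi * z))\<^sup>2) \<le> 1 * exp ((2 * pi + e) * norm z)" for z :: complex
  proof -
    have "norm ((sin (of_real pi * z))\<^sup>2) \<le> (exp (norm (of_real pi * z)))\<^sup>2"
      unfolding norm_power by (intro power_mono sin_le) auto
    also have "\<dots> = exp (2 * pi * norm z)" by (simp add: norm_mult exp_double[symmetric] mult.assoc)
    also have "\<dots> \<le> exp ((2 * pi + e) * norm z)" using e by (simp add: mult_right_mono)
    finally show ?thesis by simp
  qed
  then show "\<exists>C>0. \<forall>z::complex. norm ((sin (of_real pi * z))\<^sup>2) \<le> C * exp ((2 * pi + e) * norm z)"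
    by (intro exI[of _ 1]) auto
qed

text \<open>If no majorant were at finite distance from \<open>f\<close>, every majorant would be extremal; adding
  \<open>sin\<^sup>2 (\<pi> z)\<close> would then give a second interpolating one.\<close>
lemma unique_interpolating_extremal_finite:
  assumes ex1: "\<exists>!F. extremal_majorant (2 * pi) f F \<and> interpolates_at_ints f F"
    and M: "extremal_majorant (2 * pi) f M" "interpolates_at_ints f M"
  shows "(\<integral>\<^sup>+x. ennreal \<bar>Re (M (of_real x)) - f x\<bar> \<partial>lborel) < \<infinity>"
proof (rule ccontr)
  assume "\<not> ?thesis"
  then have inf: "(\<integral>\<^sup>+x. ennreal \<bar>Re (M (of_real x)) - f x\<bar> \<partial>lborel) = \<infinity>" by (simp add: not_less top_unique)
  \<comment> \<open>\<open>sin\<^sup>2 (\<pi> z)\<close> is non-negative on the reals, zero at the integers and of type \<open>2 \<pi>\<close>.\<close>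
  define N where "N z = M z + (sin (of_real pi * z))\<^sup>2" for z
  have real_sin: "(sin (of_real pi * of_real x))\<^sup>2 = complex_of_real ((sin (pi * x))\<^sup>2)" for x
    by (simp add: sin_of_real[symmetric])
  have "extremal_majorant (2 * pi) f N"
    unfolding extremal_majorant_def majorant_def
  proof (intro conjI allI impI)
    show "exp_type_at_most (2 * pi) N"
      unfolding N_def[abs_def] using M exp_type_sin_squared
      by (intro exp_type_add) (auto simp: extremal_majorant_def majorant_def)
    show "N (of_real x) \<in> \<real>" for x
      using M unfolding N_def real_sin by (auto simp: extremal_majorant_def majorant_def intro!: Reals_add)
    show "f x \<le> Re (N (of_real x))" for x
    proof -
      have "f x \<le> Re (M (of_real x))" using M by (auto simp: extremal_majorant_def majorant_def)
      then show ?thesis unfolding N_def real_sin by (simp add: add_increasing2)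
    qed
    fix H assume H: "exp_type_at_most (2 * pi) H \<and> (\<forall>x::real. H (of_real x) \<in> \<real>) \<and> (\<forall>x. f x \<le> Re (H (of_real x)))"
    then have "(\<integral>\<^sup>+x. ennreal \<bar>Re (M (of_real x)) - f x\<bar> \<partial>lborel) \<le> (\<integral>\<^sup>+x. ennreal \<bar>Re (H (of_real x)) - f x\<bar> \<partial>lborel)"
      using M(1) unfolding extremal_majorant_def majorant_def by blast
    then have "(\<integral>\<^sup>+x. ennreal \<bar>Re (H (of_real x)) - f x\<bar> \<partial>lborel) = \<infinity>"
      unfolding inf by (simp add: top_unique)
    then show "(\<integral>\<^sup>+x. ennreal \<bar>Re (N (of_real x)) - f x\<bar> \<partial>lborel) \<le> (\<integral>\<^sup>+x. ennreal \<bar>Re (H (of_real x)) - f x\<bar> \<partial>lborel)"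
      by simp
  qed
  moreover have "interpolates_at_ints f N"
    unfolding interpolates_at_ints_def
  proof
    fix n :: int
    have "sin (of_real pi * complex_of_real (of_int n)) = 0"
      unfolding of_real_mult[symmetric] sin_of_real by (simp add: mult.commute)
    then show "N (of_int n) = of_real (f (of_int n))"
      using M(2) by (simp add: N_def interpolates_at_ints_def)
  qed
  ultimately have "N = M" using ex1 M by blast
  then have "N (of_real (1 / 2)) = M (of_real (1 / 2))" by simp
  then have "complex_of_real ((sin (pi * (1 / 2)))\<^sup>2) = 0" unfolding N_def real_sin by simp
  then show False by simp
qed

text \<open>The difference of the two has a minimum at the point of contact.\<close>
lemma majorant_touching_deriv:
  assumes F: "F holomorphic_on UNIV" and real: "\<And>y::real. F (of_real y) \<in> \<real>"
    and maj: "\<And>y::real. g y \<le> Re (F (of_real y))" and touch: "Re (F (of_real x)) = g x" and g: "g differentiable (at x)"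
  shows "deriv F (of_real x) = of_real (deriv g x)"
proof -
  have "(F has_field_derivative deriv F (of_real x)) (at (of_real x))"
    using F by (intro holomorphic_derivI[of _ UNIV]) auto
  then have v: "((\<lambda>y. F (of_real y)) has_vector_derivative deriv F (of_real x)) (at x)"
    by (rule has_vector_derivative_real_field)
  have r: "((\<lambda>y. Re (F (of_real y))) has_real_derivative Re (deriv F (of_real x))) (at x)"
    using bounded_linear.has_vector_derivative[OF bounded_linear_Re v] by (simp add: has_real_derivative_iff_has_vector_derivative)
  have i: "((\<lambda>y. Im (F (of_real y))) has_real_derivative Im (deriv F (of_real x))) (at x)"
    using bounded_linear.has_vector_derivative[OF bounded_linear_Im v] by (simp add: has_real_derivative_iff_has_vector_derivative)
  have "(\<lambda>y. Im (F (complex_of_real y))) = (\<lambda>_. 0)" using real by (auto simp: complex_is_Real_iff)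
  then have "Im (deriv F (of_real x)) = 0" using i DERIV_unique[OF _ DERIV_const[of 0]] by metis
  moreover have "(g has_real_derivative deriv g x) (at x)"
    using g by (simp add: DERIV_deriv_iff_real_differentiable)
  from DERIV_diff[OF r this] have "Re (deriv F (of_real x)) - deriv g x = 0"
    by (rule DERIV_local_min[of _ _ _ 1]) (use maj touch in auto)
  ultimately show ?thesis by (simp add: complex_eq_iff)
qed

text \<open>Approximate the real argument by the grid point \<open>\<lfloor>i x\<rfloor> / i\<close>, which takes countably many values.\<close>
lemma measurable_caratheodory:
  fixes f :: "'a \<Rightarrow> real \<Rightarrow> 'b::metric_space"
  assumes m: "\<And>x. (\<lambda>l. f l x) \<in> borel_measurable N" and c: "\<And>l. l \<in> space N \<Longrightarrow> continuous_on UNIV (f l)"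
  shows "(\<lambda>p. f (fst p) (snd p)) \<in> borel_measurable (N \<Otimes>\<^sub>M borel)"
proof (rule borel_measurable_LIMSEQ_metric)
  let ?r = "\<lambda>i x. of_int \<lfloor>real (Suc i) * x\<rfloor> / real (Suc i)"
  show "(\<lambda>p. f (fst p) (?r i (snd p))) \<in> borel_measurable (N \<Otimes>\<^sub>M borel)" for i
  proof (rule measurable_compose_countable[where f="\<lambda>j p. f (fst p) (of_int j / real (Suc i))" and g="\<lambda>p. \<lfloor>real (Suc i) * snd p\<rfloor>"])
    show "(\<lambda>p. f (fst p) (of_int j / real (Suc i))) \<in> borel_measurable (N \<Otimes>\<^sub>M borel)" for j :: int
      using measurable_compose[OF measurable_fst m] .
    show "(\<lambda>p. \<lfloor>real (Suc i) * snd p\<rfloor>) \<in> N \<Otimes>\<^sub>M borel \<rightarrow>\<^sub>M count_space UNIV" by measurable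
  qed
  fix p assume "p \<in> space (N \<Otimes>\<^sub>M (borel :: real measure))"
  then have l: "fst p \<in> space N" by (auto simp: space_pair_measure)
  have lim: "(\<lambda>i. ?r i (snd p)) \<longlonglongrightarrow> snd p"
  proof (rule LIM_zero_cancel, rule Lim_null_comparison)
    show "(\<lambda>i. inverse (real (Suc i))) \<longlonglongrightarrow> 0" by (rule LIMSEQ_inverse_real_of_nat)
    show "\<forall>\<^sub>F i in sequentially. norm (?r i (snd p) - snd p) \<le> inverse (real (Suc i))"
    proof (intro always_eventually allI)
      fix i
      have "?r i (snd p) - snd p = (of_int \<lfloor>real (Suc i) * snd p\<rfloor> - real (Suc i) * snd p) / real (Suc i)"
        by (simp add: field_simps del: of_nat_Suc)
      moreover have "\<bar>of_int \<lfloor>real (Suc i) * snd p\<rfloor> - real (Suc i) * snd p\<bar> \<le> 1" by linarith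
      ultimately show "norm (?r i (snd p) - snd p) \<le> inverse (real (Suc i))"
        by (simp add: abs_divide divide_right_mono inverse_eq_divide del: of_nat_Suc)
    qed
  qed
  have "isCont (f (fst p)) (snd p)" using c[OF l] by (simp add: continuous_on_eq_continuous_at)
  from isCont_tendsto_compose[OF this lim]
  show "(\<lambda>i. f (fst p) (?r i (snd p))) \<longlonglongrightarrow> f (fst p) (snd p)" .
qed

locale interpolating_majorant =
  fixes G :: "real \<Rightarrow> real" and M :: "complex \<Rightarrow> complex"
  assumes G_continuous: "continuous_on UNIV G"
    and G_differentiable: "\<And>x. x \<noteq> 0 \<Longrightarrow> G differentiable (at x)"
    and G_integrable: "integrable lborel G"
    and G_fourier_integrable: "integrable lborel (fourier (\<lambda>x. of_real (G x)))"
    and G_fourier_nonneg: "\<And>t. fourier (\<lambda>x. of_real (G x)) t \<in> \<real>\<^sub>\<ge>\<^sub>0"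
    and majorant: "majorant (2 * pi) G M"
    and interpolates: "interpolates_at_ints G M"
    and finite_distance: "(\<integral>\<^sup>+x. ennreal \<bar>Re (M (of_real x)) - G x\<bar> \<partial>lborel) < \<infinity>"
begin

definition gap :: "real \<Rightarrow> real" where "gap x = Re (M (of_real x)) - G x"

lemma M_holomorphic: "M holomorphic_on UNIV"
  using majorant by (simp add: majorant_def exp_type_at_most_def)

lemma M_real: "M (of_real x) = of_real (G x + gap x)"
  using majorant by (auto simp: majorant_def gap_def complex_eq_iff complex_is_Real_iff)

lemma M_continuous: "continuous_on A (\<lambda>x. M (of_real x))"
  by (rule continuous_on_compose2[OF holomorphic_on_imp_continuous_on[OF M_holomorphic]]) (auto intro: continuous_intros)

lemma gap_continuous: "continuous_on A gap"
  unfolding gap_def by (intro continuous_intros M_continuous continuous_on_subset[OF G_continuous]) auto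

lemma gap_nonneg: "0 \<le> gap x"
  using majorant by (simp add: majorant_def gap_def)

lemma gap_int: "gap (of_int n) = 0"
  using interpolates unfolding interpolates_at_ints_def gap_def by (metis Re_complex_of_real diff_self of_real_of_int_eq)

lemma gap_integrable: "integrable lborel gap"
  using finite_distance borel_measurable_continuous_onI[OF gap_continuous]
  by (intro integrableI_bounded) (auto simp: gap_def[abs_def])

sublocale integrable_exp_type M
proof
  show "exp_type_at_most (2 * pi) M" using majorant by (simp add: majorant_def)
  show "integrable lborel (\<lambda>x. M (of_real x))"
    unfolding M_real using G_integrable gap_integrable
    by (intro integrable_of_real Bochner_Integration.integrable_add)
qed

lemma fourier_gap: "fourier (\<lambda>x. of_real (gap x)) t = spectrum t - fourier (\<lambda>x. of_real (G x)) t"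
proof -
  have "spectrum t = fourier (\<lambda>x. of_real (G x) + of_real (gap x)) t" unfolding spectrum_def M_real by simp
  also have "\<dots> = fourier (\<lambda>x. of_real (G x)) t + fourier (\<lambda>x. of_real (gap x)) t"
    by (intro fourier_add integrable_of_real G_integrable gap_integrable)
  finally show ?thesis by simp
qed

lemma fourier_gap_outside: "1 \<le> \<bar>t\<bar> \<Longrightarrow> fourier (\<lambda>x. of_real (gap x)) t = - fourier (\<lambda>x. of_real (G x)) t"
  unfolding fourier_gap by (simp add: spectrum_zero)

lemma norm_fourier_gap_le: "norm (fourier (\<lambda>x. of_real (gap x)) t) \<le> (LBINT x. gap x)"
  using norm_fourier_le[of "\<lambda>x. of_real (gap x)" t] gap_nonneg by simp

text \<open>Split the transform of the gap along \<open>1 = \<kappa> + (1 - \<kappa>)\<close> and invert.  The part with \<open>\<kappa>\<close> is at most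
  \<open>\<integral>\<kappa>\<close> times the supremum of the transform, which is at most the integral of the gap.  The part with \<open>1 - \<kappa>\<close> lives
  where the transform is the negative of that of \<open>G\<close>, so that it has constant sign and its inverse
  transform is largest at the origin; and there inversion bounds it by the first part, because the gap at \<open>0\<close> is
  non-negative.\<close>
lemma gap_le:
  fixes \<kappa> :: "real \<Rightarrow> real"
  assumes k: "test_fun R (\<lambda>t. of_real (\<kappa> t))" and k1: "\<And>t. \<bar>t\<bar> \<le> 1 \<Longrightarrow> \<kappa> t = 1"
    and k01: "\<And>t. 0 \<le> \<kappa> t" "\<And>t. \<kappa> t \<le> 1"
  shows "gap x \<le> 2 * (LBINT t. \<kappa> t) * (LBINT x. gap x)"
proof -
  define K where "K = (LBINT x. gap x)"
  define Dh where "Dh = fourier (\<lambda>x. of_real (gap x))"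
  define Gh where "Gh = fourier (\<lambda>x. of_real (G x))"
  have Gh_int: "integrable lborel Gh" using G_fourier_integrable by (simp add: Gh_def)
  have Dh_int: "integrable lborel Dh"
    unfolding Dh_def fourier_gap[abs_def] by (intro Bochner_Integration.integrable_diff spectrum_integrable G_fourier_integrable)
  have Gh0: "0 \<le> Re (Gh t)" "Im (Gh t) = 0" for t
    using G_fourier_nonneg[of t] by (auto simp: Gh_def complex_nonneg_Reals_iff)
  have ki: "integrable lborel (\<lambda>t. of_real (\<kappa> t) :: complex)" by (rule test_fun_integrable[OF k])
  then have ki': "integrable lborel \<kappa>" by (simp add: complex_of_real_integrable_eq)
  have [measurable]: "\<kappa> \<in> borel_measurable borel" using ki' by (auto dest: borel_measurable_integrable)
  have [measurable]: "Dh \<in> borel_measurable borel" "Gh \<in> borel_measurable borel"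
    using Dh_int Gh_int by (auto dest: borel_measurable_integrable)
  have i1: "integrable lborel (\<lambda>t. Dh t * of_real (\<kappa> t) * cis (2 * pi * t * y))" for y
    by (rule Bochner_Integration.integrable_bound[OF Dh_int]) (use k01 in \<open>auto simp: norm_mult mult_left_le\<close>)
  have i2: "integrable lborel (\<lambda>t. Gh t * of_real (1 - \<kappa> t) * cis (2 * pi * t * y))" for y
    by (rule Bochner_Integration.integrable_bound[OF Gh_int]) (use k01 in \<open>auto simp: norm_mult mult_left_le simp flip: of_real_diff\<close>)
  have inv: "of_real (gap y) = (LBINT t. Dh t * of_real (\<kappa> t) * cis (2 * pi * t * y)) - (LBINT t. Gh t * of_real (1 - \<kappa> t) * cis (2 * pi * t * y))" for y
  proof -
    have "of_real (gap y) = (LBINT t. Dh t * cis (2 * pi * t * y))"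
      unfolding Dh_def using gap_continuous[of UNIV]
      by (intro fourier_inversion integrable_of_real gap_integrable Dh_int[unfolded Dh_def] continuous_of_real)
         (simp add: continuous_on_eq_continuous_at)
    also have "\<dots> = (LBINT t. Dh t * of_real (\<kappa> t) * cis (2 * pi * t * y) - Gh t * of_real (1 - \<kappa> t) * cis (2 * pi * t * y))"
    proof (rule Bochner_Integration.integral_cong[OF refl])
      fix t
      show "Dh t * cis (2 * pi * t * y) = Dh t * of_real (\<kappa> t) * cis (2 * pi * t * y) - Gh t * of_real (1 - \<kappa> t) * cis (2 * pi * t * y)"
      proof (cases "\<bar>t\<bar> \<le> 1")
        case True then show ?thesis by (simp add: k1)
      next
        case False
        then have "Dh t = - Gh t" unfolding Dh_def Gh_def by (intro fourier_gap_outside) simp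
        then show ?thesis by (simp add: algebra_simps)
      qed
    qed
    also have "\<dots> = (LBINT t. Dh t * of_real (\<kappa> t) * cis (2 * pi * t * y)) - (LBINT t. Gh t * of_real (1 - \<kappa> t) * cis (2 * pi * t * y))"
      by (rule Bochner_Integration.integral_diff[OF i1 i2])
    finally show ?thesis .
  qed
  have near: "norm (LBINT t. Dh t * of_real (\<kappa> t) * cis (2 * pi * t * y)) \<le> K * (LBINT t. \<kappa> t)" for y
  proof -
    have "norm (LBINT t. Dh t * of_real (\<kappa> t) * cis (2 * pi * t * y)) \<le> (LBINT t. norm (Dh t * of_real (\<kappa> t) * cis (2 * pi * t * y)))"
      by (rule integral_norm_bound)
    also have "\<dots> \<le> (LBINT t. K * \<kappa> t)"
    proof (rule integral_mono)
      show "integrable lborel (\<lambda>t. norm (Dh t * of_real (\<kappa> t) * cis (2 * pi * t * y)))" using i1 by (rule integrable_norm)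
      show "integrable lborel (\<lambda>t. K * \<kappa> t)" using ki' by simp
      show "norm (Dh t * of_real (\<kappa> t) * cis (2 * pi * t * y)) \<le> K * \<kappa> t" for t
        using norm_fourier_gap_le[of t] k01 unfolding Dh_def K_def by (simp add: norm_mult mult_right_mono)
    qed
    finally show ?thesis by simp
  qed
  have mass: "(LBINT t. Re (Gh t) * (1 - \<kappa> t)) \<le> K * (LBINT t. \<kappa> t)"
  proof -
    have "(LBINT t. Gh t * of_real (1 - \<kappa> t) * cis (2 * pi * t * 0)) = (LBINT t. of_real (Re (Gh t) * (1 - \<kappa> t)))"
      by (rule Bochner_Integration.integral_cong[OF refl]) (use Gh0 in \<open>simp add: complex_eq_iff\<close>)
    also have "\<dots> = of_real (LBINT t. Re (Gh t) * (1 - \<kappa> t))" by (rule integral_complex_of_real)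
    finally have e: "(LBINT t. Gh t * of_real (1 - \<kappa> t) * cis (2 * pi * t * 0)) = of_real (LBINT t. Re (Gh t) * (1 - \<kappa> t))" .
    have "Re (of_real (gap 0)) = Re ((LBINT t. Dh t * of_real (\<kappa> t) * cis (2 * pi * t * 0)) - of_real (LBINT t. Re (Gh t) * (1 - \<kappa> t)))"
      unfolding inv[of 0] e ..
    then have "(LBINT t. Re (Gh t) * (1 - \<kappa> t)) = Re (LBINT t. Dh t * of_real (\<kappa> t) * cis (2 * pi * t * 0)) - gap 0"
      unfolding minus_complex.simps Re_complex_of_real by linarith
    also have "\<dots> \<le> norm (LBINT t. Dh t * of_real (\<kappa> t) * cis (2 * pi * t * 0))"
      using gap_nonneg[of 0] complex_Re_le_cmod[of "\<integral>t. Dh t * of_real (\<kappa> t) * cis (2 * pi * t * 0) \<partial>lborel"] by linarith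
    finally show ?thesis using near[of 0] by linarith
  qed
  have far: "norm (LBINT t. Gh t * of_real (1 - \<kappa> t) * cis (2 * pi * t * x)) \<le> K * (LBINT t. \<kappa> t)"
  proof -
    have "norm (LBINT t. Gh t * of_real (1 - \<kappa> t) * cis (2 * pi * t * x)) \<le> (LBINT t. norm (Gh t * of_real (1 - \<kappa> t) * cis (2 * pi * t * x)))"
      by (rule integral_norm_bound)
    also have "\<dots> = (LBINT t. Re (Gh t) * (1 - \<kappa> t))"
      by (rule Bochner_Integration.integral_cong[OF refl])
         (use k01 Gh0 in \<open>simp add: norm_mult cmod_eq_Re flip: of_real_diff\<close>)
    finally show ?thesis using mass by linarith
  qed
  have "gap x = norm (complex_of_real (gap x))" using gap_nonneg by simp
  also have "\<dots> \<le> K * (LBINT t. \<kappa> t) + K * (LBINT t. \<kappa> t)"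
    unfolding inv by (rule order_trans[OF norm_triangle_ineq4 add_mono[OF near far]])
  finally show ?thesis by (simp add: K_def)
qed

lemma M_int: "M (of_int n) = of_real (G (of_int n))"
  using interpolates by (simp add: interpolates_at_ints_def)

lemma deriv_M_int:
  assumes "n \<noteq> 0"
  shows "deriv M (of_int n) = of_real (deriv G (of_int n))"
proof -
  have "deriv M (of_real (of_int n)) = of_real (deriv G (of_int n))"
    using majorant M_int[of n] assms
    by (intro majorant_touching_deriv M_holomorphic G_differentiable) (auto simp: majorant_def)
  then show ?thesis by simp
qed

text \<open>Touching determines the derivative of \<open>M\<close> at the integers except at \<open>0\<close>, where \<open>G\<close> may have a corner.  The missing
  value is found from the sum of the derivatives, which is zero.\<close>
lemma deriv_M_0: "deriv M 0 = - (\<Sum>k. if int_decode k = 0 then 0 else complex_of_real (deriv G (of_int (int_decode k))))"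
proof -
  let ?s = "\<lambda>k. if k = int_encode 0 then deriv M 0 else 0"
  let ?r = "\<lambda>k. if int_decode k = 0 then 0 else complex_of_real (deriv G (of_int (int_decode k)))"
  have "(\<lambda>k. deriv M (of_int (int_decode k)) - ?s k) sums (0 - deriv M 0)"
    by (intro sums_diff derivative_sum) (use sums_single[of "int_encode 0" "\<lambda>_. deriv M 0"] in simp)
  moreover have "(\<lambda>k. deriv M (of_int (int_decode k)) - ?s k) = ?r"
  proof
    fix k
    have "(k = int_encode 0) = (int_decode k = 0)" by (metis int_decode_inverse int_encode_inverse)
    then show "deriv M (of_int (int_decode k)) - ?s k = ?r k"
      by (cases "int_decode k = 0") (auto simp: deriv_M_int)
  qed
  ultimately have "?r sums (- deriv M 0)" by simp
  then have "- deriv M 0 = (\<Sum>k. ?r k)" by (rule sums_unique)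
  then show ?thesis by (metis minus_minus)
qed

end

section \<open>Superposition of interpolating majorants\<close>

locale majorant_superposition =
  fixes I :: "real set" and G :: "real \<Rightarrow> real \<Rightarrow> real" and M :: "real \<Rightarrow> complex \<Rightarrow> complex" and \<nu> :: "real measure"
  assumes family: "\<And>l. l \<in> I \<Longrightarrow> interpolating_majorant (G l) (M l)"
    and space: "space \<nu> = I"
    and G_measurable: "\<And>x. (\<lambda>l. G l x) \<in> borel_measurable \<nu>"
    and finite_gap: "(\<integral>\<^sup>+l. (\<integral>\<^sup>+x. ennreal (Re (M l (of_real x)) - G l x) \<partial>lborel) \<partial>\<nu>) < \<infinity>"
begin

abbreviation D :: "real \<Rightarrow> real \<Rightarrow> real" where
  "D l \<equiv> interpolating_majorant.gap (G l) (M l)"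

abbreviation K :: "real \<Rightarrow> real" where
  "K l \<equiv> \<integral>x. D l x \<partial>lborel"

lemma D_eq: "l \<in> I \<Longrightarrow> D l x = Re (M l (of_real x)) - G l x"
  by (simp add: interpolating_majorant.gap_def[OF family])

lemmas D_continuous = interpolating_majorant.gap_continuous[OF family]
lemmas D_nonneg = interpolating_majorant.gap_nonneg[OF family]
lemmas D_integrable = interpolating_majorant.gap_integrable[OF family]

lemma K_nonneg: "l \<in> I \<Longrightarrow> 0 \<le> K l"
  by (intro Bochner_Integration.integral_nonneg) (simp add: D_nonneg)

lemma deriv_G_measurable:
  assumes n: "n \<noteq> 0"
  shows "(\<lambda>l. deriv (G l) (real_of_int n)) \<in> borel_measurable \<nu>"
proof (rule borel_measurable_LIMSEQ_real)
  let ?h = "\<lambda>k. inverse (real (Suc k))"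
  show "(\<lambda>l. (G l (of_int n + ?h k) - G l (of_int n)) / ?h k) \<in> borel_measurable \<nu>" for k
    by (intro borel_measurable_divide borel_measurable_diff G_measurable borel_measurable_const)
  fix l assume "l \<in> space \<nu>"
  then have "G l differentiable (at (real_of_int n))"
    using interpolating_majorant.G_differentiable[OF family] n by (simp add: space)
  then have "(\<lambda>h. (G l (of_int n + h) - G l (of_int n)) / h) \<midarrow>0\<rightarrow> deriv (G l) (of_int n)"
    by (simp add: DERIV_deriv_iff_real_differentiable[symmetric] DERIV_def)
  then have "\<forall>X. (\<forall>i. X i \<in> UNIV - {0}) \<longrightarrow> X \<longlonglongrightarrow> 0 \<longrightarrow> ((\<lambda>h. (G l (of_int n + h) - G l (of_int n)) / h) \<circ> X) \<longlonglongrightarrow> deriv (G l) (of_int n)"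
    unfolding tendsto_at_iff_sequentially .
  from this[rule_format, of ?h] show "(\<lambda>k. (G l (of_int n + ?h k) - G l (of_int n)) / ?h k) \<longlonglongrightarrow> deriv (G l) (of_int n)"
    using LIMSEQ_inverse_real_of_nat by (simp add: o_def del: of_nat_Suc)
qed

text \<open>The derivative of \<open>M l\<close> at \<open>n\<close>, expressed through \<open>G l\<close> alone.\<close>
definition M_deriv :: "int \<Rightarrow> real \<Rightarrow> complex" where
  "M_deriv n l = (if n = 0 then - (\<Sum>k. if int_decode k = 0 then 0 else complex_of_real (deriv (G l) (of_int (int_decode k))))
     else of_real (deriv (G l) (of_int n)))"

lemma M_deriv: "l \<in> I \<Longrightarrow> deriv (M l) (of_int n) = M_deriv n l"
  using interpolating_majorant.deriv_M_int[OF family, of l n] interpolating_majorant.deriv_M_0[OF family, of l]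
  by (cases "n = 0") (simp_all add: M_deriv_def)

lemma M_deriv_measurable: "M_deriv n \<in> borel_measurable \<nu>"
proof -
  have m: "(\<lambda>l. complex_of_real (deriv (G l) (of_int n))) \<in> borel_measurable \<nu>" if "n \<noteq> 0" for n
    by (rule measurable_compose[OF deriv_G_measurable[OF that] borel_measurable_of_real])
  have m': "(\<lambda>l. if int_decode k = 0 then 0 else complex_of_real (deriv (G l) (of_int (int_decode k)))) \<in> borel_measurable \<nu>" for k
    using m[of "int_decode k"] by (cases "int_decode k = 0") auto
  have "(\<lambda>l. - (\<Sum>k. if int_decode k = 0 then 0 else complex_of_real (deriv (G l) (of_int (int_decode k))))) \<in> borel_measurable \<nu>"
    by (rule borel_measurable_uminus[OF borel_measurable_suminf[OF m']])
  then show ?thesis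
    unfolding M_deriv_def[abs_def] using m[of n] by (cases "n = 0") auto
qed

text \<open>By \<open>reconstruction\<close>, \<open>M l\<close> is an integral over \<open>t\<close> of a series in the samples of \<open>G l\<close>, and each sample
  depends measurably on \<open>l\<close>.\<close>
lemma M_measurable: "(\<lambda>l. M l (of_real x)) \<in> borel_measurable \<nu>"
proof -
  define a where "a p = (\<Sum>k. complex_of_real (G (fst p) (of_int (int_decode k))) * cis (- (2 * pi * of_int (int_decode k) * snd p)))" for p :: "real \<times> real"
  define b where "b p = (\<Sum>k. M_deriv (int_decode k) (fst p) * cis (- (2 * pi * of_int (int_decode k) * snd p)))" for p :: "real \<times> real"
  define f where "f p = indicator {0..1} (snd p) *\<^sub>R
     ((b p / (2 * pi * \<i>) + of_real (1 - snd p) * a p) * cis (2 * pi * snd p * x) +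
      (of_real (snd p) * a p - b p / (2 * pi * \<i>)) * cis (2 * pi * (snd p - 1) * x))" for p :: "real \<times> real"
  have Gm[measurable]: "(\<lambda>p. G (fst p) y) \<in> borel_measurable (\<nu> \<Otimes>\<^sub>M lborel)" for y
    by (rule measurable_compose[OF measurable_fst G_measurable])
  have Dm[measurable]: "(\<lambda>p. M_deriv n (fst p)) \<in> borel_measurable (\<nu> \<Otimes>\<^sub>M lborel)" for n
    by (rule measurable_compose[OF measurable_fst M_deriv_measurable])
  have [measurable]: "a \<in> borel_measurable (\<nu> \<Otimes>\<^sub>M lborel)" "b \<in> borel_measurable (\<nu> \<Otimes>\<^sub>M lborel)"
    unfolding a_def b_def by (measurable)
  have "f \<in> borel_measurable (\<nu> \<Otimes>\<^sub>M lborel)" unfolding f_def by measurable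
  then have "(\<lambda>l. \<integral>t. f (l, t) \<partial>lborel) \<in> borel_measurable \<nu>"
    by (intro lborel.borel_measurable_lebesgue_integral) simp
  moreover have "M l (of_real x) = (LBINT t. f (l, t))" if l: "l \<in> I" for l
  proof -
    interpret interpolating_majorant "G l" "M l" by (rule family[OF l])
    have "value_sum t = a (l, t)" "derivative_sum_at t = b (l, t)" for t
      unfolding value_sum_def derivative_sum_at_def a_def b_def by (simp_all add: M_int M_deriv[OF l])
    then show ?thesis unfolding reconstruction f_def by simp
  qed
  ultimately show ?thesis
    by (subst measurable_cong[where g="\<lambda>l. \<integral>t. f (l, t) \<partial>lborel"]) (simp_all add: space)
qed

lemma D_measurable: "(\<lambda>l. D l x) \<in> borel_measurable \<nu>"
proof (subst measurable_cong[where g="\<lambda>l. Re (M l (of_real x)) - G l x"])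
  show "(\<lambda>l. Re (M l (of_real x)) - G l x) \<in> borel_measurable \<nu>"
    by (intro borel_measurable_diff G_measurable measurable_compose[OF M_measurable borel_measurable_Re])
qed (simp add: D_eq space)

lemma D_measurable_pair: "(\<lambda>p. D (fst p) (snd p)) \<in> borel_measurable (\<nu> \<Otimes>\<^sub>M lborel)"
proof -
  have "(\<lambda>p. D (fst p) (snd p)) \<in> borel_measurable (\<nu> \<Otimes>\<^sub>M borel)"
    by (rule measurable_caratheodory[OF D_measurable]) (simp add: space D_continuous)
  then show ?thesis by (simp cong: measurable_cong_sets sets_pair_measure_cong)
qed

lemma K_measurable: "K \<in> borel_measurable \<nu>"
  using D_measurable_pair by (intro lborel.borel_measurable_lebesgue_integral) (simp add: split_beta')

lemma nn_integral_D: "l \<in> I \<Longrightarrow> (\<integral>\<^sup>+x. ennreal (D l x) \<partial>lborel) = ennreal (K l)"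
  by (intro nn_integral_eq_integral D_integrable) (simp_all add: D_nonneg)

lemma nn_integral_K: "(\<integral>\<^sup>+l. ennreal (K l) \<partial>\<nu>) = (\<integral>\<^sup>+l. (\<integral>\<^sup>+x. ennreal (Re (M l (of_real x)) - G l x) \<partial>lborel) \<partial>\<nu>)"
proof (rule nn_integral_cong)
  fix l assume "l \<in> space \<nu>"
  then have l: "l \<in> I" by (simp add: space)
  show "ennreal (K l) = (\<integral>\<^sup>+x. ennreal (Re (M l (of_real x)) - G l x) \<partial>lborel)"
    by (simp only: D_eq[OF l, symmetric] nn_integral_D[OF l])
qed

lemma K_integrable: "integrable \<nu> K"
proof (rule integrableI_nonneg)
  show "(\<integral>\<^sup>+l. ennreal (K l) \<partial>\<nu>) < \<infinity>" unfolding nn_integral_K by (rule finite_gap)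
  show "AE l in \<nu>. 0 \<le> K l" by (intro AE_I2) (simp add: space K_nonneg)
qed (rule K_measurable)

text \<open>The constant comes from one fixed cut-off and so is the same for all members of the family.\<close>
lemma D_bound: obtains B where "0 \<le> B" "\<And>l x. l \<in> I \<Longrightarrow> D l x \<le> B * K l"
proof -
  obtain \<eta> \<kappa> :: "real \<Rightarrow> real" where k: "test_fun (1 + 2 * 1) (\<lambda>t. of_real (\<kappa> t))" "\<And>t. \<bar>t\<bar> \<le> 1 \<Longrightarrow> \<kappa> t = 1" "\<And>t. 0 \<le> \<kappa> t" "\<And>t. \<kappa> t \<le> 1"
    by (rule plateau_exists[OF zero_less_one]) blast
  show ?thesis
  proof (rule that)
    show "0 \<le> 2 * (LBINT t. \<kappa> t)" by (simp add: k(3))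
    show "D l x \<le> 2 * (LBINT t. \<kappa> t) * K l" if "l \<in> I" for l x
      by (rule interpolating_majorant.gap_le[OF family[OF that] k])
  qed
qed

definition d :: "real \<Rightarrow> real" where
  "d x = (\<integral>l. D l x \<partial>\<nu>)"

lemma D_integrable_param: "integrable \<nu> (\<lambda>l. D l x)"
proof -
  obtain B where B: "0 \<le> B" "\<And>l x. l \<in> I \<Longrightarrow> D l x \<le> B * K l" by (rule D_bound) blast
  show ?thesis
  proof (rule Bochner_Integration.integrable_bound[OF integrable_mult_right[OF K_integrable, of B] D_measurable])
    show "AE l in \<nu>. norm (D l x) \<le> norm (B * K l)"
      using B D_nonneg K_nonneg by (intro AE_I2) (simp add: space)
  qed
qed

lemma d_nonneg: "0 \<le> d x"
  unfolding d_def by (intro Bochner_Integration.integral_nonneg_AE AE_I2) (simp add: space D_nonneg)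

lemma d_int: "d (of_int n) = 0"
  unfolding d_def by (intro integral_eq_zero_AE AE_I2) (simp add: space interpolating_majorant.gap_int[OF family])

text \<open>Dominated convergence with the majorant \<open>B K\<close>.\<close>
lemma d_continuous: "continuous_on A d"
proof -
  obtain B where B: "0 \<le> B" "\<And>l x. l \<in> I \<Longrightarrow> D l x \<le> B * K l" by (rule D_bound) blast
  have "(\<lambda>n. d (X n)) \<longlonglongrightarrow> d x" if X: "X \<longlonglongrightarrow> x" for X x
    unfolding d_def
  proof (rule integral_dominated_convergence[where w="\<lambda>l. B * K l"])
    show "integrable \<nu> (\<lambda>l. B * K l)" using K_integrable by (rule integrable_mult_right)
    show "AE l in \<nu>. (\<lambda>n. D l (X n)) \<longlonglongrightarrow> D l x"
    proof (intro AE_I2)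
      fix l assume "l \<in> space \<nu>"
      then have "isCont (D l) x" using D_continuous[of l UNIV] by (simp add: space continuous_on_eq_continuous_at)
      then show "(\<lambda>n. D l (X n)) \<longlonglongrightarrow> D l x" using X by (rule isCont_tendsto_compose)
    qed
    show "AE l in \<nu>. norm (D l (X n)) \<le> B * K l" for n
      using B D_nonneg by (intro AE_I2) (simp add: space)
  qed (rule D_measurable)+
  then show ?thesis
    by (intro continuous_at_imp_continuous_on) (auto simp: continuous_at_sequentially o_def)
qed

text \<open>\<open>\<nu>\<close> need not be \<open>\<sigma>\<close>-finite, but the gap vanishes where \<open>K\<close> does, so all integrals of the
  gap can be taken against the finite measure with density \<open>K\<close>.\<close>
definition \<mu> :: "real measure" where
  "\<mu> = density \<nu> (\<lambda>l. ennreal (K l))"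

definition E :: "real \<Rightarrow> real \<Rightarrow> real" where
  "E l x = D l x / K l"

lemma finite_measure_mu: "finite_measure \<mu>"
proof (rule finite_measureI)
  have "emeasure \<mu> (space \<mu>) = (\<integral>\<^sup>+l. ennreal (K l) \<partial>\<nu>)"
    unfolding \<mu>_def using K_measurable
    by (subst emeasure_density) (auto intro!: nn_integral_cong)
  then show "emeasure \<mu> (space \<mu>) \<noteq> \<infinity>" using finite_gap nn_integral_K by simp
qed

lemma K_times_E: "l \<in> I \<Longrightarrow> K l * E l x = D l x"
proof -
  assume l: "l \<in> I"
  obtain B where B: "\<And>l x. l \<in> I \<Longrightarrow> D l x \<le> B * K l" by (rule D_bound) blast
  show ?thesis
    using B[OF l, of x] D_nonneg[OF l, of x] by (cases "K l = 0") (auto simp: E_def)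
qed

lemma E_nonneg: "l \<in> I \<Longrightarrow> 0 \<le> E l x"
  by (simp add: E_def D_nonneg K_nonneg)

lemma space_mu: "space \<mu> = I"
  by (simp add: \<mu>_def space)

lemma sets_mu: "sets \<mu> = sets \<nu>"
  by (simp add: \<mu>_def)

lemma E_measurable_pair: "(\<lambda>p. E (fst p) (snd p)) \<in> borel_measurable (\<mu> \<Otimes>\<^sub>M lborel)"
proof -
  have "(\<lambda>p. E (fst p) (snd p)) \<in> borel_measurable (\<nu> \<Otimes>\<^sub>M lborel)"
    unfolding E_def
    by (intro borel_measurable_divide D_measurable_pair measurable_compose[OF measurable_fst K_measurable])
  then show ?thesis by (simp cong: measurable_cong_sets sets_pair_measure_cong add: sets_mu)
qed

lemma integral_mu:
  fixes h :: "real \<Rightarrow> 'b::{banach, second_countable_topology}"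
  assumes "h \<in> borel_measurable \<nu>"
  shows "(\<integral>l. h l \<partial>\<mu>) = (\<integral>l. K l *\<^sub>R h l \<partial>\<nu>)"
  unfolding \<mu>_def using assms K_measurable
  by (intro integral_density AE_I2) (simp_all add: space K_nonneg)

lemma nn_integral_d: "(\<integral>\<^sup>+x. ennreal (d x) \<partial>lborel) = (\<integral>\<^sup>+l. ennreal (K l) \<partial>\<nu>)"
proof -
  interpret finite_measure \<mu> by (rule finite_measure_mu)
  interpret pair_sigma_finite \<mu> lborel ..
  have Em: "(\<lambda>p. ennreal (E (fst p) (snd p))) \<in> borel_measurable (\<mu> \<Otimes>\<^sub>M lborel)"
    using E_measurable_pair by measurable
  have Em1: "(\<lambda>l. E l x) \<in> borel_measurable \<nu>" for x
    unfolding E_def by (intro borel_measurable_divide D_measurable K_measurable)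
  have "ennreal (d x) = (\<integral>\<^sup>+l. ennreal (E l x) \<partial>\<mu>)" for x
  proof -
    have "ennreal (d x) = (\<integral>\<^sup>+l. ennreal (D l x) \<partial>\<nu>)"
      unfolding d_def by (intro nn_integral_eq_integral[symmetric] D_integrable_param AE_I2) (simp add: space D_nonneg)
    also have "\<dots> = (\<integral>\<^sup>+l. ennreal (K l) * ennreal (E l x) \<partial>\<nu>)"
      by (intro nn_integral_cong) (simp add: space K_nonneg E_nonneg K_times_E flip: ennreal_mult)
    also have "\<dots> = (\<integral>\<^sup>+l. ennreal (E l x) \<partial>\<mu>)"
      unfolding \<mu>_def using K_measurable Em1 by (intro nn_integral_density[symmetric]) auto
    finally show ?thesis .
  qed
  then have "(\<integral>\<^sup>+x. ennreal (d x) \<partial>lborel) = (\<integral>\<^sup>+x. (\<integral>\<^sup>+l. ennreal (E l x) \<partial>\<mu>) \<partial>lborel)" by simp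
  also have "\<dots> = (\<integral>\<^sup>+l. (\<integral>\<^sup>+x. ennreal (E l x) \<partial>lborel) \<partial>\<mu>)"
    using Fubini[OF Em] by simp
  also have "\<dots> = (\<integral>\<^sup>+l. ennreal (K l) * (\<integral>\<^sup>+x. ennreal (E l x) \<partial>lborel) \<partial>\<nu>)"
    unfolding \<mu>_def
  proof (rule nn_integral_density)
    show "(\<lambda>l. ennreal (K l)) \<in> borel_measurable \<nu>" using K_measurable by measurable
    have "(\<lambda>l. \<integral>\<^sup>+x. ennreal (E l x) \<partial>lborel) \<in> borel_measurable \<mu>"
      using Em by (intro lborel.borel_measurable_nn_integral) (simp add: split_beta')
    then show "(\<lambda>l. \<integral>\<^sup>+x. ennreal (E l x) \<partial>lborel) \<in> borel_measurable \<nu>"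
      by (simp cong: measurable_cong_sets add: sets_mu)
  qed
  also have "\<dots> = (\<integral>\<^sup>+l. ennreal (K l) \<partial>\<nu>)"
  proof (intro nn_integral_cong)
    fix l assume "l \<in> space \<nu>"
    then have l: "l \<in> I" by (simp add: space)
    have [measurable]: "E l \<in> borel_measurable borel"
      unfolding E_def[abs_def] using D_integrable[OF l] by (auto dest: borel_measurable_integrable)
    have "ennreal (K l) * (\<integral>\<^sup>+x. ennreal (E l x) \<partial>lborel) = (\<integral>\<^sup>+x. ennreal (K l) * ennreal (E l x) \<partial>lborel)"
      by (intro nn_integral_cmult[symmetric]) simp
    also have "\<dots> = (\<integral>\<^sup>+x. ennreal (D l x) \<partial>lborel)"
      by (intro nn_integral_cong) (simp add: l K_nonneg E_nonneg K_times_E flip: ennreal_mult)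
    also have "\<dots> = ennreal (K l)" by (rule nn_integral_D[OF l])
    finally show "ennreal (K l) * (\<integral>\<^sup>+x. ennreal (E l x) \<partial>lborel) = ennreal (K l)" .
  qed
  finally show ?thesis .
qed

lemma d_integrable: "integrable lborel d"
proof (rule integrableI_nonneg)
  show "(\<integral>\<^sup>+x. ennreal (d x) \<partial>lborel) < \<infinity>" unfolding nn_integral_d nn_integral_K by (rule finite_gap)
  show "d \<in> borel_measurable lborel" using borel_measurable_continuous_onI[OF d_continuous] by simp
qed (simp add: d_nonneg)

lemma fourier_d: "fourier (\<lambda>x. of_real (d x)) t = (\<integral>l. fourier (\<lambda>x. of_real (D l x)) t \<partial>\<nu>)"
proof -
  interpret finite_measure \<mu> by (rule finite_measure_mu)
  interpret pair_sigma_finite \<mu> lborel ..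
  let ?f = "\<lambda>l x. complex_of_real (E l x) * cis (- (2 * pi * x * t))"
  have Em1: "(\<lambda>l. E l x) \<in> borel_measurable \<nu>" for x
    unfolding E_def by (intro borel_measurable_divide D_measurable K_measurable)
  have fm: "(\<lambda>p. ?f (fst p) (snd p)) \<in> borel_measurable (\<mu> \<Otimes>\<^sub>M lborel)"
    using E_measurable_pair by measurable
  have Ei: "integrable lborel (E l)" if "l \<in> I" for l
    unfolding E_def[abs_def] using D_integrable[OF that] by simp
  have int: "integrable (\<mu> \<Otimes>\<^sub>M lborel) (case_prod ?f)"
  proof (rule Fubini_integrable)
    show "case_prod ?f \<in> borel_measurable (\<mu> \<Otimes>\<^sub>M lborel)" using fm by (simp add: split_beta')
    show "integrable \<mu> (\<lambda>l. \<integral>x. norm (case (l, x) of (l, x) \<Rightarrow> ?f l x) \<partial>lborel)"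
    proof (rule integrable_const_bound[of _ 1])
      show "AE l in \<mu>. norm (LBINT x. norm (case (l, x) of (l, x) \<Rightarrow> ?f l x)) \<le> 1"
      proof (intro AE_I2)
        fix l assume "l \<in> space \<mu>"
        then have l: "l \<in> I" by (simp add: space_mu)
        have "(LBINT x. norm (case (l, x) of (l, x) \<Rightarrow> ?f l x)) = K l / K l"
          using E_nonneg[OF l] by (simp add: norm_mult) (simp add: E_def)
        then show "norm (LBINT x. norm (case (l, x) of (l, x) \<Rightarrow> ?f l x)) \<le> 1" by (cases "K l = 0") simp_all
      qed
      show "(\<lambda>l. \<integral>x. norm (case (l, x) of (l, x) \<Rightarrow> ?f l x) \<partial>lborel) \<in> borel_measurable \<mu>"
        using fm by (intro lborel.borel_measurable_lebesgue_integral) (simp add: split_beta')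
    qed
    show "AE l in \<mu>. integrable lborel (\<lambda>x. case (l, x) of (l, x) \<Rightarrow> ?f l x)"
      by (intro AE_I2) (simp add: space_mu Ei integrable_mult_cis)
  qed
  have Fm: "(\<lambda>l. \<integral>x. ?f l x \<partial>lborel) \<in> borel_measurable \<nu>"
  proof -
    have "(\<lambda>l. \<integral>x. ?f l x \<partial>lborel) \<in> borel_measurable \<mu>"
      using fm by (intro lborel.borel_measurable_lebesgue_integral) (simp add: split_beta')
    then show ?thesis by (simp cong: measurable_cong_sets add: sets_mu)
  qed
  have "of_real (d x) = (\<integral>l. complex_of_real (E l x) \<partial>\<mu>)" for x
  proof -
    have "(\<integral>l. E l x \<partial>\<mu>) = (\<integral>l. K l *\<^sub>R E l x \<partial>\<nu>)" by (rule integral_mu[OF Em1])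
    also have "\<dots> = d x" unfolding d_def
      by (rule Bochner_Integration.integral_cong[OF refl]) (simp add: space K_times_E)
    finally show ?thesis by simp
  qed
  then have "fourier (\<lambda>x. of_real (d x)) t = (LBINT x. (\<integral>l. ?f l x \<partial>\<mu>))"
    unfolding fourier_cis by simp
  also have "\<dots> = (\<integral>l. (LBINT x. ?f l x) \<partial>\<mu>)"
    by (rule Fubini_integral[OF int])
  also have "\<dots> = (\<integral>l. K l *\<^sub>R (LBINT x. ?f l x) \<partial>\<nu>)"
    by (rule integral_mu[OF Fm])
  also have "\<dots> = (\<integral>l. fourier (\<lambda>x. of_real (D l x)) t \<partial>\<nu>)"
  proof (rule Bochner_Integration.integral_cong[OF refl])
    fix l assume "l \<in> space \<nu>"
    then have l: "l \<in> I" by (simp add: space)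
    have "K l *\<^sub>R (LBINT x. ?f l x) = (LBINT x. K l *\<^sub>R ?f l x)" by (rule integral_scaleR_right[symmetric])
    also have "\<dots> = fourier (\<lambda>x. of_real (D l x)) t"
      unfolding fourier_cis
    proof (rule Bochner_Integration.integral_cong[OF refl])
      fix x
      have "complex_of_real (K l) * complex_of_real (E l x) = of_real (D l x)"
        by (simp only: K_times_E[OF l] flip: of_real_mult)
      then show "K l *\<^sub>R ?f l x = of_real (D l x) * cis (- (2 * pi * x * t))"
        by (simp only: scaleR_conv_of_real mult.assoc[symmetric])
    qed
    finally show "K l *\<^sub>R (LBINT x. ?f l x) = fourier (\<lambda>x. of_real (D l x)) t" .
  qed
  finally show ?thesis .
qed

lemma fourier_d_outside:
  assumes "1 \<le> \<bar>t\<bar>"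
  shows "fourier (\<lambda>x. of_real (d x)) t = - (\<integral>l. fourier (\<lambda>x. of_real (G l x)) t \<partial>\<nu>)"
proof -
  have "fourier (\<lambda>x. of_real (d x)) t = (\<integral>l. - fourier (\<lambda>x. of_real (G l x)) t \<partial>\<nu>)"
    unfolding fourier_d
    by (rule Bochner_Integration.integral_cong[OF refl])
       (use assms in \<open>simp add: space interpolating_majorant.fourier_gap_outside[OF family]\<close>)
  then show ?thesis by simp
qed

end

section \<open>Tempered distributions and integrable perturbations\<close>

lemma schwartz_continuous: "schwartz \<phi> \<Longrightarrow> continuous_on UNIV \<phi>"
  unfolding schwartz_def
  by (metis nth_vderiv_0 differentiable_imp_continuous_within continuous_at_imp_continuous_on)

lemma schwartz_seminorm_bdd:
  assumes "schwartz \<phi>"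
  shows "bdd_above (range (\<lambda>x. norm (x ^ k *\<^sub>R nth_vderiv n \<phi> x)))"
  using assms unfolding schwartz_def by (auto simp: bounded_iff bdd_above_def)

lemma schwartz_seminorm_nonneg: "schwartz \<phi> \<Longrightarrow> 0 \<le> schwartz_seminorm k n \<phi>"
  unfolding schwartz_seminorm_def
  by (rule order_trans[OF norm_ge_zero cSUP_upper[OF UNIV_I schwartz_seminorm_bdd]])

lemma norm_schwartz_le: "schwartz \<phi> \<Longrightarrow> norm (\<phi> x) \<le> schwartz_seminorm 0 0 \<phi>"
  using cSUP_upper[OF UNIV_I schwartz_seminorm_bdd[of \<phi> 0 0], of x] by (simp add: schwartz_seminorm_def)

lemma integrable_times_schwartz:
  fixes d :: "real \<Rightarrow> real"
  assumes d: "integrable lborel d" and p: "schwartz \<phi>"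
  shows "integrable lborel (\<lambda>x. of_real (d x) * \<phi> x)"
proof (rule Bochner_Integration.integrable_bound[OF integrable_mult_right[OF d, of "schwartz_seminorm 0 0 \<phi>"]])
  have "\<phi> \<in> borel_measurable borel" by (rule borel_measurable_continuous_onI[OF schwartz_continuous[OF p]])
  then show "(\<lambda>x. of_real (d x) * \<phi> x) \<in> borel_measurable lborel"
    using d by (auto dest: borel_measurable_integrable)
  show "AE x in lborel. norm (of_real (d x) * \<phi> x) \<le> norm (schwartz_seminorm 0 0 \<phi> * d x)"
  proof (intro AE_I2)
    fix x
    have "\<bar>d x\<bar> * norm (\<phi> x) \<le> \<bar>d x\<bar> * schwartz_seminorm 0 0 \<phi>"
      by (intro mult_left_mono norm_schwartz_le p) simp
    then show "norm (of_real (d x) * \<phi> x) \<le> norm (schwartz_seminorm 0 0 \<phi> * d x)"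
      using schwartz_seminorm_nonneg[OF p] by (simp add: norm_mult abs_mult mult.commute)
  qed
qed

lemma pairing_add_integrable:
  assumes g: "defines_tempered_distribution g" and d: "integrable lborel d" and p: "schwartz \<phi>"
  shows "pairing (\<lambda>x. g x + d x) \<phi> = pairing g \<phi> + pairing d \<phi>"
  unfolding pairing_def using pairing_integrable[OF g p] integrable_times_schwartz[OF d p]
  by (simp add: distrib_right)

lemma tempered_add_integrable:
  assumes g: "defines_tempered_distribution g" and d: "integrable lborel d"
  shows "defines_tempered_distribution (\<lambda>x. g x + d x)"
  unfolding defines_tempered_distribution_def
proof (intro conjI allI impI)
  fix \<phi> assume p: "schwartz \<phi>"
  show "integrable lborel (\<lambda>x. of_real (g x + d x) * \<phi> x)"
    using Bochner_Integration.integrable_add[OF pairing_integrable[OF g p] integrable_times_schwartz[OF d p]]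
    by (simp add: distrib_right)
next
  obtain C N where C: "\<And>\<phi>. schwartz \<phi> \<Longrightarrow> norm (pairing g \<phi>) \<le> C * (\<Sum>k\<le>N. \<Sum>n\<le>N. schwartz_seminorm k n \<phi>)"
    using g unfolding defines_tempered_distribution_def by blast
  define L where "L = (LBINT x. norm (d x))"
  have L: "0 \<le> L" by (simp add: L_def)
  have "norm (pairing (\<lambda>x. g x + d x) \<phi>) \<le> (C + L) * (\<Sum>k\<le>N. \<Sum>n\<le>N. schwartz_seminorm k n \<phi>)" if p: "schwartz \<phi>" for \<phi>
  proof -
    let ?S = "\<Sum>k\<le>N. \<Sum>n\<le>N. schwartz_seminorm k n \<phi>"
    have s0: "schwartz_seminorm 0 0 \<phi> \<le> ?S"
    proof -
      have "schwartz_seminorm 0 0 \<phi> \<le> (\<Sum>n\<le>N. schwartz_seminorm 0 n \<phi>)"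
        using schwartz_seminorm_nonneg[OF p] by (intro member_le_sum) auto
      also have "\<dots> \<le> ?S"
        using schwartz_seminorm_nonneg[OF p] by (intro member_le_sum[of 0 "{..N}" "\<lambda>k. \<Sum>n\<le>N. schwartz_seminorm k n \<phi>"] sum_nonneg) auto
      finally show ?thesis .
    qed
    have "norm (pairing d \<phi>) \<le> (LBINT x. norm (of_real (d x) * \<phi> x))"
      unfolding pairing_def by (rule integral_norm_bound)
    also have "\<dots> \<le> (LBINT x. norm (d x) * schwartz_seminorm 0 0 \<phi>)"
    proof (rule integral_mono)
      show "integrable lborel (\<lambda>x. norm (of_real (d x) * \<phi> x))" by (rule integrable_norm[OF integrable_times_schwartz[OF d p]])
      show "integrable lborel (\<lambda>x. norm (d x) * schwartz_seminorm 0 0 \<phi>)" using d by simp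
      show "norm (of_real (d x) * \<phi> x) \<le> norm (d x) * schwartz_seminorm 0 0 \<phi>" for x
        using norm_schwartz_le[OF p, of x] by (simp add: norm_mult mult_left_mono)
    qed
    also have "\<dots> = L * schwartz_seminorm 0 0 \<phi>" by (simp add: L_def)
    also have "\<dots> \<le> L * ?S" using L s0 by (intro mult_left_mono)
    finally have "norm (pairing g \<phi> + pairing d \<phi>) \<le> C * ?S + L * ?S"
      using C[OF p] norm_triangle_ineq[of "pairing g \<phi>" "pairing d \<phi>"] by linarith
    then show ?thesis unfolding pairing_add_integrable[OF g d p] distrib_right .
  qed
  then show "\<exists>C N. \<forall>\<phi>. schwartz \<phi> \<longrightarrow> norm (pairing (\<lambda>x. g x + d x) \<phi>) \<le> C * (\<Sum>k\<le>N. \<Sum>n\<le>N. schwartz_seminorm k n \<phi>)"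
    by blast
qed

section \<open>Extremality\<close>

text \<open>By Poisson summation the integrals of two majorants at finite distance from \<open>g\<close> differ by the sum of the differences of their values
  at the integers, where \<open>m\<close> is as small as a majorant can be.  In case of equality \<open>H\<close> also
  touches \<open>g\<close> at all integers, so \<open>H\<close> and \<open>m\<close> have the same derivatives at the
  non-zero ones.\<close>
lemma interpolating_majorant_is_extremal:
  assumes g: "continuous_on UNIV g" "\<And>x. x \<noteq> 0 \<Longrightarrow> g differentiable (at x)"
    and m: "majorant (2 * pi) g m" "interpolates_at_ints g m"
    and fin: "(\<integral>\<^sup>+x. ennreal \<bar>Re (m (of_real x)) - g x\<bar> \<partial>lborel) < \<infinity>"
    and H: "majorant (2 * pi) g H"
  shows "(\<integral>\<^sup>+x. ennreal \<bar>Re (m (of_real x)) - g x\<bar> \<partial>lborel) \<le> (\<integral>\<^sup>+x. ennreal \<bar>Re (H (of_real x)) - g x\<bar> \<partial>lborel)"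
    and "(\<integral>\<^sup>+x. ennreal \<bar>Re (H (of_real x)) - g x\<bar> \<partial>lborel) = (\<integral>\<^sup>+x. ennreal \<bar>Re (m (of_real x)) - g x\<bar> \<partial>lborel) \<Longrightarrow> H = m"
proof -
  let ?d = "\<lambda>F x. Re (F (complex_of_real x)) - g x"
  have hol: "F holomorphic_on UNIV" if "majorant (2 * pi) g F" for F
    using that by (simp add: majorant_def exp_type_at_most_def)
  have cont: "continuous_on UNIV (?d F)" if "majorant (2 * pi) g F" for F
    by (intro continuous_intros g continuous_on_compose2[OF holomorphic_on_imp_continuous_on[OF hol[OF that]]]) auto
  have nn: "0 \<le> ?d F x" if "majorant (2 * pi) g F" for F x
    using that by (simp add: majorant_def)
  have intI: "integrable lborel (?d F)" if "majorant (2 * pi) g F" "(\<integral>\<^sup>+x. ennreal \<bar>?d F x\<bar> \<partial>lborel) < \<infinity>" for F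
    using that(2) borel_measurable_continuous_onI[OF cont[OF that(1)]] by (intro integrableI_bounded) auto
  have nni: "(\<integral>\<^sup>+x. ennreal \<bar>?d F x\<bar> \<partial>lborel) = ennreal (LBINT x. ?d F x)"
    if "majorant (2 * pi) g F" "integrable lborel (?d F)" for F
    using nn[OF that(1)] nn_integral_eq_integral[OF that(2)] by simp
  have main: "(LBINT x. ?d m x) \<le> (LBINT x. ?d H x) \<and> ((LBINT x. ?d H x) = (LBINT x. ?d m x) \<longrightarrow> H = m)"
    if finH: "integrable lborel (?d H)"
  proof -
    have mi: "integrable lborel (?d m)" by (rule intI[OF m(1) fin])
    have real: "H (of_real x) - m (of_real x) = of_real (?d H x - ?d m x)" for x
      using H m(1) by (auto simp: majorant_def complex_eq_iff complex_is_Real_iff)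
    interpret F: integrable_exp_type "\<lambda>z. H z - m z"
    proof
      show "exp_type_at_most (2 * pi) (\<lambda>z. H z - m z)"
        using exp_type_add[OF _ exp_type_uminus, of "2 * pi" H m] H m(1) by (simp add: majorant_def)
      show "integrable lborel (\<lambda>x. H (of_real x) - m (of_real x))"
        unfolding real by (intro integrable_of_real Bochner_Integration.integrable_diff finH mi)
    qed
    have m0: "?d m (of_int n) = 0" for n :: int
      using m(2) unfolding interpolates_at_ints_def by (metis Re_complex_of_real diff_self of_real_of_int_eq)
    have at_int: "H (of_int n) - m (of_int n) = of_real (?d H (of_int n))" for n :: int
      using real[of "of_int n"] unfolding m0 by simp
    let ?s = "\<lambda>k. ?d H (of_int (int_decode k))"
    have "(LBINT x. H (of_real x) - m (of_real x)) = of_real ((LBINT x. ?d H x) - (LBINT x. ?d m x))"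
      unfolding real integral_complex_of_real Bochner_Integration.integral_diff[OF finH mi] ..
    then have "(\<lambda>k. complex_of_real (?s k)) sums of_real ((LBINT x. ?d H x) - (LBINT x. ?d m x))"
      using F.poisson_sum unfolding at_int by simp
    then have s: "?s sums ((LBINT x. ?d H x) - (LBINT x. ?d m x))"
      by (simp only: sums_of_real_iff)
    have s0: "0 \<le> ?s k" for k by (rule nn[OF H])
    have "0 \<le> (LBINT x. ?d H x) - (LBINT x. ?d m x)"
      using suminf_nonneg[OF sums_summable[OF s] s0] sums_unique[OF s] by simp
    moreover have "H = m" if "(LBINT x. ?d H x) = (LBINT x. ?d m x)"
    proof -
      have "?s sums 0" using s that by simp
      then have "(\<forall>k. ?s k = 0)"
        using suminf_eq_zero_iff[OF sums_summable[OF s] s0] sums_unique by fastforce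
      then have H0: "?d H (of_int n) = 0" for n :: int
        by (metis int_encode_inverse)
      have "(\<lambda>z. H z - m z) = (\<lambda>_. 0)"
      proof (rule F.zero_if_samples_zero)
        show "H (of_int n) - m (of_int n) = 0" for n :: int unfolding at_int H0 by simp
        fix n :: int assume n: "n \<noteq> 0"
        have t: "deriv F (of_real (of_int n)) = of_real (deriv g (of_int n))"
          if "majorant (2 * pi) g F" "?d F (of_int n) = 0" for F
          using that n by (intro majorant_touching_deriv hol g) (auto simp: majorant_def)
        have "deriv (\<lambda>z. H z - m z) (of_int n) = deriv H (of_int n) - deriv m (of_int n)"
          by (intro deriv_diff holomorphic_on_imp_differentiable_at[OF hol] H m(1)) auto
        also have "\<dots> = 0" using t[OF H H0] t[OF m(1) m0] by simp
        finally show "deriv (\<lambda>z. H z - m z) (of_int n) = 0" .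
      qed
      then show ?thesis by (simp add: fun_eq_iff)
    qed
    ultimately show ?thesis by simp
  qed
  have mi: "integrable lborel (?d m)" by (rule intI[OF m(1) fin])
  show "(\<integral>\<^sup>+x. ennreal \<bar>?d m x\<bar> \<partial>lborel) \<le> (\<integral>\<^sup>+x. ennreal \<bar>?d H x\<bar> \<partial>lborel)"
  proof (cases "(\<integral>\<^sup>+x. ennreal \<bar>?d H x\<bar> \<partial>lborel) < \<infinity>")
    case True
    then have hi: "integrable lborel (?d H)" by (rule intI[OF H])
    show ?thesis unfolding nni[OF m(1) mi] nni[OF H hi] using main[OF hi] by (simp add: ennreal_leI)
  qed (simp add: not_less top_unique)
  assume eq: "(\<integral>\<^sup>+x. ennreal \<bar>?d H x\<bar> \<partial>lborel) = (\<integral>\<^sup>+x. ennreal \<bar>?d m x\<bar> \<partial>lborel)"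
  then have hi: "integrable lborel (?d H)" using fin by (intro intI[OF H]) simp
  have "(LBINT x. ?d H x) = (LBINT x. ?d m x)"
    using eq unfolding nni[OF m(1) mi] nni[OF H hi]
    by (subst (asm) ennreal_inj) (auto intro!: Bochner_Integration.integral_nonneg nn H m(1))
  then show "H = m" using main[OF hi] by simp
qed

lemma majorant_family_interpolating_majorant:
  assumes fam: "majorant_family I G" and l: "l \<in> I"
    and M: "extremal_majorant (2 * pi) (G l) M" "interpolates_at_ints (G l) M"
  shows "interpolating_majorant (G l) M"
proof -
  have a: "continuous_on UNIV (G l)" "\<And>x. x \<noteq> 0 \<Longrightarrow> G l differentiable (at x)"
    "\<And>t. fourier (\<lambda>x. of_real (G l x)) t \<in> \<real>\<^sub>\<ge>\<^sub>0"
    "\<exists>!F. extremal_majorant (2 * pi) (G l) F \<and> interpolates_at_ints (G l) F"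
    using fam l unfolding majorant_family_def by blast+
  obtain C e where C: "C > 0" "e > 0" "\<And>x. \<bar>G l x\<bar> \<le> C * (1 + \<bar>x\<bar>) powr (- 1 - e)"
    "\<And>t. norm (fourier (\<lambda>x. of_real (G l x)) t) \<le> C * (1 + \<bar>t\<bar>) powr (- 1 - e)"
    using fam l unfolding majorant_family_def by blast
  have Gi: "integrable lborel (G l)"
    using C borel_measurable_continuous_onI[OF a(1)] by (intro integrable_of_decay[of _ e C]) auto
  show ?thesis
  proof
    show "integrable lborel (fourier (\<lambda>x. of_real (G l x)))"
      using C borel_measurable_fourier[OF integrable_of_real[OF Gi]] by (intro integrable_of_decay[of _ e C]) auto
    show "majorant (2 * pi) (G l) M" using M(1) by (simp add: extremal_majorant_def)
    show "(\<integral>\<^sup>+x. ennreal \<bar>Re (M (of_real x)) - G l x\<bar> \<partial>lborel) < \<infinity>"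
      by (rule unique_interpolating_extremal_finite[OF a(4) M])
  qed (use a Gi M in auto)
qed

text \<open>The candidate is \<open>u = g + d\<close>.  Off \<open>[-1, 1]\<close> its spectrum is zero: there the transform of \<open>d\<close> is the negative of the
  density that represents the transform of \<open>g\<close>.\<close>
theorem theorem15:
  fixes I :: "real set"
    and G :: "real \<Rightarrow> real \<Rightarrow> real"
    and M :: "real \<Rightarrow> complex \<Rightarrow> complex"
    and \<nu> :: "real measure"
    and g :: "real \<Rightarrow> real"
  assumes "is_interval I"
    and "majorant_family I G"
    and "\<And>lam. lam \<in> I \<Longrightarrow>
           extremal_majorant (2 * pi) (G lam) (M lam) \<and> interpolates_at_ints (G lam) (M lam)"
    and "sets \<nu> = sets (restrict_space borel I)"
    and "\<And>x. (\<lambda>lam. G lam x) \<in> borel_measurable \<nu>"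
    and "(\<integral>\<^sup>+lam. (\<integral>\<^sup>+x. ennreal (Re (M lam (of_real x)) - G lam x) \<partial>lborel) \<partial>\<nu>) < \<infinity>"
    and "defines_tempered_distribution g"
    and "continuous_on UNIV g"
    and "\<And>x. x \<noteq> 0 \<Longrightarrow> g differentiable (at x)"
    and "\<And>\<phi>. schwartz \<phi> \<Longrightarrow> closure {x. \<phi> x \<noteq> 0} \<subseteq> {..< - 1} \<union> {1 <..} \<Longrightarrow>
           distr_fourier g \<phi> =
             (\<integral>t. (\<integral>lam. fourier (\<lambda>x. of_real (G lam x)) t \<partial>\<nu>) * \<phi> t \<partial>lborel)"
  shows "(\<exists>!m. extremal_majorant (2 * pi) g m) \<and>
         (\<forall>m. extremal_majorant (2 * pi) g m \<longrightarrow>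
            interpolates_at_ints g m \<and>
            (\<integral>\<^sup>+x. ennreal (Re (m (of_real x)) - g x) \<partial>lborel) =
              (\<integral>\<^sup>+lam. (\<integral>\<^sup>+x. ennreal (Re (M lam (of_real x)) - G lam x) \<partial>lborel) \<partial>\<nu>))"
proof -
  interpret majorant_superposition I G M \<nu>
  proof (rule majorant_superposition.intro)
    show "interpolating_majorant (G l) (M l)" if "l \<in> I" for l
      using majorant_family_interpolating_majorant[OF assms(2) that] assms(3)[OF that] by blast
    show "space \<nu> = I" using sets_eq_imp_space_eq[OF assms(4)] by (simp add: space_restrict_space)
  qed (rule assms)+
  define u where "u x = g x + d x" for x
  have u_cont: "continuous_on UNIV u" unfolding u_def by (intro continuous_on_add assms(8) d_continuous)
  have u_temp: "defines_tempered_distribution u" unfolding u_def by (rule tempered_add_integrable[OF assms(7) d_integrable])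
  have spec: "distr_fourier u \<phi> = 0" if p: "test_fun R \<phi>" and supp: "closure {x. \<phi> x \<noteq> 0} \<subseteq> {..< - 1} \<union> {1 <..}" for \<phi> R
  proof -
    have "pairing d (fourier \<phi>) = (\<integral>t. fourier (\<lambda>x. of_real (d x)) t * \<phi> t \<partial>lborel)"
      unfolding pairing_def by (rule fourier_multiplication[OF integrable_of_real[OF d_integrable] test_fun_integrable[OF p]])
    also have "\<dots> = (\<integral>t. - ((\<integral>lam. fourier (\<lambda>x. of_real (G lam x)) t \<partial>\<nu>) * \<phi> t) \<partial>lborel)"
    proof (rule Bochner_Integration.integral_cong[OF refl])
      fix t
      show "fourier (\<lambda>x. of_real (d x)) t * \<phi> t = - ((\<integral>lam. fourier (\<lambda>x. of_real (G lam x)) t \<partial>\<nu>) * \<phi> t)"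
      proof (cases "\<phi> t = 0")
        case False
        then have "t \<in> closure {x. \<phi> x \<noteq> 0}" by (intro subsetD[OF closure_subset]) simp
        then have "t \<in> {..< - 1} \<union> {1 <..}" by (rule subsetD[OF supp])
        then have "1 \<le> \<bar>t\<bar>" by auto
        then show ?thesis by (simp add: fourier_d_outside)
      qed simp
    qed
    also have "\<dots> = - distr_fourier g \<phi>" unfolding assms(10)[OF schwartz_test_fun[OF p] supp] by simp
    finally show ?thesis
      unfolding distr_fourier_def u_def pairing_add_integrable[OF assms(7) d_integrable schwartz_fourier[OF p]]
      by simp
  qed
  obtain m where m: "exp_type_at_most (2 * pi) m" "\<And>x. m (of_real x) = of_real (u x)"
  proof (rule paley_wiener_tempered[OF u_cont u_temp])
    show "distr_fourier u \<phi> = 0" if "test_fun R \<phi>" "closure {x. \<phi> x \<noteq> 0} \<subseteq> {..< - 1} \<union> {1 <..}" for \<phi> R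
      by (rule spec[OF that])
  qed blast
  have maj: "majorant (2 * pi) g m"
    unfolding majorant_def using m d_nonneg by (auto simp: u_def)
  have dm: "Re (m (of_real x)) - g x = d x" for x by (simp add: m(2) u_def)
  have interp: "interpolates_at_ints g m"
    unfolding interpolates_at_ints_def
  proof
    fix n :: int
    show "m (of_int n) = of_real (g (of_int n))"
      using m(2)[of "of_int n"] d_int[of n] by (simp add: u_def)
  qed
  have val: "(\<integral>\<^sup>+x. ennreal (Re (m (of_real x)) - g x) \<partial>lborel) =
      (\<integral>\<^sup>+lam. (\<integral>\<^sup>+x. ennreal (Re (M lam (of_real x)) - G lam x) \<partial>lborel) \<partial>\<nu>)"
    unfolding dm nn_integral_d nn_integral_K ..
  have fin: "(\<integral>\<^sup>+x. ennreal \<bar>Re (m (of_real x)) - g x\<bar> \<partial>lborel) < \<infinity>"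
    using assms(6) unfolding val[symmetric] dm by (simp add: d_nonneg)
  have minimal: "(\<integral>\<^sup>+x. ennreal \<bar>Re (m (of_real x)) - g x\<bar> \<partial>lborel) \<le> (\<integral>\<^sup>+x. ennreal \<bar>Re (H (of_real x)) - g x\<bar> \<partial>lborel)"
    if "majorant (2 * pi) g H" for H
    by (rule interpolating_majorant_is_extremal(1)[OF assms(8) _ maj interp fin that]) (rule assms(9))
  have minimal_unique: "H = m" if "majorant (2 * pi) g H"
    "(\<integral>\<^sup>+x. ennreal \<bar>Re (H (of_real x)) - g x\<bar> \<partial>lborel) = (\<integral>\<^sup>+x. ennreal \<bar>Re (m (of_real x)) - g x\<bar> \<partial>lborel)" for H
    by (rule interpolating_majorant_is_extremal(2)[OF assms(8) _ maj interp fin that]) (rule assms(9))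
  have extremal: "extremal_majorant (2 * pi) g m"
    unfolding extremal_majorant_def using maj minimal by blast
  have unique: "H = m" if "extremal_majorant (2 * pi) g H" for H
  proof (rule minimal_unique)
    show H: "majorant (2 * pi) g H" using that by (simp add: extremal_majorant_def)
    show "(\<integral>\<^sup>+x. ennreal \<bar>Re (H (of_real x)) - g x\<bar> \<partial>lborel) = (\<integral>\<^sup>+x. ennreal \<bar>Re (m (of_real x)) - g x\<bar> \<partial>lborel)"
      using that maj minimal[OF H] unfolding extremal_majorant_def by (intro antisym) blast+
  qed
  show ?thesis
    using extremal unique interp val by blast
qed

end
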